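(* Let $\theta,\kappa,\sigma>0$ satisfy $\sigma^2\le 4\theta\kappa$, let $T>0$, and for $x\ge 0$ let $X_t(x)=X^x_t$, $t\in[0,T]$, be the CIR process with these coefficients starting at $x$, i.e. the solution of $$X^x_t=x+\int_0^t\theta(\kappa-X^x_s)\,ds+\int_0^t\sigma\sqrt{X^x_s}\,dB_s,\qquad t\in[0,T].$$ Let $f\in C^q_{\mathrm{pol}}(\mathbb{R}_+)$ for some integer $q\ge 4$, and define $$u(t,x):=\mathbb{E}f(X_t(x)),\qquad x\ge 0,\ t\in[0,T].$$ Then, for all nonnegative integers $l,l'$ such that $2l+4l'\le q$, the function $u$ is $l$ times continuously differentiable in $x\ge 0$ and $l'$ times continuously differentiable in $t\in[0,T]$. Moreover, there exist constants $C\ge 0$ and $k\in\mathbb{N}$, depending (for fixed $\theta,\kappa,\sigma,T,q,l,l'$) only on a good set $\{(C_i,k_i),\ i=0,1,\ldots,q\}$ for $f$, such that $$\left|\partial_x^j\partial_t^i u(t,x)\right|\le C(1+x^k),\qquad x\ge 0,\ t\in[0,T],$$ for all $j=0,1,\ldots,l$ and $i=0,1,\ldots,l'$. In particular, $u$ is a classical solution of the backward Kolmogorov equation $$\begin{cases}\partial_t u(t,x)=Au(t,x), & x\ge 0,\ t\in[0,T],\\ u(0,x)=f(x), & x\ge 0,\end{cases}$$ where $A$ acts in the variable $x$ by $Af(x)=\theta(\kappa-x)f'(x)+\frac12\sigma^2xf''(x)$, $x\ge0$. As a consequence, if $f\in C^\infty_{\mathrm{pol}}(\mathbb{R}_+)$,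 then $u$ is infinitely differentiable on $[0,T]\times\mathbb{R}_+$, and for all nonnegative integers $i,j$ the estimate $|\partial_x^j\partial_t^i u(t,x)|\le C(1+x^k)$, $x\ge0$, $t\in[0,T]$, holds with constants $C\ge0$ and $k\in\mathbb{N}$ depending (for fixed $\theta,\kappa,\sigma,T$) on $(i,j)$ and on a good sequence $\{(C_i,k_i),\ i=0,1,2,\ldots\}$ for $f$.
   Context: $\mathbb{R}_+=[0,\infty)$ and $\mathbb{N}=\{1,2,\ldots\}$. $B$ is a standard one-dimensional Brownian motion. The CIR equation has a unique nonnegative strong solution for each $x\ge0$. For an integer $n\ge0$, $C^n_{\mathrm{pol}}(\mathbb{R}_+)$ is the set of $n$ times continuously differentiable functions $f:\mathbb{R}_+\to\mathbb{R}$ (one-sided derivatives at $0$) for which there exist constants $C_i\ge0$ and $k_i\in\mathbb{N}$, $i=0,1,\ldots,n$, such that $|f^{(i)}(x)|\le C_i(1+x^{k_i})$ for all $x\ge0$ and $i=0,1,\ldots,n$. Any such set of constants $\{(C_i,k_i),\ i=0,\ldots,n\}$ is called a good set for $f$. $C^\infty_{\mathrm{pol}}(\mathbb{R}_+)$ is the set of infinitely differentiable functions $f:\mathbb{R}_+\to\mathbb{R}$ for which there exist constants $C_i\ge0$ and $k_i\in\mathbb{N}$, $i=0,1,2,\ldots$, such that $|f^{(i)}(x)|\le C_i(1+x^{k_i})$ for all $x\ge0$ and all $i\ge0$. Any such sequence $\{(C_i,k_i),\ i=0,1,2,\ldots\}$ is called a good sequence for $f$. "Depending only on a good set" means that the same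 $C$ and $k$ work for every $f$ admitting that good set. Derivatives at the boundary points $x=0$, $t=0$, $t=T$ are one-sided. *)

theory Defs
  imports "HOL-Probability.Probability"
begin

section \<open>One-sided derivatives and functions of polynomial growth\<close>

text \<open>
  Functions on \<open>[0,\<infinity>)\<close> are represented by total functions on \<open>\<real>\<close> whose values at negative
  arguments are irrelevant: derivatives are taken within the relevant interval and are therefore
  one-sided at its end points. The operator below is meaningful only where the function is
  differentiable; differentiability is always asserted separately.
\<close>

definition deriv_within :: "real set \<Rightarrow> (real \<Rightarrow> real) \<Rightarrow> real \<Rightarrow> real" where
  "deriv_within S f x = vector_derivative f (at x within S)"

definition C_k_on :: "nat \<Rightarrow> real set \<Rightarrow> (real \<Rightarrow> real) \<Rightarrow> bool" where
  "C_k_on n S f \<longleftrightarrow>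
     (\<forall>i<n. ((deriv_within S ^^ i) f) differentiable_on S) \<and>
     (\<forall>i\<le>n. continuous_on S ((deriv_within S ^^ i) f))"

definition good_set :: "nat \<Rightarrow> (real \<Rightarrow> real) \<Rightarrow> (nat \<Rightarrow> real) \<Rightarrow> (nat \<Rightarrow> nat) \<Rightarrow> bool" where
  "good_set n f C k \<longleftrightarrow>
     (\<forall>i\<le>n. 0 \<le> C i \<and> 1 \<le> k i \<and>
        (\<forall>x\<ge>0. \<bar>(deriv_within {0..} ^^ i) f x\<bar> \<le> C i * (1 + x ^ k i)))"

definition good_sequence :: "(real \<Rightarrow> real) \<Rightarrow> (nat \<Rightarrow> real) \<Rightarrow> (nat \<Rightarrow> nat) \<Rightarrow> bool" where
  "good_sequence f C k \<longleftrightarrow>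
     (\<forall>i. 0 \<le> C i \<and> 1 \<le> k i \<and>
        (\<forall>x\<ge>0. \<bar>(deriv_within {0..} ^^ i) f x\<bar> \<le> C i * (1 + x ^ k i)))"

definition C_pol :: "nat \<Rightarrow> (real \<Rightarrow> real) set" where
  "C_pol n = {f. C_k_on n {0..} f \<and> (\<exists>C k. good_set n f C k)}"

definition C_pol_infinity :: "(real \<Rightarrow> real) set" where
  "C_pol_infinity = {f. (\<forall>n. C_k_on n {0..} f) \<and> (\<exists>C k. good_sequence f C k)}"


section \<open>Partial derivatives on \<open>[0,T] \<times> [0,\<infinity>)\<close>\<close>

definition partial_t :: "real \<Rightarrow> (real \<Rightarrow> real \<Rightarrow> real) \<Rightarrow> real \<Rightarrow> real \<Rightarrow> real" where
  "partial_t T u t x = deriv_within {0..T} (\<lambda>s. u s x) t"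

definition partial_x :: "(real \<Rightarrow> real \<Rightarrow> real) \<Rightarrow> real \<Rightarrow> real \<Rightarrow> real" where
  "partial_x u t x = deriv_within {0..} (\<lambda>y. u t y) x"

definition differentiable_t :: "real \<Rightarrow> (real \<Rightarrow> real \<Rightarrow> real) \<Rightarrow> bool" where
  "differentiable_t T u \<longleftrightarrow> (\<forall>x\<ge>0. (\<lambda>s. u s x) differentiable_on {0..T})"

definition differentiable_x :: "real \<Rightarrow> (real \<Rightarrow> real \<Rightarrow> real) \<Rightarrow> bool" where
  "differentiable_x T u \<longleftrightarrow> (\<forall>t\<in>{0..T}. (\<lambda>y. u t y) differentiable_on {0..})"

definition jointly_continuous :: "real \<Rightarrow> (real \<Rightarrow> real \<Rightarrow> real) \<Rightarrow> bool" where
  "jointly_continuous T u \<longleftrightarrow> continuous_on ({0..T} \<times> {0..}) (\<lambda>(t, x). u t x)"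

text \<open>
  \<open>C_tx T m n u\<close>: all derivatives \<open>\<partial>\<^sub>x\<^sup>j \<partial>\<^sub>t\<^sup>i u\<close> with \<open>i \<le> m\<close> and \<open>j \<le> n\<close> exist on
  \<open>[0,T] \<times> [0,\<infinity>)\<close> and are jointly continuous there.
\<close>

definition C_tx :: "real \<Rightarrow> nat \<Rightarrow> nat \<Rightarrow> (real \<Rightarrow> real \<Rightarrow> real) \<Rightarrow> bool" where
  "C_tx T m n u \<longleftrightarrow>
     (\<forall>i<m. differentiable_t T ((partial_t T ^^ i) u)) \<and>
     (\<forall>i\<le>m. \<forall>j<n. differentiable_x T ((partial_x ^^ j) ((partial_t T ^^ i) u))) \<and>
     (\<forall>i\<le>m. \<forall>j\<le>n. jointly_continuous T ((partial_x ^^ j) ((partial_t T ^^ i) u)))"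

inductive_set iterated_partials ::
  "real \<Rightarrow> (real \<Rightarrow> real \<Rightarrow> real) \<Rightarrow> (real \<Rightarrow> real \<Rightarrow> real) set"
  for T :: real and u :: "real \<Rightarrow> real \<Rightarrow> real" where
  "u \<in> iterated_partials T u"
| "g \<in> iterated_partials T u \<Longrightarrow> partial_t T g \<in> iterated_partials T u"
| "g \<in> iterated_partials T u \<Longrightarrow> partial_x g \<in> iterated_partials T u"

definition C_infinity_tx :: "real \<Rightarrow> (real \<Rightarrow> real \<Rightarrow> real) \<Rightarrow> bool" where
  "C_infinity_tx T u \<longleftrightarrow>
     (\<forall>g \<in> iterated_partials T u.
        differentiable_t T g \<and> differentiable_x T g \<and> jointly_continuous T g)"


section \<open>Brownian motion and the Ito integral\<close>

text \<open>
  A filtration is indexed by all real times because the library locale is; only nonnegative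
  times matter (take \<open>F t = F 0\<close> for \<open>t < 0\<close>).
\<close>

definition brownian_motion ::
  "'a measure \<Rightarrow> (real \<Rightarrow> 'a measure) \<Rightarrow> (real \<Rightarrow> 'a \<Rightarrow> real) \<Rightarrow> bool" where
  "brownian_motion M F B \<longleftrightarrow>
     prob_space M \<and> filtration (space M) F \<and> (\<forall>t. subalgebra M (F t)) \<and>
     (\<forall>t\<ge>0. B t \<in> borel_measurable (F t)) \<and>
     (\<forall>\<omega>\<in>space M. continuous_on {0..} (\<lambda>t. B t \<omega>)) \<and>
     (AE \<omega> in M. B 0 \<omega> = 0) \<and>
     (\<forall>s t. 0 \<le> s \<and> s < t \<longrightarrow>
        distributed M lborel (\<lambda>\<omega>. B t \<omega> - B s \<omega>) (normal_density 0 (sqrt (t - s))) \<and>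
        prob_space.indep_set M (sets (F s))
          (sets (vimage_algebra (space M) (\<lambda>\<omega>. B t \<omega> - B s \<omega>) borel)))"

text \<open>
  A simple process is \<open>\<Sum>i<n. \<xi> i \<cdot> 1\<^bsub>(p i, p (i+1)]\<^esub>\<close> with \<open>\<xi> i\<close> bounded and
  measurable with respect to \<open>F (p i)\<close>.
\<close>

type_synonym 'a simple_data = "nat \<times> (nat \<Rightarrow> real) \<times> (nat \<Rightarrow> 'a \<Rightarrow> real)"

fun simple_process_data :: "'a measure \<Rightarrow> (real \<Rightarrow> 'a measure) \<Rightarrow> 'a simple_data \<Rightarrow> bool" where
  "simple_process_data M F (n, p, \<xi>) \<longleftrightarrow>
     0 \<le> p 0 \<and>
     (\<forall>i<n. p i \<le> p (Suc i) \<and> \<xi> i \<in> borel_measurable (F (p i)) \<and>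
        (\<exists>c. \<forall>\<omega>\<in>space M. \<bar>\<xi> i \<omega>\<bar> \<le> c))"

fun simple_process :: "'a simple_data \<Rightarrow> real \<Rightarrow> 'a \<Rightarrow> real" where
  "simple_process (n, p, \<xi>) s \<omega> = (\<Sum>i<n. \<xi> i \<omega> * indicator {p i<..p (Suc i)} s)"

fun simple_integral :: "(real \<Rightarrow> 'a \<Rightarrow> real) \<Rightarrow> 'a simple_data \<Rightarrow> real \<Rightarrow> 'a \<Rightarrow> real" where
  "simple_integral B (n, p, \<xi>) t \<omega> =
     (\<Sum>i<n. \<xi> i \<omega> * (B (min t (p (Suc i))) \<omega> - B (min t (p i)) \<omega>))"

text \<open>
  \<open>Y\<close> is a version of \<open>\<integral>\<^sub>0\<^sup>t H\<^sub>s dB\<^sub>s\<close> for a progressively measurable integrand \<open>H\<close> with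
  \<open>\<integral>\<^sub>0\<^sup>t H\<^sub>s\<^sup>2 ds < \<infinity>\<close> almost surely: it is the limit in probability of the integrals of simple
  processes \<open>S m\<close> such that \<open>\<integral>\<^sub>0\<^sup>t (S m - H)\<^sup>2 ds\<close> tends to \<open>0\<close> in probability.
  Such \<open>Y\<close> always exists and is almost surely unique.
\<close>

definition has_ito_integral ::
  "'a measure \<Rightarrow> (real \<Rightarrow> 'a measure) \<Rightarrow> (real \<Rightarrow> 'a \<Rightarrow> real) \<Rightarrow>
   (real \<Rightarrow> 'a \<Rightarrow> real) \<Rightarrow> real \<Rightarrow> ('a \<Rightarrow> real) \<Rightarrow> bool" where
  "has_ito_integral M F B H t Y \<longleftrightarrow>
     (\<forall>r\<in>{0..t}. (\<lambda>(s, \<omega>). H s \<omega>) \<in> borel_measurable (restrict_space borel {0..r} \<Otimes>\<^sub>M F r)) \<and>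
     (AE \<omega> in M. (\<integral>\<^sup>+s\<in>{0..t}. ennreal ((H s \<omega>)\<^sup>2) \<partial>lborel) < \<infinity>) \<and>
     Y \<in> borel_measurable M \<and>
     (\<exists>S :: nat \<Rightarrow> 'a simple_data.
        (\<forall>m. simple_process_data M F (S m)) \<and>
        (\<forall>\<epsilon>>0. (\<lambda>m. measure M {\<omega>\<in>space M.
            (\<integral>\<^sup>+s\<in>{0..t}. ennreal ((simple_process (S m) s \<omega> - H s \<omega>)\<^sup>2) \<partial>lborel) > ennreal \<epsilon>})
          \<longlonglongrightarrow> 0) \<and>
        (\<forall>\<epsilon>>0. (\<lambda>m. measure M {\<omega>\<in>space M. \<bar>simple_integral B (S m) t \<omega> - Y \<omega>\<bar> > \<epsilon>})
          \<longlonglongrightarrow> 0))"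


section \<open>The CIR process\<close>

definition cir_solution ::
  "real \<Rightarrow> real \<Rightarrow> real \<Rightarrow> real \<Rightarrow> 'a measure \<Rightarrow> (real \<Rightarrow> 'a measure) \<Rightarrow> (real \<Rightarrow> 'a \<Rightarrow> real) \<Rightarrow>
   real \<Rightarrow> (real \<Rightarrow> 'a \<Rightarrow> real) \<Rightarrow> bool" where
  "cir_solution \<theta> \<kappa> \<sigma> T M F B x X \<longleftrightarrow>
     (\<forall>t\<in>{0..T}. X t \<in> borel_measurable (F t)) \<and>
     (\<forall>\<omega>\<in>space M. continuous_on {0..T} (\<lambda>t. X t \<omega>)) \<and>
     (\<forall>t\<in>{0..T}. \<forall>\<omega>\<in>space M. 0 \<le> X t \<omega>) \<and>
     (\<forall>t\<in>{0..T}. \<exists>Y. has_ito_integral M F B (\<lambda>s \<omega>. \<sigma> * sqrt (X s \<omega>)) t Y \<and>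
        (AE \<omega> in M. X t \<omega> = x + (LBINT s:{0..t}. \<theta> * (\<kappa> - X s \<omega>)) + Y \<omega>))"

text \<open>\<open>X x t\<close> is the value at time \<open>t\<close> of the solution started at \<open>x\<close>.\<close>

definition cir_family ::
  "real \<Rightarrow> real \<Rightarrow> real \<Rightarrow> real \<Rightarrow> 'a measure \<Rightarrow> (real \<Rightarrow> 'a measure) \<Rightarrow> (real \<Rightarrow> 'a \<Rightarrow> real) \<Rightarrow>
   (real \<Rightarrow> real \<Rightarrow> 'a \<Rightarrow> real) \<Rightarrow> bool" where
  "cir_family \<theta> \<kappa> \<sigma> T M F B X \<longleftrightarrow>
     brownian_motion M F B \<and> (\<forall>x\<ge>0. cir_solution \<theta> \<kappa> \<sigma> T M F B x (X x))"

definition cir_expectation ::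
  "'a measure \<Rightarrow> (real \<Rightarrow> real \<Rightarrow> 'a \<Rightarrow> real) \<Rightarrow> (real \<Rightarrow> real) \<Rightarrow> real \<Rightarrow> real \<Rightarrow> real" where
  "cir_expectation M X f t x = prob_space.expectation M (\<lambda>\<omega>. f (X x t \<omega>))"

definition cir_generator :: "real \<Rightarrow> real \<Rightarrow> real \<Rightarrow> (real \<Rightarrow> real) \<Rightarrow> real \<Rightarrow> real" where
  "cir_generator \<theta> \<kappa> \<sigma> f x =
     \<theta> * (\<kappa> - x) * deriv_within {0..} f x
     + 1 / 2 * \<sigma>\<^sup>2 * x * (deriv_within {0..} ^^ 2) f x"

definition classical_solution_kolmogorov ::
  "real \<Rightarrow> real \<Rightarrow> real \<Rightarrow> real \<Rightarrow> (real \<Rightarrow> real) \<Rightarrow> (real \<Rightarrow> real \<Rightarrow> real) \<Rightarrow> bool" where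
  "classical_solution_kolmogorov \<theta> \<kappa> \<sigma> T f u \<longleftrightarrow>
     C_tx T 1 0 u \<and> C_tx T 0 2 u \<and>
     (\<forall>t\<in>{0..T}. \<forall>x\<ge>0. partial_t T u t x = cir_generator \<theta> \<kappa> \<sigma> (u t) x) \<and>
     (\<forall>x\<ge>0. u 0 x = f x)"

end

theory Submission
  imports Defs
begin

text \<open>
  Write \<open>P\<^sub>d\<close> for the semigroup with dimension parameter \<open>d = 2\<theta>\<kappa>/\<sigma>\<^sup>2\<close>, given by an explicit kernel (a
  Poisson mixture of gamma laws). Differentiation in \<open>x\<close> intertwines dimensions,
  \<open>\<partial>\<^sub>x P\<^sub>d f = e\<^sup>-\<^sup>\<theta>\<^sup>t P\<^sub>d\<^sub>+\<^sub>1 f'\<close>, and \<open>\<partial>\<^sub>t P\<^sub>d f = (\<theta>\<kappa> - \<theta>x) e\<^sup>-\<^sup>\<theta>\<^sup>t P\<^sub>d\<^sub>+\<^sub>1 f' + (\<sigma>\<^sup>2/2) x e\<^sup>-\<^sup>2\<^sup>\<theta>\<^sup>t P\<^sub>d\<^sub>+\<^sub>2 f''\<close>. Both identities are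
  elementary for \<open>f(z) = e\<^sup>-\<^sup>l\<^sup>z\<close> and extend by density; so an \<open>x\<close>-derivative costs one derivative of \<open>f\<close> and
  a \<open>t\<close>-derivative two, and no singularity arises at \<open>t = 0\<close> or \<open>x = 0\<close>.

  The law of \<open>X\<^sub>t\<close> is identified with the kernel through its Laplace transform. If \<open>\<psi>' = \<theta>\<psi> + (\<sigma>\<^sup>2/2) \<psi>\<^sup>2\<close>, the
  exponential of \<open>- \<integral> \<psi> \<sigma> \<surd>X dB - (1/2) \<integral> \<psi>\<^sup>2 \<sigma>\<^sup>2 X ds\<close> equals \<open>exp (c - \<psi>\<^sub>t X\<^sub>t)\<close>, which is bounded since \<open>X \<ge> 0\<close>.
  Its discretisations, stopped when \<open>X\<close> exceeds \<open>K\<close> on the grid, have expectation one and are bounded in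
  \<open>L\<^sup>2\<close>; Lenglart's inequality compares them with the stochastic integral, and then \<open>K\<close> tends to infinity.
\<close>

section \<open>The transition kernel\<close>

text \<open>The square root in the diffusion coefficient is not Lipschitz at 0 and the generator
  degenerates there, so differentiating the flow in the starting point can create singular terms;
  regularity is read off the kernel instead. Density suffices because exponential sums approximate
  all derivatives at once and lose only powers of 1 + z, which the moments of the kernel absorb.
  Ito's formula is avoided: \<psi> is deterministic and differentiable and the exponent is affine in
  X, so the product rule for \<psi> X holds path by path and no quadratic variation appears. The
  discrete exponent splits as \<open>Q = Z + D\<close>. Here Z compares increments of the stochastic
  integral with \<open>H\<close> times Brownian increments and tends to 0 in probability, while D is
  a Riemann sum that converges on each path. The limit exponent is bounded because X is nonnegative,
  but the discrete exponentials are not bounded; stopping at level K gives the \<open>L^2\<close>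
  bound, hence uniform integrability for fixed K, and on the stopped paths a one-sided bound on D is
  enough.\<close>

definition cir_scale :: "real \<Rightarrow> real \<Rightarrow> real \<Rightarrow> real" where
  "cir_scale \<theta> \<sigma> t = \<sigma>\<^sup>2 * (1 - exp (- \<theta> * t)) / (2 * \<theta>)"

text \<open>The Laplace transform at rate \<open>l\<close> of the CIR law started at
  \<open>x\<close>, with \<open>d\<close> in the role of 2 \<theta> \<kappa> / \<sigma>^2. At
  \<open>x = 0\<close> it is that of the gamma law with shape \<open>d\<close> and scale
  \<open>cir_scale\<close>, the latter being \<sigma>^2 / 2 times the integral of e^(-\<theta> s)
  over [0, t].\<close>

definition cir_laplace :: "real \<Rightarrow> real \<Rightarrow> real \<Rightarrow> real \<Rightarrow> real \<Rightarrow> real \<Rightarrow> real" where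
  "cir_laplace \<theta> \<sigma> d t x l = (1 + l * cir_scale \<theta> \<sigma> t) powr (- d)
     * exp (- (x * l * exp (- \<theta> * t) / (1 + l * cir_scale \<theta> \<sigma> t)))"

lemma cir_scale_nonneg: "0 < \<theta> \<Longrightarrow> 0 \<le> t \<Longrightarrow> 0 \<le> cir_scale \<theta> \<sigma> t"
  by (simp add: cir_scale_def)

lemma cir_scale_pos: "0 < \<theta> \<Longrightarrow> 0 < \<sigma> \<Longrightarrow> 0 < t \<Longrightarrow> 0 < cir_scale \<theta> \<sigma> t"
  by (simp add: cir_scale_def)

lemma cir_scale_0 [simp]: "cir_scale \<theta> \<sigma> 0 = 0"
  by (simp add: cir_scale_def)

definition gamma_dens :: "real \<Rightarrow> real \<Rightarrow> real \<Rightarrow> real" where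
  "gamma_dens s b z = indicator {0..} z * z powr (s - 1) * exp (- z / b) / (b powr s * Gamma s)"

lemma gamma_dens_measurable [measurable]: "gamma_dens s b \<in> borel_measurable borel"
  unfolding gamma_dens_def[abs_def] by measurable

lemma gamma_dens_nonneg: "0 < s \<Longrightarrow> 0 < b \<Longrightarrow> 0 \<le> gamma_dens s b z"
  by (simp add: gamma_dens_def Gamma_real_pos less_imp_le)

text \<open>The substitution t = (1/b + l) z reduces the integral to Euler's. The condition
  \<open>0 < 1 + l * b\<close> admits slightly negative rates, that is, exponential moments, on
  which the moment bound of the kernel rests.\<close>

lemma gamma_dens_laplace:
  assumes s: "0 < s" and b: "0 < b" and l: "0 < 1 + l * b"
  shows "(\<integral>\<^sup>+z. ennreal (exp (- l * z)) * ennreal (gamma_dens s b z) \<partial>lborel) = ennreal ((1 + l * b) powr (- s))"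
proof -
  define r where "r = 1 / b + l"
  have rb: "r * b = 1 + l * b" using b by (simp add: r_def field_simps)
  then have r: "0 < r" using l b by (metis zero_less_mult_pos2)
  have G: "0 < Gamma s" by (rule Gamma_real_pos[OF s])
  let ?f = "\<lambda>t. indicator {0..} t * t powr (s - 1) / exp t :: real"
  define K where "K = 1 / (r powr (s - 1) * b powr s * Gamma s)"
  have K: "0 \<le> K" using r b G by (simp add: K_def)
  have "exp (- l * z) * gamma_dens s b z = K * ?f (0 + r * z)" for z
  proof (cases "0 \<le> z")
    case True
    have "exp (- l * z) * exp (- z / b) = exp (- (r * z))"
      by (simp add: exp_add[symmetric] r_def field_simps)
    moreover have "(r * z) powr (s - 1) = r powr (s - 1) * z powr (s - 1)" using r True by (simp add: powr_mult)
    ultimately show ?thesis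
      using True r b G by (simp add: gamma_dens_def K_def exp_minus field_simps)
  next
    case False
    then have "\<not> 0 \<le> r * z" using r by (simp add: zero_le_mult_iff)
    with False show ?thesis by (simp add: gamma_dens_def)
  qed
  then have "(\<integral>\<^sup>+z. ennreal (exp (- l * z)) * ennreal (gamma_dens s b z) \<partial>lborel) = (\<integral>\<^sup>+z. ennreal K * ennreal (?f (0 + r * z)) \<partial>lborel)"
    using gamma_dens_nonneg[OF s b] K by (intro nn_integral_cong) (simp add: ennreal_mult'[symmetric])
  also have "\<dots> = ennreal K * (\<integral>\<^sup>+z. ennreal (?f (0 + r * z)) \<partial>lborel)"
    by (rule nn_integral_cmult) measurable
  also have "\<dots> = ennreal (K / r) * (ennreal \<bar>r\<bar> * (\<integral>\<^sup>+z. ennreal (?f (0 + r * z)) \<partial>lborel))"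
    using r K by (simp add: mult.assoc[symmetric] ennreal_mult'[symmetric])
  also have "ennreal \<bar>r\<bar> * (\<integral>\<^sup>+z. ennreal (?f (0 + r * z)) \<partial>lborel) = (\<integral>\<^sup>+t. ennreal (?f t) \<partial>lborel)"
    using r by (intro nn_integral_real_affine[symmetric]) auto
  also have "\<dots> = ennreal (Gamma s)" by (rule Gamma_conv_nn_integral_real[OF s, symmetric])
  also have "ennreal (K / r) * ennreal (Gamma s) = ennreal (K / r * Gamma s)"
    using K r G by (subst ennreal_mult) auto
  also have "K / r * Gamma s = 1 / (r powr s * b powr s)"
  proof -
    have "r powr (s - 1) * r = r powr s" using r by (simp add: powr_mult_base mult.commute)
    then show ?thesis using G by (simp add: K_def field_simps)
  qed
  also have "\<dots> = (1 + l * b) powr (- s)"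
    using r b by (simp add: powr_minus_divide powr_mult[symmetric] rb)
  finally show ?thesis .
qed

text \<open>A scaled noncentral chi-square law: given a Poisson variable n with mean
  \<open>y\<close>, a gamma variable with shape d + n and scale \<open>b\<close>. At time 0 the
  scale vanishes and the density degenerates, hence the separate Dirac case.\<close>

definition cir_kernel :: "real \<Rightarrow> real \<Rightarrow> real \<Rightarrow> real \<Rightarrow> real \<Rightarrow> real measure" where
  "cir_kernel \<theta> \<sigma> d t x = (if t = 0 then return borel x else
     (let b = cir_scale \<theta> \<sigma> t; y = x * exp (- \<theta> * t) / b in
      density lborel (\<lambda>z. \<Sum>n. ennreal (exp (- y) * y ^ n / fact n) * ennreal (gamma_dens (d + real n) b z))))"

lemma sets_cir_kernel [simp, measurable_cong]: "sets (cir_kernel \<theta> \<sigma> d t x) = sets borel"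
  by (simp add: cir_kernel_def Let_def)

lemma space_cir_kernel [simp]: "space (cir_kernel \<theta> \<sigma> d t x) = UNIV"
  by (simp add: cir_kernel_def Let_def)

lemma cir_kernel_AE_nonneg:
  assumes "0 \<le> x"
  shows "AE z in cir_kernel \<theta> \<sigma> d t x. 0 \<le> z"
proof (cases "t = 0")
  case True
  have "AE z in return borel x. 0 \<le> z" using assms by (subst AE_return) auto
  then show ?thesis using True by (simp only: cir_kernel_def if_True simp_thms)
next
  case False
  then show ?thesis
    unfolding cir_kernel_def Let_def
    by (simp add: AE_density gamma_dens_def indicator_def)
qed

text \<open>Each gamma component contributes (1 + l b)^(-d-n), so the sum over n is the generating
  function of the Poisson law at 1 / (1 + l b). Its exponent - y + y / (1 + l b) is the exponent of
  \<open>cir_laplace\<close>.\<close>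

lemma cir_kernel_laplace:
  assumes pos: "0 < \<theta>" "0 < \<sigma>" "0 < d" and t: "0 \<le> t" and x: "0 \<le> x" and l: "0 < 1 + l * cir_scale \<theta> \<sigma> t"
  shows "(\<integral>\<^sup>+z. ennreal (exp (- l * z)) \<partial>cir_kernel \<theta> \<sigma> d t x) = ennreal (cir_laplace \<theta> \<sigma> d t x l)"
proof (cases "t = 0")
  case True
  then show ?thesis by (simp add: cir_kernel_def cir_laplace_def nn_integral_return mult.commute)
next
  case False
  define b where "b = cir_scale \<theta> \<sigma> t"
  define y where "y = x * exp (- \<theta> * t) / b"
  have b: "0 < b" using cir_scale_pos[of \<theta> \<sigma> t] pos t False by (simp add: b_def)
  have y: "0 \<le> y" using x b by (simp add: y_def)
  have lb: "0 < 1 + l * b" using l by (simp add: b_def)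
  let ?p = "\<lambda>n. exp (- y) * y ^ n / fact n"
  have "(\<integral>\<^sup>+z. ennreal (exp (- l * z)) \<partial>cir_kernel \<theta> \<sigma> d t x)
    = (\<integral>\<^sup>+z. (\<Sum>n. ennreal (?p n) * ennreal (gamma_dens (d + real n) b z)) * ennreal (exp (- l * z)) \<partial>lborel)"
    using False unfolding cir_kernel_def Let_def b_def[symmetric] y_def[symmetric]
    by (simp only: if_False) (rule nn_integral_density, measurable)
  also have "\<dots> = (\<integral>\<^sup>+z. (\<Sum>n. ennreal (?p n) * (ennreal (exp (- l * z)) * ennreal (gamma_dens (d + real n) b z))) \<partial>lborel)"
    by (intro nn_integral_cong) (simp add: ennreal_suminf_multc[symmetric] mult_ac)
  also have "\<dots> = (\<Sum>n. ennreal (?p n) * (\<integral>\<^sup>+z. ennreal (exp (- l * z)) * ennreal (gamma_dens (d + real n) b z) \<partial>lborel))"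
    by (subst nn_integral_suminf) (auto simp: nn_integral_cmult)
  also have "\<dots> = (\<Sum>n. ennreal (?p n * (1 + l * b) powr (- (d + real n))))"
  proof (rule suminf_cong)
    fix n
    have "(\<integral>\<^sup>+z. ennreal (exp (- l * z)) * ennreal (gamma_dens (d + real n) b z) \<partial>lborel) = ennreal ((1 + l * b) powr (- (d + real n)))"
      by (rule gamma_dens_laplace[OF _ b lb]) (use pos in simp)
    then show "ennreal (?p n) * (\<integral>\<^sup>+z. ennreal (exp (- l * z)) * ennreal (gamma_dens (d + real n) b z) \<partial>lborel)
        = ennreal (?p n * (1 + l * b) powr (- (d + real n)))"
      using y by (simp only:) (rule ennreal_mult[symmetric], auto)
  qed
  also have "\<dots> = ennreal (cir_laplace \<theta> \<sigma> d t x l)"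
  proof (rule suminf_ennreal_eq)
    show "0 \<le> ?p n * (1 + l * b) powr (- (d + real n))" for n using y by simp
    have "?p n * (1 + l * b) powr (- (d + real n)) = ((1 + l * b) powr (- d) * exp (- y)) * ((y / (1 + l * b)) ^ n /\<^sub>R fact n)" for n
    proof -
      have "(1 + l * b) powr (- (d + real n)) = (1 + l * b) powr (- d) / (1 + l * b) ^ n"
        using lb by (simp add: powr_diff powr_realpow)
      then show ?thesis using lb by (simp add: power_divide field_simps)
    qed
    moreover have "(\<lambda>n. ((1 + l * b) powr (- d) * exp (- y)) * ((y / (1 + l * b)) ^ n /\<^sub>R fact n))
       sums (((1 + l * b) powr (- d) * exp (- y)) * exp (y / (1 + l * b)))"
      by (intro sums_mult exp_converges)
    moreover have "((1 + l * b) powr (- d) * exp (- y)) * exp (y / (1 + l * b)) = cir_laplace \<theta> \<sigma> d t x l"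
    proof -
      have "- y + y / (1 + l * b) = - (y * l * b / (1 + l * b))" using lb by (simp add: field_simps)
      also have "y * l * b = x * l * exp (- \<theta> * t)" using b by (simp add: y_def)
      finally show ?thesis by (simp add: cir_laplace_def b_def[symmetric] mult.assoc exp_add[symmetric])
    qed
    ultimately show "(\<lambda>n. ?p n * (1 + l * b) powr (- (d + real n))) sums cir_laplace \<theta> \<sigma> d t x l" by simp
  qed
  finally show ?thesis .
qed

lemma cir_kernel_integral_exp:
  assumes "0 < \<theta>" "0 < \<sigma>" "0 < d" "0 \<le> t" "0 \<le> x" "0 < 1 + l * cir_scale \<theta> \<sigma> t"
  shows "integrable (cir_kernel \<theta> \<sigma> d t x) (\<lambda>z. exp (- l * z))"
    "(\<integral>z. exp (- l * z) \<partial>cir_kernel \<theta> \<sigma> d t x) = cir_laplace \<theta> \<sigma> d t x l"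
proof -
  have "has_bochner_integral (cir_kernel \<theta> \<sigma> d t x) (\<lambda>z. exp (- l * z)) (cir_laplace \<theta> \<sigma> d t x l)"
    by (rule has_bochner_integral_nn_integral) (use cir_kernel_laplace[OF assms] in \<open>auto simp: cir_laplace_def\<close>)
  then show "integrable (cir_kernel \<theta> \<sigma> d t x) (\<lambda>z. exp (- l * z))"
    "(\<integral>z. exp (- l * z) \<partial>cir_kernel \<theta> \<sigma> d t x) = cir_laplace \<theta> \<sigma> d t x l"
    by (auto simp: has_bochner_integral_iff)
qed

lemma power_le_fact_exp:
  fixes y :: real
  assumes "0 \<le> y"
  shows "y ^ n \<le> fact n * exp y"
proof -
  have "(\<Sum>k\<in>{n}. y ^ k /\<^sub>R fact k) \<le> (\<Sum>k. y ^ k /\<^sub>R fact k)"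
    by (rule sum_le_suminf) (use assms summable_exp_generic[of y] in auto)
  then have "y ^ n / fact n \<le> exp y" by (simp add: exp_def divide_inverse mult.commute)
  then show ?thesis by (simp add: divide_le_eq mult.commute)
qed

text \<open>A power of \<open>1 + z\<close> is dominated by \<open>e\<^sup>\<epsilon>\<^sup>z\<close> with \<open>\<epsilon> = c / (1 + x)\<close>, a rate at which the exponential
  moment of the kernel is bounded uniformly in \<open>x\<close>.\<close>

lemma cir_kernel_moment:
  assumes pos: "0 < \<theta>" "0 < \<sigma>" "0 < d"
  obtains A where "0 < A" "\<And>t x. t \<in> {0..T} \<Longrightarrow> 0 \<le> x \<Longrightarrow>
    (\<integral>\<^sup>+z. ennreal ((1 + max 0 z) ^ m) \<partial>cir_kernel \<theta> \<sigma> d t x) \<le> ennreal (A * (1 + x) ^ m)"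
proof -
  define b where "b = \<sigma>\<^sup>2 / (2 * \<theta>)"
  have b: "0 < b" using pos by (simp add: b_def)
  \<comment> \<open>\<open>b\<close> is the supremum of \<open>cir_scale\<close> over all times, so
    any rate up to this \<open>c\<close> keeps the denominator 1 - \<epsilon>
    \<open>cir_scale\<close> at least 1/2.\<close>
  define c where "c = min 1 (1 / (2 * b))"
  have c: "0 < c" "c \<le> 1" "c * b \<le> 1 / 2"
  proof -
    show "0 < c" "c \<le> 1" using b by (auto simp: c_def)
    have "c * b \<le> 1 / (2 * b) * b" using b by (intro mult_right_mono) (auto simp: c_def)
    then show "c * b \<le> 1 / 2" using b by simp
  qed
  \<comment> \<open>The factors, in order: the bound of a power by an exponential, with c^m coming
    from \<epsilon>^m; e^\<epsilon> \<le> e; the denominator, at least 1/2, to the power -d; and the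
    exponential in \<open>x\<close>, whose exponent is at most 1 / (1/2).\<close>
  define A where "A = fact m / c ^ m * exp 1 * (2 powr d * exp 2)"
  show thesis
  proof (rule that[of A])
    show "0 < A" using c by (simp add: A_def)
    fix t x :: real assume t: "t \<in> {0..T}" and x: "0 \<le> x"
    define \<epsilon> where "\<epsilon> = c / (1 + x)"
    have \<epsilon>: "0 < \<epsilon>" "\<epsilon> \<le> c"
      using c x divide_left_mono[of 1 "1 + x" c] by (simp_all add: \<epsilon>_def)
    have sc: "0 \<le> cir_scale \<theta> \<sigma> t" "cir_scale \<theta> \<sigma> t \<le> b"
    proof -
      show "0 \<le> cir_scale \<theta> \<sigma> t" using cir_scale_nonneg[of \<theta> t \<sigma>] pos t by simp
      have "cir_scale \<theta> \<sigma> t = b * (1 - exp (- \<theta> * t))" by (simp add: cir_scale_def b_def)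
      also have "\<dots> \<le> b * 1" using b by (intro mult_left_mono) auto
      finally show "cir_scale \<theta> \<sigma> t \<le> b" by simp
    qed
    have "\<epsilon> * cir_scale \<theta> \<sigma> t \<le> c * b" using \<epsilon> sc c by (intro mult_mono) auto
    then have half: "1 / 2 \<le> 1 + - \<epsilon> * cir_scale \<theta> \<sigma> t" using c by simp
    let ?D = "1 + - \<epsilon> * cir_scale \<theta> \<sigma> t"
    have "ennreal ((1 + max 0 z) ^ m) \<le> ennreal (fact m / \<epsilon> ^ m * exp 1) * ennreal (exp (- (- \<epsilon>) * z))" if "0 \<le> z" for z
    proof -
      have "(\<epsilon> * (1 + z)) ^ m \<le> fact m * exp (\<epsilon> * (1 + z))" using \<epsilon> that by (intro power_le_fact_exp) simp
      also have "\<dots> = fact m * exp \<epsilon> * exp (\<epsilon> * z)" by (simp add: exp_add[symmetric] algebra_simps)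
      also have "\<dots> \<le> fact m * exp 1 * exp (\<epsilon> * z)" using \<epsilon> c by (intro mult_right_mono mult_left_mono) auto
      finally have "(\<epsilon> * (1 + z)) ^ m / \<epsilon> ^ m \<le> fact m * exp 1 * exp (\<epsilon> * z) / \<epsilon> ^ m"
        using \<epsilon> by (intro divide_right_mono) auto
      then have "(1 + z) ^ m \<le> fact m / \<epsilon> ^ m * exp 1 * exp (\<epsilon> * z)"
        using \<epsilon> by (simp add: power_mult_distrib)
      then show ?thesis using that \<epsilon> by (simp add: ennreal_mult'[symmetric] ennreal_leI)
    qed
    then have "(\<integral>\<^sup>+z. ennreal ((1 + max 0 z) ^ m) \<partial>cir_kernel \<theta> \<sigma> d t x)
      \<le> (\<integral>\<^sup>+z. ennreal (fact m / \<epsilon> ^ m * exp 1) * ennreal (exp (- (- \<epsilon>) * z)) \<partial>cir_kernel \<theta> \<sigma> d t x)"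
      by (intro nn_integral_mono_AE eventually_mono[OF cir_kernel_AE_nonneg[OF x]])
    also have "\<dots> = ennreal (fact m / \<epsilon> ^ m * exp 1) * ennreal (cir_laplace \<theta> \<sigma> d t x (- \<epsilon>))"
    proof -
      have "(\<integral>\<^sup>+z. ennreal (exp (- (- \<epsilon>) * z)) \<partial>cir_kernel \<theta> \<sigma> d t x) = ennreal (cir_laplace \<theta> \<sigma> d t x (- \<epsilon>))"
        by (rule cir_kernel_laplace) (use pos t x half in auto)
      then show ?thesis by (subst nn_integral_cmult) simp_all
    qed
    also have "\<dots> = ennreal (fact m / \<epsilon> ^ m * exp 1 * cir_laplace \<theta> \<sigma> d t x (- \<epsilon>))"
      using \<epsilon> by (simp add: ennreal_mult'[symmetric])
    also have "\<dots> \<le> ennreal (A * (1 + x) ^ m)"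
    proof (rule ennreal_leI)
      have "?D powr (- d) \<le> (1 / 2) powr (- d)" using half pos by (intro powr_mono2') auto
      also have "\<dots> = 2 powr d" by (simp add: powr_minus_divide powr_divide)
      finally have 1: "?D powr (- d) \<le> 2 powr d" .
      have "- (x * - \<epsilon> * exp (- \<theta> * t) / ?D) = \<epsilon> * x * exp (- \<theta> * t) / ?D" by simp
      also have "\<dots> \<le> 1 * 1 / (1 / 2)"
      proof (rule frac_le)
        have "c * x \<le> 1 * x" using c x by (intro mult_right_mono) auto
        then have "\<epsilon> * x \<le> 1" using x by (simp add: \<epsilon>_def divide_le_eq)
        then show "\<epsilon> * x * exp (- \<theta> * t) \<le> 1 * 1" using \<epsilon> x t pos by (intro mult_mono) auto
      qed (use half in auto)
      finally have 2: "exp (- (x * - \<epsilon> * exp (- \<theta> * t) / ?D)) \<le> exp 2" by simp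
      have "cir_laplace \<theta> \<sigma> d t x (- \<epsilon>) \<le> 2 powr d * exp 2"
        unfolding cir_laplace_def using 1 2 by (intro mult_mono) auto
      then have "fact m / \<epsilon> ^ m * exp 1 * cir_laplace \<theta> \<sigma> d t x (- \<epsilon>) \<le> fact m / \<epsilon> ^ m * exp 1 * (2 powr d * exp 2)"
        using \<epsilon> by (intro mult_left_mono) auto
      also have "\<dots> = A * (1 + x) ^ m" using x c by (simp add: A_def \<epsilon>_def power_divide)
      finally show "fact m / \<epsilon> ^ m * exp 1 * cir_laplace \<theta> \<sigma> d t x (- \<epsilon>) \<le> A * (1 + x) ^ m" .
    qed
    finally show "(\<integral>\<^sup>+z. ennreal ((1 + max 0 z) ^ m) \<partial>cir_kernel \<theta> \<sigma> d t x) \<le> ennreal (A * (1 + x) ^ m)" .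
  qed
qed

section \<open>Density of exponential sums\<close>

text \<open>The weight (1 + z)^m is monotone in m and multiplicative, which 1 + z^k is only up to
  constants. Conversion to and from the form used in good sets happens once at each end, in
  \<open>good_set_weighted\<close> and \<open>comb_bound\<close>.\<close>

definition weighted :: "nat \<Rightarrow> real \<Rightarrow> (real \<Rightarrow> real) \<Rightarrow> bool" where
  "weighted m C g \<longleftrightarrow> continuous_on {0..} g \<and> (\<forall>z\<ge>0. \<bar>g z\<bar> \<le> C * (1 + z) ^ m)"

lemma weightedD: "weighted m C g \<Longrightarrow> 0 \<le> z \<Longrightarrow> \<bar>g z\<bar> \<le> C * (1 + z) ^ m"
  by (simp add: weighted_def)

lemma weighted_nonneg: "weighted m C g \<Longrightarrow> 0 \<le> C"
  using weightedD[of m C g 0] by simp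

text \<open>Pairs \<open>(c, l)\<close> encode the exponential sum \<open>\<Sum> c e\<^sup>-\<^sup>l\<^sup>z\<close>; the index \<open>j\<close> is the order of the derivative.\<close>

definition exp_sum :: "(real \<times> real) list \<Rightarrow> nat \<Rightarrow> real \<Rightarrow> real" where
  "exp_sum L j z = (\<Sum>(c, l)\<leftarrow>L. c * (- l) ^ j * exp (- l * z))"

text \<open>Excluding rate 0 makes the class closed under taking primitives, by division by - l, and
  leaves only rates at which the Laplace transform of the solution is known.\<close>

definition pos_rates :: "(real \<times> real) list \<Rightarrow> bool" where
  "pos_rates L \<longleftrightarrow> (\<forall>(c, l)\<in>set L. 0 < l)"

lemma exp_sum_Nil [simp]: "exp_sum [] j z = 0"
  and exp_sum_Cons [simp]: "exp_sum ((c, l) # L) j z = c * (- l) ^ j * exp (- l * z) + exp_sum L j z"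
  by (simp_all add: exp_sum_def)

lemma pos_rates_simps [simp]: "pos_rates []" "pos_rates ((c, l) # L) \<longleftrightarrow> 0 < l \<and> pos_rates L"
  by (auto simp: pos_rates_def)

lemma exp_sum_deriv: "(exp_sum L j has_real_derivative exp_sum L (Suc j) z) (at z within S)"
proof (induction L)
  case Nil
  show ?case by (simp add: exp_sum_def[abs_def])
next
  case (Cons p L)
  obtain c l where p: "p = (c, l)" by (cases p)
  have "((\<lambda>z. c * (- l) ^ j * exp (- l * z) + exp_sum L j z) has_real_derivative
      c * (- l) ^ j * (exp (- l * z) * - l) + exp_sum L (Suc j) z) (at z within S)"
    by (rule DERIV_add[OF _ Cons.IH]) (auto intro!: derivative_eq_intros)
  then show ?case by (simp add: p mult_ac)
qed

lemma exp_sum_continuous: "continuous_on S (exp_sum L j)"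
  using exp_sum_deriv by (meson DERIV_continuous continuous_on_eq_continuous_within)

lemma exp_sum_bounded:
  assumes "pos_rates L"
  shows "\<exists>C\<ge>0. \<forall>z\<ge>0. \<bar>exp_sum L j z\<bar> \<le> C"
  using assms
proof (induction L)
  case (Cons p L)
  obtain c l where p: "p = (c, l)" by (cases p)
  from Cons obtain C where C: "C \<ge> 0" "\<And>z. z \<ge> 0 \<Longrightarrow> \<bar>exp_sum L j z\<bar> \<le> C" by (auto simp: p)
  have l: "0 < l" using Cons.prems by (simp add: p)
  have "\<bar>exp_sum (p # L) j z\<bar> \<le> \<bar>c * (- l) ^ j\<bar> + C" if z: "z \<ge> 0" for z
  proof -
    have "\<bar>c * (- l) ^ j * exp (- l * z)\<bar> \<le> \<bar>c * (- l) ^ j\<bar> * 1"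
      unfolding abs_mult[of "c * (- l) ^ j"] using l z by (intro mult_left_mono) auto
    then show ?thesis using C(2)[OF z] by (simp add: p)
  qed
  then show ?case using C(1) by (intro exI[of _ "\<bar>c * (- l) ^ j\<bar> + C"]) auto
qed (auto intro: exI[of _ 0])

lemma weighted_exp_sum:
  assumes "pos_rates L"
  shows "\<exists>C. weighted m C (exp_sum L j)"
proof -
  obtain C where C: "C \<ge> 0" "\<And>z. z \<ge> 0 \<Longrightarrow> \<bar>exp_sum L j z\<bar> \<le> C" using exp_sum_bounded[OF assms] by blast
  have "\<bar>exp_sum L j z\<bar> \<le> C * (1 + z) ^ m" if "z \<ge> 0" for z
  proof -
    have "C * 1 \<le> C * (1 + z) ^ m" using C that by (intro mult_left_mono) auto
    then show ?thesis using C(2)[OF that] by simp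
  qed
  then show ?thesis unfolding weighted_def using exp_sum_continuous by blast
qed

text \<open>With y = e^(-z), exponential sums become polynomials on [0, 1] and Weierstrass applies.
  The constant coefficient would have rate 0; it is dropped at a cost below e/2, because the target
  function vanishes at y = 0.\<close>

lemma exp_sum_dense_compact_support:
  assumes g: "continuous_on {0..} g" and R: "0 < R" "\<And>z. R \<le> z \<Longrightarrow> g z = 0" and e: "0 < e"
  shows "\<exists>L. pos_rates L \<and> (\<forall>z\<ge>0. \<bar>g z - exp_sum L 0 z\<bar> \<le> e)"
proof -
  \<comment> \<open>Clamping y at e^(-R) keeps the logarithm continuous down to y = 0; below the
    clamp the value is g R = 0, so nothing is altered.\<close>
  define h where "h y = g (- ln (max y (exp (- R))))" for y :: real
  have mp: "0 < max y (exp (- R))" for y by (simp add: less_max_iff_disj)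
  have hc: "continuous_on {0..1} h"
    unfolding h_def
  proof (rule continuous_on_compose2[OF g])
    show "continuous_on {0..1} (\<lambda>y. - ln (max y (exp (- R))))"
      by (intro continuous_on_minus continuous_on_ln continuous_on_max continuous_on_id continuous_on_const
          ballI less_imp_neq[OF mp, THEN not_sym])

    show "(\<lambda>y. - ln (max y (exp (- R)))) ` {0..1} \<subseteq> {0..}"
    proof (rule image_subsetI)
      fix y :: real assume "y \<in> {0..1}"
      then have "max y (exp (- R)) \<le> 1" using R by simp
      then show "- ln (max y (exp (- R))) \<in> {0..}" using mp[of y] by simp
    qed
  qed
  obtain p where p: "real_polynomial_function p" "\<And>y. y \<in> {0..1} \<Longrightarrow> \<bar>h y - p y\<bar> < e / 2"
    by (rule Stone_Weierstrass_real_polynomial_function[of "{0..1}" h "e / 2"]) (use e hc in simp_all)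
  obtain a n where pa: "p = (\<lambda>x. \<Sum>i\<le>n. a i * x ^ i)" using p(1) real_polynomial_function_iff_sum by blast
  define L where "L = map (\<lambda>i. (a (Suc i), real (Suc i))) [0..<n]"
  have L: "exp_sum L 0 z = p (exp (- z)) - a 0" for z
  proof -
    have "exp_sum L 0 z = (\<Sum>i<n. a (Suc i) * exp (- real (Suc i) * z))"
      unfolding exp_sum_def L_def map_map o_def case_prod_conv interv_sum_list_conv_sum_set_nat
      by (intro sum.cong) auto
    also have "\<dots> = (\<Sum>i<n. a (Suc i) * exp (- z) ^ Suc i)"
    proof (intro sum.cong refl)
      fix i
      have "exp (- real (Suc i) * z) = exp (real (Suc i) * (- z))" by (simp del: of_nat_Suc)
      then show "a (Suc i) * exp (- real (Suc i) * z) = a (Suc i) * exp (- z) ^ Suc i"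
        by (simp only: exp_of_nat_mult)
    qed
    also have "\<dots> = p (exp (- z)) - a 0" unfolding pa by (subst sum.atMost_shift) simp
    finally show ?thesis .
  qed
  have "h 0 = 0" using R by (simp add: h_def max_def)
  moreover have "p 0 = a 0" unfolding pa by (subst sum.atMost_shift) simp
  ultimately have a0: "\<bar>a 0\<bar> < e / 2" using p(2)[of 0] by simp
  have "\<bar>g z - exp_sum L 0 z\<bar> \<le> e" if z: "0 \<le> z" for z
  proof -
    have "h (exp (- z)) = g z"
    proof (cases "z \<le> R")
      case True
      then show ?thesis by (simp add: h_def max_def)
    next
      case False
      then show ?thesis using R by (simp add: h_def max_def)
    qed
    then have "\<bar>g z - p (exp (- z))\<bar> < e / 2" using p(2)[of "exp (- z)"] z by simp
    then show ?thesis using a0 unfolding L by linarith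
  qed
  moreover have "pos_rates L" by (auto simp: pos_rates_def L_def)
  ultimately show ?thesis by blast
qed

definition cutoff :: "real \<Rightarrow> real \<Rightarrow> real" where
  "cutoff R z = max 0 (min 1 (R + 1 - z))"

lemma cutoff_bounds: "0 \<le> cutoff R z" "cutoff R z \<le> 1" "z \<le> R \<Longrightarrow> cutoff R z = 1" "R + 1 \<le> z \<Longrightarrow> cutoff R z = 0"
  by (auto simp: cutoff_def)

lemma cutoff_continuous: "continuous_on S (cutoff R)"
  unfolding cutoff_def by (intro continuous_intros)

text \<open>Truncation followed by the compactly supported case. The extra power pays for the tail:
  \<open>R\<close> is chosen so that C \<le> (e/2) (1 + z) beyond it.\<close>

lemma exp_sum_dense_weighted:
  assumes g: "weighted m C g" and e: "0 < e"
  shows "\<exists>L. pos_rates L \<and> (\<forall>z\<ge>0. \<bar>g z - exp_sum L 0 z\<bar> \<le> e * (1 + z) ^ Suc m)"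
proof -
  have C: "0 \<le> C" by (rule weighted_nonneg[OF g])
  define R where "R = 2 * C / e + 1"
  have R: "0 < R" using C e by (simp add: R_def add_nonneg_pos)
  have "continuous_on {0..} (\<lambda>z. g z * cutoff R z)"
    using g by (intro continuous_on_mult cutoff_continuous) (simp add: weighted_def)
  from exp_sum_dense_compact_support[OF this, of "R + 1" "e / 2"] obtain L where L: "pos_rates L"
    "\<And>z. z \<ge> 0 \<Longrightarrow> \<bar>g z * cutoff R z - exp_sum L 0 z\<bar> \<le> e / 2"
    using R e cutoff_bounds by auto
  have "\<bar>g z - exp_sum L 0 z\<bar> \<le> e * (1 + z) ^ Suc m" if z: "0 \<le> z" for z
  proof -
    have one: "1 \<le> (1 + z) ^ Suc m" using z by (intro one_le_power) simp
    have "\<bar>g z - g z * cutoff R z\<bar> \<le> e / 2 * (1 + z) ^ Suc m"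
    proof (cases "z \<le> R")
      case True
      then show ?thesis using e z by (simp add: cutoff_bounds)
    next
      case False
      have "\<bar>g z - g z * cutoff R z\<bar> = \<bar>g z\<bar> * (1 - cutoff R z)"
      proof -
        have "g z - g z * cutoff R z = g z * (1 - cutoff R z)" by (simp add: algebra_simps)
        then show ?thesis using cutoff_bounds(2)[of R z] by (simp add: abs_mult)
      qed
      also have "\<dots> \<le> \<bar>g z\<bar> * 1" using cutoff_bounds(1)[of R z] by (intro mult_left_mono) auto
      also have "\<dots> \<le> C * (1 + z) ^ m" using g z by (simp add: weighted_def)
      also have "C \<le> e / 2 * (1 + z)" using False e by (simp add: R_def field_simps)
      then have "C * (1 + z) ^ m \<le> e / 2 * (1 + z) * (1 + z) ^ m" using z by (intro mult_right_mono) auto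
      finally show ?thesis by (simp add: mult_ac)
    qed
    moreover have "e / 2 * 1 \<le> e / 2 * (1 + z) ^ Suc m" using one e by (intro mult_left_mono) auto
    moreover have "\<bar>g z - exp_sum L 0 z\<bar> \<le> \<bar>g z - g z * cutoff R z\<bar> + \<bar>g z * cutoff R z - exp_sum L 0 z\<bar>" by simp
    moreover have "e / 2 * (1 + z) ^ Suc m + e / 2 * (1 + z) ^ Suc m = e * (1 + z) ^ Suc m" by (simp add: field_simps)
    ultimately show ?thesis using L(2)[OF z] by linarith
  qed
  with L(1) show ?thesis by blast
qed

text \<open>The highest derivative is approximated and then integrated k times; each integration
  costs one power of 1 + z. The integration constant is not an exponential sum with positive rates,
  so it is replaced by a slowly decaying K e^(-\<delta> z), whose derivatives are also
  small.\<close>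

lemma exp_sum_dense_derivatives:
  assumes "\<And>i z. i < k \<Longrightarrow> 0 \<le> z \<Longrightarrow> (f i has_real_derivative f (Suc i) z) (at z within {0..})"
    and "weighted m C (f k)" and "0 < e"
  shows "\<exists>L. pos_rates L \<and> (\<forall>i\<le>k. \<forall>z\<ge>0. \<bar>f i z - exp_sum L i z\<bar> \<le> e * (1 + z) ^ (Suc m + k))"
  using assms
proof (induction k arbitrary: f e)
  case 0
  then show ?case using exp_sum_dense_weighted[of m C "f 0" e] by auto
next
  case (Suc k)
  let ?M = "Suc m + k"
  have "\<exists>L. pos_rates L \<and> (\<forall>i\<le>k. \<forall>z\<ge>0. \<bar>f (Suc i) z - exp_sum L i z\<bar> \<le> e / 2 * (1 + z) ^ ?M)"
    using Suc.prems by (intro Suc.IH) auto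
  then obtain L' where L': "pos_rates L'"
    "\<And>i z. i \<le> k \<Longrightarrow> 0 \<le> z \<Longrightarrow> \<bar>f (Suc i) z - exp_sum L' i z\<bar> \<le> e / 2 * (1 + z) ^ ?M" by blast
  \<comment> \<open>The termwise primitive of L', so that differentiation shifts the index
    back.\<close>
  define L1 where "L1 = map (\<lambda>(c, l). (- c / l, l)) L'"
  have L1: "exp_sum L1 (Suc j) z = exp_sum L' j z" for j z
    using L'(1) unfolding L1_def by (induction L') (auto simp: exp_sum_def)
  have pL1: "pos_rates L1" using L'(1) by (auto simp: L1_def pos_rates_def)
  define K where "K = f 0 0 - exp_sum L1 0 0"
  \<comment> \<open>The second entry gives |K| \<delta> \<le> e/2, with |K| + 1 guarding against
    division by 0; the bound by 1 keeps the powers of \<delta> from higher derivatives at most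
    1.\<close>
  define \<delta> where "\<delta> = min 1 (e / (2 * (\<bar>K\<bar> + 1)))"
  have \<delta>: "0 < \<delta>" "\<delta> \<le> 1" using Suc.prems(3) by (simp_all add: \<delta>_def add_nonneg_pos)
  have K\<delta>: "\<bar>K\<bar> * \<delta> \<le> e / 2"
  proof -
    have "\<bar>K\<bar> * \<delta> \<le> (\<bar>K\<bar> + 1) * (e / (2 * (\<bar>K\<bar> + 1)))" using \<delta> by (intro mult_mono) (auto simp: \<delta>_def)
    also have "\<dots> = e / 2"
    proof -
      have "\<bar>K\<bar> + 1 \<noteq> 0" by linarith
      then show ?thesis by (simp add: field_simps)
    qed
    finally show ?thesis .
  qed
  have "\<bar>f i z - exp_sum ((K, \<delta>) # L1) i z\<bar> \<le> e * (1 + z) ^ (Suc m + Suc k)" if i: "i \<le> Suc k" and z: "0 \<le> z" for i z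
  proof -
    have pw: "1 \<le> (1 + z) ^ ?M" using z by (intro one_le_power) simp
    have exp1: "0 \<le> exp (- \<delta> * z)" "exp (- \<delta> * z) \<le> 1" using \<delta> z by auto
    show ?thesis
    proof (cases i)
      case 0
      have "norm ((f 0 z - exp_sum L1 0 z) - (f 0 0 - exp_sum L1 0 0)) \<le> e / 2 * (1 + z) ^ ?M * norm (z - 0)"
      proof (rule field_differentiable_bound[where S="{0..z}" and f'="\<lambda>y. f 1 y - exp_sum L1 1 y"])
        fix y assume y: "y \<in> {0..z}"
        then have "(f 0 has_real_derivative f (Suc 0) y) (at y within {0..z})"
          using Suc.prems(1)[of 0 y] by (auto intro: DERIV_subset)
        then show "((\<lambda>y. f 0 y - exp_sum L1 0 y) has_field_derivative f 1 y - exp_sum L1 1 y) (at y within {0..z})"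
          using exp_sum_deriv[of L1 0 y "{0..z}"] by (auto intro!: DERIV_diff)
        have "\<bar>f 1 y - exp_sum L1 1 y\<bar> \<le> e / 2 * (1 + y) ^ ?M" using L'(2)[of 0 y] y L1[of 0] by simp
        also have "\<dots> \<le> e / 2 * (1 + z) ^ ?M" using y Suc.prems(3) by (intro mult_left_mono power_mono) auto
        finally show "norm (f 1 y - exp_sum L1 1 y) \<le> e / 2 * (1 + z) ^ ?M" by simp
      qed (use z in auto)
      then have 1: "\<bar>f 0 z - exp_sum L1 0 z - K\<bar> \<le> e / 2 * (1 + z) ^ ?M * z" using z by (simp add: K_def)
      have "1 - exp (- \<delta> * z) \<le> \<delta> * z" using exp_ge_add_one_self[of "- \<delta> * z"] by simp
      then have "\<bar>K\<bar> * (1 - exp (- \<delta> * z)) \<le> \<bar>K\<bar> * (\<delta> * z)" by (intro mult_left_mono) auto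
      also have "\<dots> \<le> e / 2 * z" using mult_right_mono[OF K\<delta> z] by (simp only: mult.assoc)
      also have "\<dots> \<le> e / 2 * (1 + z) ^ ?M * z" using pw z Suc.prems(3) by (intro mult_right_mono) auto
      finally have 2: "\<bar>K\<bar> * (1 - exp (- \<delta> * z)) \<le> e / 2 * (1 + z) ^ ?M * z" .
      have 2: "\<bar>K - K * exp (- \<delta> * z)\<bar> \<le> e / 2 * (1 + z) ^ ?M * z"
      proof -
        have "K - K * exp (- \<delta> * z) = K * (1 - exp (- \<delta> * z))" by (simp add: algebra_simps)
        moreover have "\<bar>1 - exp (- \<delta> * z)\<bar> = 1 - exp (- \<delta> * z)" using exp1 by simp
        ultimately show ?thesis using 2 by (simp only: abs_mult)
      qed
      have "\<bar>f 0 z - exp_sum ((K, \<delta>) # L1) 0 z\<bar> \<le> \<bar>f 0 z - exp_sum L1 0 z - K\<bar> + \<bar>K - K * exp (- \<delta> * z)\<bar>" by simp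
      also have "\<dots> \<le> e / 2 * (1 + z) ^ ?M * z + e / 2 * (1 + z) ^ ?M * z" using 1 2 by linarith
      also have "\<dots> = e * (1 + z) ^ ?M * z" by simp
      also have "\<dots> \<le> e * (1 + z) ^ ?M * (1 + z)" using Suc.prems(3) z by (intro mult_left_mono) auto
      finally show ?thesis by (simp add: 0 mult_ac)
    next
      case (Suc j)
      then have "\<bar>f (Suc j) z - exp_sum L1 (Suc j) z\<bar> \<le> e / 2 * (1 + z) ^ ?M" using L'(2)[of j z] i z L1 by simp
      moreover have "\<bar>K * (- \<delta>) ^ Suc j * exp (- \<delta> * z)\<bar> \<le> e / 2 * 1"
      proof -
        have "\<bar>K * (- \<delta>) ^ Suc j * exp (- \<delta> * z)\<bar> = \<bar>K\<bar> * (\<delta> * \<delta> ^ j) * exp (- \<delta> * z)"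
          using \<delta> by (simp add: abs_mult power_abs)
        also have "\<dots> \<le> \<bar>K\<bar> * (\<delta> * 1) * 1" using \<delta> exp1 by (intro mult_mono mult_left_mono power_le_one) auto
        finally show ?thesis using K\<delta> by simp
      qed
      moreover have "e / 2 * 1 \<le> e / 2 * (1 + z) ^ ?M" using pw Suc.prems(3) by (intro mult_left_mono) auto
      ultimately have "\<bar>f i z - exp_sum ((K, \<delta>) # L1) i z\<bar> \<le> e * (1 + z) ^ ?M" unfolding Suc exp_sum_Cons by linarith
      also have "\<dots> \<le> e * (1 + z) ^ (Suc m + Suc k)" using Suc.prems(3) z by (intro mult_left_mono power_increasing) auto
      finally show ?thesis .
    qed
  qed
  then show ?case using pL1 \<delta> by (intro exI[of _ "(K, \<delta>) # L1"]) auto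
qed

section \<open>The semigroup\<close>

lemma weighted_mono_exponent:
  assumes "weighted m C g" "m \<le> n"
  shows "weighted n C g"
proof -
  have "\<bar>g z\<bar> \<le> C * (1 + z) ^ n" if "0 \<le> z" for z
  proof -
    have "C * (1 + z) ^ m \<le> C * (1 + z) ^ n"
      using weighted_nonneg[OF assms(1)] that assms(2) by (intro mult_left_mono power_increasing) auto
    then show ?thesis using weightedD[OF assms(1) that] by simp
  qed
  then show ?thesis using assms(1) by (simp add: weighted_def)
qed

lemma weighted_measurable:
  assumes "weighted m C g"
  shows "(\<lambda>z. g (max 0 z)) \<in> borel_measurable borel"
proof (rule borel_measurable_continuous_onI)
  have "continuous_on {0..} g" using assms by (simp add: weighted_def)
  then show "continuous_on UNIV (\<lambda>z. g (max 0 z))"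
    by (rule continuous_on_compose2) (auto intro!: continuous_on_max)
qed

lemma has_real_derivative_limit:
  fixes F :: "nat \<Rightarrow> real \<Rightarrow> real"
  assumes S: "convex S" and x: "x \<in> S"
    and der: "\<And>n y. y \<in> S \<Longrightarrow> (F n has_real_derivative G n y) (at y within S)"
    and unif: "\<And>e. 0 < e \<Longrightarrow> \<forall>\<^sub>F n in sequentially. \<forall>y\<in>S. \<bar>G n y - g y\<bar> \<le> e"
    and lim: "\<And>y. y \<in> S \<Longrightarrow> (\<lambda>n. F n y) \<longlonglongrightarrow> f y"
  shows "(f has_real_derivative g x) (at x within S)"
proof -
  have der': "(F n has_derivative (\<lambda>v. G n y * v)) (at y within S)" if "y \<in> S" for n y
    using der[OF that] by (simp add: has_field_derivative_def)
  have unif': "\<forall>\<^sub>F n in sequentially. \<forall>y\<in>S. \<forall>v. norm (G n y * v - g y * v) \<le> e * norm v" if "0 < e" for e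
    using unif[OF that]
    by eventually_elim (auto simp: left_diff_distrib[symmetric] abs_mult mult_right_mono)
  obtain h where h': "\<forall>y\<in>S. (\<lambda>n. F n y) \<longlonglongrightarrow> h y \<and> (h has_derivative (\<lambda>v. g y * v)) (at y within S)"
    using has_derivative_sequence[of S F "\<lambda>n y v. G n y * v" "\<lambda>y v. g y * v" x "f x", OF S der' unif' x lim[OF x]] by blast
  have h: "(\<lambda>n. F n y) \<longlonglongrightarrow> h y" "(h has_derivative (\<lambda>v. g y * v)) (at y within S)" if "y \<in> S" for y
    using bspec[OF h' that] by auto
  have "h y = f y" if "y \<in> S" for y using LIMSEQ_unique[OF h(1)[OF that] lim[OF that]] .
  then have "(f has_derivative (\<lambda>v. g x * v)) (at x within S)"
    by (intro has_derivative_transform[OF x _ h(2)[OF x]]) auto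
  then show ?thesis by (simp add: has_field_derivative_def)
qed

section \<open>The semigroup on weighted functions and on exponential sums\<close>

locale cir_parameters =
  fixes \<theta> \<sigma> :: real
  assumes \<theta>: "0 < \<theta>" and \<sigma>: "0 < \<sigma>"
begin

text \<open>Functions are controlled only on the half line. Composing with \<open>max 0\<close>
  makes the integrand measurable and bounded by the weight everywhere, and changes nothing almost
  surely.\<close>

definition P :: "real \<Rightarrow> (real \<Rightarrow> real) \<Rightarrow> real \<Rightarrow> real \<Rightarrow> real" where
  "P d g t x = (\<integral>z. g (max 0 z) \<partial>cir_kernel \<theta> \<sigma> d t x)"

text \<open>The closed form of \<open>P d (exp_sum L j)\<close>, as \<open>P_exp_sum\<close>
  confirms.\<close>

definition laplace_sum :: "real \<Rightarrow> (real \<times> real) list \<Rightarrow> nat \<Rightarrow> real \<Rightarrow> real \<Rightarrow> real" where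
  "laplace_sum d L j t x = (\<Sum>(c, l)\<leftarrow>L. c * (- l) ^ j * cir_laplace \<theta> \<sigma> d t x l)"

lemma laplace_sum_Nil [simp]: "laplace_sum d [] j t x = 0"
  and laplace_sum_Cons [simp]: "laplace_sum d ((c, l) # L) j t x = c * (- l) ^ j * cir_laplace \<theta> \<sigma> d t x l + laplace_sum d L j t x"
  by (simp_all add: laplace_sum_def)

lemma scale_arg_pos: "0 \<le> t \<Longrightarrow> 0 < l \<Longrightarrow> 0 < 1 + l * cir_scale \<theta> \<sigma> t"
  using cir_scale_nonneg[of \<theta> t \<sigma>] \<theta> by (intro add_pos_nonneg) auto

lemma kernel_moment:
  assumes d: "0 < d"
  obtains A where "0 < A" "\<And>t x. t \<in> {0..T} \<Longrightarrow> 0 \<le> x \<Longrightarrow>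
      integrable (cir_kernel \<theta> \<sigma> d t x) (\<lambda>z. (1 + max 0 z) ^ m)"
    "\<And>t x. t \<in> {0..T} \<Longrightarrow> 0 \<le> x \<Longrightarrow> (\<integral>z. (1 + max 0 z) ^ m \<partial>cir_kernel \<theta> \<sigma> d t x) \<le> A * (1 + x) ^ m"
proof -
  obtain A where A: "0 < A" "\<And>t x. t \<in> {0..T} \<Longrightarrow> 0 \<le> x \<Longrightarrow>
    (\<integral>\<^sup>+z. ennreal ((1 + max 0 z) ^ m) \<partial>cir_kernel \<theta> \<sigma> d t x) \<le> ennreal (A * (1 + x) ^ m)"
    by (rule cir_kernel_moment[OF \<theta> \<sigma> d]) blast
  have int: "integrable (cir_kernel \<theta> \<sigma> d t x) (\<lambda>z. (1 + max 0 z) ^ m)" if "t \<in> {0..T}" "0 \<le> x" for t x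
    using A(2)[OF that] by (intro integrableI_nonneg) (auto intro: le_less_trans)
  have "(\<integral>z. (1 + max 0 z) ^ m \<partial>cir_kernel \<theta> \<sigma> d t x) \<le> A * (1 + x) ^ m" if "t \<in> {0..T}" "0 \<le> x" for t x
  proof -
    have "ennreal (\<integral>z. (1 + max 0 z) ^ m \<partial>cir_kernel \<theta> \<sigma> d t x) \<le> ennreal (A * (1 + x) ^ m)"
      using A(2)[OF that] by (subst nn_integral_eq_integral[OF int[OF that], symmetric]) auto
    then show ?thesis using A(1) that by (subst (asm) ennreal_le_iff) auto
  qed
  with A(1) int show thesis by (rule that)
qed

lemma integrable_weighted:
  assumes d: "0 < d" and t: "0 \<le> t" and x: "0 \<le> x" and g: "weighted m C g"
  shows "integrable (cir_kernel \<theta> \<sigma> d t x) (\<lambda>z. g (max 0 z))"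
proof -
  have A: "integrable (cir_kernel \<theta> \<sigma> d t x) (\<lambda>z. (1 + max 0 z) ^ m)"
    by (rule kernel_moment[OF d, of t m]) (use t x in simp)
  have [measurable]: "(\<lambda>z. g (max 0 z)) \<in> borel_measurable borel" by (rule weighted_measurable[OF g])
  show ?thesis
  proof (rule Bochner_Integration.integrable_bound[where f="\<lambda>z. C * (1 + max 0 z) ^ m"])
    show "AE z in cir_kernel \<theta> \<sigma> d t x. norm (g (max 0 z)) \<le> norm (C * (1 + max 0 z) ^ m)"
    proof (rule AE_I2)
      fix z :: real
      have "\<bar>g (max 0 z)\<bar> \<le> C * (1 + max 0 z) ^ m" using weightedD[OF g] by simp
      then show "norm (g (max 0 z)) \<le> norm (C * (1 + max 0 z) ^ m)" by simp
    qed
  qed (use A in auto)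
qed

text \<open>Two exponents play different parts: m' only guarantees that both integrals exist,
  whereas m measures the difference. The constant \<open>A\<close> comes from the m-th moment alone
  and therefore serves all pairs of functions and all m'.\<close>

lemma P_close:
  assumes d: "0 < d"
  obtains A where "0 < A" "\<And>t x g h C C' m' e. t \<in> {0..T} \<Longrightarrow> 0 \<le> x \<Longrightarrow> weighted m' C g \<Longrightarrow> weighted m' C' h \<Longrightarrow>
    (\<And>z. 0 \<le> z \<Longrightarrow> \<bar>g z - h z\<bar> \<le> e * (1 + z) ^ m) \<Longrightarrow> \<bar>P d g t x - P d h t x\<bar> \<le> e * A * (1 + x) ^ m"
proof -
  obtain A where A: "0 < A" "\<And>t x. t \<in> {0..T} \<Longrightarrow> 0 \<le> x \<Longrightarrow>
      integrable (cir_kernel \<theta> \<sigma> d t x) (\<lambda>z. (1 + max 0 z) ^ m)"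
    "\<And>t x. t \<in> {0..T} \<Longrightarrow> 0 \<le> x \<Longrightarrow> (\<integral>z. (1 + max 0 z) ^ m \<partial>cir_kernel \<theta> \<sigma> d t x) \<le> A * (1 + x) ^ m"
    by (rule kernel_moment[OF d]) blast
  show thesis
  proof (rule that[OF A(1)])
    fix t x C C' e :: real and g h m'
    assume t: "t \<in> {0..T}" and x: "0 \<le> x" and gh: "weighted m' C g" "weighted m' C' h"
      and le: "\<And>z. 0 \<le> z \<Longrightarrow> \<bar>g z - h z\<bar> \<le> e * (1 + z) ^ m"
    have e: "0 \<le> e" using order_trans[OF abs_ge_zero le[of 0]] by simp
    have t0: "0 \<le> t" using t by simp
    note int = integrable_weighted[OF d t0 x]
    have "\<bar>P d g t x - P d h t x\<bar> = \<bar>\<integral>z. g (max 0 z) - h (max 0 z) \<partial>cir_kernel \<theta> \<sigma> d t x\<bar>"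
      unfolding P_def using int[OF gh(1)] int[OF gh(2)] by simp
    also have "\<dots> \<le> (\<integral>z. \<bar>g (max 0 z) - h (max 0 z)\<bar> \<partial>cir_kernel \<theta> \<sigma> d t x)" by (rule integral_abs_bound)
    also have "\<dots> \<le> (\<integral>z. e * (1 + max 0 z) ^ m \<partial>cir_kernel \<theta> \<sigma> d t x)"
      using int[OF gh(1)] int[OF gh(2)] A(2)[OF t x] le by (intro integral_mono) auto
    also have "\<dots> = e * (\<integral>z. (1 + max 0 z) ^ m \<partial>cir_kernel \<theta> \<sigma> d t x)" by simp
    also have "\<dots> \<le> e * (A * (1 + x) ^ m)" by (rule mult_left_mono[OF A(3)[OF t x] e])
    finally show "\<bar>P d g t x - P d h t x\<bar> \<le> e * A * (1 + x) ^ m" by (simp add: mult.assoc)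
  qed
qed

lemma weighted_zero: "weighted m 0 (\<lambda>z. 0)"
  by (simp add: weighted_def)

lemma P_bound:
  assumes d: "0 < d"
  obtains A where "0 < A" "\<And>t x g C. t \<in> {0..T} \<Longrightarrow> 0 \<le> x \<Longrightarrow> weighted m C g \<Longrightarrow> \<bar>P d g t x\<bar> \<le> C * A * (1 + x) ^ m"
proof -
  obtain A where A: "0 < A" "\<And>t x g h C C' m' e. t \<in> {0..T} \<Longrightarrow> 0 \<le> x \<Longrightarrow> weighted m' C g \<Longrightarrow> weighted m' C' h \<Longrightarrow>
    (\<And>z. 0 \<le> z \<Longrightarrow> \<bar>g z - h z\<bar> \<le> e * (1 + z) ^ m) \<Longrightarrow> \<bar>P d g t x - P d h t x\<bar> \<le> e * A * (1 + x) ^ m"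
    by (rule P_close[OF d]) blast
  show thesis
  proof (rule that[OF A(1)])
    fix t x C :: real and g assume "t \<in> {0..T}" "0 \<le> x" and g: "weighted m C g"
    then show "\<bar>P d g t x\<bar> \<le> C * A * (1 + x) ^ m"
      using A(2)[OF _ _ g weighted_zero[of m], of t x C] by (simp add: weighted_def P_def)
  qed
qed

lemma P_exp_sum:
  assumes d: "0 < d" and t: "0 \<le> t" and x: "0 \<le> x" and L: "pos_rates L"
  shows "P d (exp_sum L j) t x = laplace_sum d L j t x"
  using L
proof (induction L)
  case Nil
  then show ?case by (simp add: P_def)
next
  case (Cons p L)
  obtain c l where p: "p = (c, l)" by (cases p)
  have l: "0 < l" and L: "pos_rates L" using Cons.prems by (auto simp: p)
  note E = cir_kernel_integral_exp[OF \<theta> \<sigma> d t x scale_arg_pos[OF t l]]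
  have ae: "AE z in cir_kernel \<theta> \<sigma> d t x. exp (- l * max 0 z) = exp (- l * z)"
    using cir_kernel_AE_nonneg[OF x] by eventually_elim simp
  have E1: "integrable (cir_kernel \<theta> \<sigma> d t x) (\<lambda>z. exp (- l * max 0 z))"
    by (rule iffD2[OF integrable_cong_AE[OF _ _ ae] E(1)]) auto
  have E2: "(\<integral>z. exp (- l * max 0 z) \<partial>cir_kernel \<theta> \<sigma> d t x) = cir_laplace \<theta> \<sigma> d t x l"
    by (rule trans[OF integral_cong_AE[OF _ _ ae] E(2)]) auto
  obtain C where C: "weighted 0 C (exp_sum L j)" using weighted_exp_sum[OF L] by blast
  have "P d (exp_sum (p # L) j) t x = (\<integral>z. c * (- l) ^ j * exp (- l * max 0 z) + exp_sum L j (max 0 z) \<partial>cir_kernel \<theta> \<sigma> d t x)"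
    by (simp only: P_def p exp_sum_Cons)
  also have "\<dots> = c * (- l) ^ j * cir_laplace \<theta> \<sigma> d t x l + P d (exp_sum L j) t x"
    using integrable_weighted[OF d t x C] E1 unfolding E2[symmetric] P_def
    by (subst Bochner_Integration.integral_add) auto
  finally show ?case unfolding p laplace_sum_Cons Cons.IH[OF L] .
qed

text \<open>Differentiation brings down - l e^(-\<theta> t) / (1 + l b). The denominator raises the
  dimension by one, and - l is the derivative of e^(-l z): this is the intertwining relation on
  exponentials.\<close>

lemma cir_laplace_deriv_x:
  assumes t: "0 \<le> t" and l: "0 < l"
  shows "((\<lambda>x. cir_laplace \<theta> \<sigma> d t x l) has_real_derivative exp (- \<theta> * t) * (- l * cir_laplace \<theta> \<sigma> (d + 1) t x l)) (at x within S)"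
proof -
  let ?D = "1 + l * cir_scale \<theta> \<sigma> t"
  have D: "0 < ?D" by (rule scale_arg_pos[OF t l])
  have "((\<lambda>x. ?D powr (- d) * exp (- (x * l * exp (- \<theta> * t) / ?D))) has_real_derivative
    ?D powr (- d) * (exp (- (x * l * exp (- \<theta> * t) / ?D)) * - (l * exp (- \<theta> * t) / ?D))) (at x within S)"
    using D by (auto intro!: derivative_eq_intros)
  moreover have "?D powr (- (d + 1)) = ?D powr (- d) / ?D" using D by (simp add: powr_diff)
  ultimately show ?thesis unfolding cir_laplace_def by (simp add: mult_ac)
qed

text \<open>The factor 1 / (1 + l b) raises the dimension by one and its square by two, so the
  derivative regroups into one first-order and one second-order term. For d = 2 \<theta> \<kappa> /
  \<sigma>^2 the coefficient d \<sigma>^2 / 2 - \<theta> x is the drift.\<close>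

lemma cir_laplace_deriv_t:
  assumes t: "0 \<le> t" and l: "0 < l"
  shows "((\<lambda>t. cir_laplace \<theta> \<sigma> d t x l) has_real_derivative
    exp (- \<theta> * t) * (d * \<sigma>\<^sup>2 / 2 - \<theta> * x) * (- l * cir_laplace \<theta> \<sigma> (d + 1) t x l)
      + \<sigma>\<^sup>2 / 2 * x * (exp (- \<theta> * t))\<^sup>2 * ((- l)\<^sup>2 * cir_laplace \<theta> \<sigma> (d + 2) t x l)) (at t within S)"
proof -
  let ?D = "\<lambda>t. 1 + l * cir_scale \<theta> \<sigma> t" and ?e = "\<lambda>t. exp (- \<theta> * t)"
  have D: "0 < ?D t" by (rule scale_arg_pos[OF t l])
  have D': "(?D has_real_derivative l * (\<sigma>\<^sup>2 / 2 * ?e t)) (at t within S)"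
    unfolding cir_scale_def using \<theta> by (auto intro!: derivative_eq_intros simp: field_simps)
  have e': "(?e has_real_derivative - \<theta> * ?e t) (at t within S)"
    by (auto intro!: derivative_eq_intros)
  have 1: "((\<lambda>t. ?D t powr (- d)) has_real_derivative - d * (?D t powr (- d) / ?D t) * (l * (\<sigma>\<^sup>2 / 2 * ?e t))) (at t within S)"
  proof -
    have "((\<lambda>t. exp (- d * ln (?D t))) has_real_derivative exp (- d * ln (?D t)) * (- d * (1 / ?D t * (l * (\<sigma>\<^sup>2 / 2 * ?e t))))) (at t within S)"
      by (rule DERIV_chain2[OF DERIV_exp DERIV_cmult[OF DERIV_chain2[OF DERIV_ln_divide[OF D] D']]])
    moreover have "\<forall>\<^sub>F s in at t within S. exp (- d * ln (?D s)) = ?D s powr (- d)"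
    proof -
      have "(?D \<longlongrightarrow> ?D t) (at t within S)" using DERIV_continuous[OF D'] by (simp add: continuous_within)
      from order_tendstoD(1)[OF this D] show ?thesis by eventually_elim (simp add: powr_def)
    qed
    ultimately have "((\<lambda>t. ?D t powr (- d)) has_real_derivative exp (- d * ln (?D t)) * (- d * (1 / ?D t * (l * (\<sigma>\<^sup>2 / 2 * ?e t))))) (at t within S)"
      using D by (subst (asm) has_field_derivative_cong_eventually) (auto simp: powr_def)
    then show ?thesis using D by (simp add: powr_def mult_ac)
  qed
  have 2: "((\<lambda>t. exp (- (x * l * ?e t / ?D t))) has_real_derivative
    exp (- (x * l * ?e t / ?D t)) * - ((x * l * (- \<theta> * ?e t) * ?D t - x * l * ?e t * (l * (\<sigma>\<^sup>2 / 2 * ?e t))) / (?D t * ?D t))) (at t within S)"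
    by (rule DERIV_chain2[OF DERIV_exp DERIV_minus[OF DERIV_divide[OF DERIV_cmult[OF e', of "x * l"] D' less_imp_neq[OF D, THEN not_sym]]]])
  have p: "?D t powr (- (d + 1)) = ?D t powr (- d) / ?D t" "?D t powr (- (d + 2)) = ?D t powr (- d) / (?D t * ?D t)"
  proof -
    show "?D t powr (- (d + 1)) = ?D t powr (- d) / ?D t" using D by (simp add: powr_diff)
    have "?D t powr (- d - 2) = ?D t powr (- d) / ?D t powr 2" by (rule powr_diff)
    also have "?D t powr 2 = ?D t * ?D t" using D powr_realpow[OF D, of 2] by (simp add: power2_eq_square)
    finally show "?D t powr (- (d + 2)) = ?D t powr (- d) / (?D t * ?D t)" by simp
  qed
  \<comment> \<open>With the power \<open>R\<close> and the exponential \<open>E\<close> treated as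
    atoms, the claim is an identity of rational functions.\<close>
  have alg: "E * (- d * (R / D) * (l * (\<sigma>\<^sup>2 / 2 * e))) + R * (E * - ((x * l * (- \<theta> * e) * D - x * l * e * (l * (\<sigma>\<^sup>2 / 2 * e))) / (D * D)))
    = e * (d * \<sigma>\<^sup>2 / 2 - \<theta> * x) * (- l * (R / D * E)) + \<sigma>\<^sup>2 / 2 * x * e\<^sup>2 * ((- l)\<^sup>2 * (R / (D * D) * E))"
    if "D \<noteq> 0" for D R E e :: real
    using that by (simp add: field_simps power2_eq_square)
  show ?thesis
    unfolding cir_laplace_def p
    by (rule DERIV_cong[OF DERIV_mult[OF 1 2]]) (subst alg[symmetric], use D in \<open>auto simp: mult_ac\<close>)
qed

lemma laplace_sum_deriv_x:
  assumes "0 \<le> t" "pos_rates L"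
  shows "(laplace_sum d L j t has_real_derivative exp (- \<theta> * t) * laplace_sum (d + 1) L (Suc j) t x) (at x within S)"
  using assms(2)
proof (induction L)
  case Nil
  show ?case by (simp add: laplace_sum_def[abs_def])
next
  case (Cons p L)
  obtain c l where p: "p = (c, l)" by (cases p)
  have "((\<lambda>x. c * (- l) ^ j * cir_laplace \<theta> \<sigma> d t x l + laplace_sum d L j t x) has_real_derivative
      c * (- l) ^ j * (exp (- \<theta> * t) * (- l * cir_laplace \<theta> \<sigma> (d + 1) t x l)) + exp (- \<theta> * t) * laplace_sum (d + 1) L (Suc j) t x) (at x within S)"
    using Cons by (intro DERIV_add DERIV_cmult cir_laplace_deriv_x assms(1)) (auto simp: p)
  then show ?case by (simp add: p algebra_simps)
qed

lemma laplace_sum_deriv_t: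
  assumes "0 \<le> t" "pos_rates L"
  shows "((\<lambda>t. laplace_sum d L j t x) has_real_derivative
    exp (- \<theta> * t) * (d * \<sigma>\<^sup>2 / 2 - \<theta> * x) * laplace_sum (d + 1) L (Suc j) t x
      + \<sigma>\<^sup>2 / 2 * x * (exp (- \<theta> * t))\<^sup>2 * laplace_sum (d + 2) L (Suc (Suc j)) t x) (at t within S)"
  using assms(2)
proof (induction L)
  case Nil
  show ?case by (simp add: laplace_sum_def[abs_def])
next
  case (Cons p L)
  obtain c l where p: "p = (c, l)" by (cases p)
  have "((\<lambda>t. c * (- l) ^ j * cir_laplace \<theta> \<sigma> d t x l + laplace_sum d L j t x) has_real_derivative
      c * (- l) ^ j * (exp (- \<theta> * t) * (d * \<sigma>\<^sup>2 / 2 - \<theta> * x) * (- l * cir_laplace \<theta> \<sigma> (d + 1) t x l)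
      + \<sigma>\<^sup>2 / 2 * x * (exp (- \<theta> * t))\<^sup>2 * ((- l)\<^sup>2 * cir_laplace \<theta> \<sigma> (d + 2) t x l))
      + (exp (- \<theta> * t) * (d * \<sigma>\<^sup>2 / 2 - \<theta> * x) * laplace_sum (d + 1) L (Suc j) t x
      + \<sigma>\<^sup>2 / 2 * x * (exp (- \<theta> * t))\<^sup>2 * laplace_sum (d + 2) L (Suc (Suc j)) t x)) (at t within S)"
    using Cons by (intro DERIV_add DERIV_cmult cir_laplace_deriv_t assms(1)) (auto simp: p)
  then show ?case by (simp add: p algebra_simps power2_eq_square)
qed

lemma laplace_sum_continuous:
  assumes "pos_rates L"
  shows "continuous_on ({0..T} \<times> {0..}) (\<lambda>(t, x). laplace_sum d L j t x)"
  using assms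
proof (induction L)
  case Nil
  show ?case by (simp add: split_beta')
next
  case (Cons p L)
  obtain c l where p: "p = (c, l)" by (cases p)
  have l: "0 < l" using Cons by (simp add: p)
  have D: "1 + l * cir_scale \<theta> \<sigma> (fst q) \<noteq> 0" if "q \<in> {0..T} \<times> {0..}" for q :: "real \<times> real"
    using scale_arg_pos[of "fst q" l] that l by (auto simp: mem_Times_iff)
  have "continuous_on ({0..T} \<times> {0..}) (\<lambda>q. cir_laplace \<theta> \<sigma> d (fst q) (snd q) l)"
    unfolding cir_laplace_def
  proof (intro continuous_on_mult continuous_on_powr continuous_on_exp continuous_on_minus continuous_on_divide
      continuous_on_const continuous_on_add continuous_on_fst continuous_on_snd continuous_on_id ballI D)
    show "continuous_on ({0..T} \<times> {0..}) (\<lambda>q. cir_scale \<theta> \<sigma> (fst q))" for T :: real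
      unfolding cir_scale_def using \<theta> by (intro continuous_intros) auto
    then show "continuous_on ({0..T} \<times> {0..}) (\<lambda>q. cir_scale \<theta> \<sigma> (fst q))" .
  qed
  then show ?case using Cons by (auto simp: p split_beta' intro!: continuous_on_add continuous_on_mult continuous_on_const)
qed

end

section \<open>Passage from exponential sums to smooth functions of polynomial growth\<close>

context cir_parameters
begin

text \<open>Every identity for the semigroup is checked on exponential sums, where it is explicit, and
  passed to the limit along the following approximating sequences.\<close>

lemma approximating_sequence:
  assumes der: "\<And>i z. i < k \<Longrightarrow> 0 \<le> z \<Longrightarrow> (f i has_real_derivative f (Suc i) z) (at z within {0..})"
    and f: "\<And>i. i \<le> k \<Longrightarrow> weighted m (C i) (f i)" and d: "\<And>i. i \<le> k \<Longrightarrow> 0 < d i"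
  obtains L A where "\<And>n. pos_rates (L n)" "0 < A"
    "\<And>i n t x. i \<le> k \<Longrightarrow> t \<in> {0..T} \<Longrightarrow> 0 \<le> x \<Longrightarrow>
      \<bar>laplace_sum (d i) (L n) i t x - P (d i) (f i) t x\<bar> \<le> A * (1 + x) ^ (Suc m + k) / real (Suc n)"
proof -
  let ?M = "Suc m + k"
  \<comment> \<open>A single list approximates all derivatives up to order k at once; this is what
    lets the explicit derivative formulas pass to the limit.\<close>
  have "\<exists>L. pos_rates L \<and> (\<forall>i\<le>k. \<forall>z\<ge>0. \<bar>f i z - exp_sum L i z\<bar> \<le> 1 / real (Suc n) * (1 + z) ^ ?M)" for n
    by (rule exp_sum_dense_derivatives[of k f m "C k"]) (use der f in auto)
  then obtain L where L: "\<And>n. pos_rates (L n)"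
    "\<And>n i z. i \<le> k \<Longrightarrow> 0 \<le> z \<Longrightarrow> \<bar>f i z - exp_sum (L n) i z\<bar> \<le> 1 / real (Suc n) * (1 + z) ^ ?M"
    by metis
  have "\<exists>A>0. \<forall>t x g h C C' m' e. t \<in> {0..T} \<longrightarrow> 0 \<le> x \<longrightarrow> weighted m' C g \<longrightarrow> weighted m' C' h \<longrightarrow>
    (\<forall>z\<ge>0. \<bar>g z - h z\<bar> \<le> e * (1 + z) ^ ?M) \<longrightarrow> \<bar>P (d i) g t x - P (d i) h t x\<bar> \<le> e * A * (1 + x) ^ ?M"
    if "i \<le> k" for i
    by (rule P_close[OF d[OF that], of T ?M]) blast
  then obtain A where A: "\<And>i. i \<le> k \<Longrightarrow> 0 < A i" "\<And>i t x g h C C' m' e. i \<le> k \<Longrightarrow> t \<in> {0..T} \<Longrightarrow> 0 \<le> x \<Longrightarrow> weighted m' C g \<Longrightarrow> weighted m' C' h \<Longrightarrow>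
    (\<And>z. 0 \<le> z \<Longrightarrow> \<bar>g z - h z\<bar> \<le> e * (1 + z) ^ ?M) \<Longrightarrow> \<bar>P (d i) g t x - P (d i) h t x\<bar> \<le> e * A i * (1 + x) ^ ?M"
    by metis
  define A' where "A' = (\<Sum>i\<le>k. A i)"
  have AA: "A i \<le> A' \<and> 0 < A'" if "i \<le> k" for i
  proof -
    have "A i \<le> A'" unfolding A'_def by (rule member_le_sum) (use that A(1) in \<open>auto intro: less_imp_le\<close>)
    then show ?thesis using A(1)[OF that] by simp
  qed
  show thesis
  proof (rule that[of L A'])
    show "pos_rates (L n)" for n by (rule L)
    show "0 < A'" using AA[of 0] by simp
    fix i n t x assume i: "i \<le> k" and t: "t \<in> {0..T}" and x: "(0::real) \<le> x"
    obtain C' where C': "weighted m C' (exp_sum (L n) i)" using weighted_exp_sum[OF L(1)] by blast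
    have "\<bar>P (d i) (f i) t x - P (d i) (exp_sum (L n) i) t x\<bar> \<le> 1 / real (Suc n) * A i * (1 + x) ^ ?M"
      by (rule A(2)[OF i t x f[OF i] C' L(2)[OF i]])
    also have "\<dots> \<le> 1 / real (Suc n) * A' * (1 + x) ^ ?M"
      using AA[OF i] x by (intro mult_right_mono mult_left_mono) auto
    finally show "\<bar>laplace_sum (d i) (L n) i t x - P (d i) (f i) t x\<bar> \<le> A' * (1 + x) ^ ?M / real (Suc n)"
      using P_exp_sum[OF d[OF i] _ x L(1), of t n i] t by (simp add: abs_minus_commute)
  qed
qed

lemma eventually_inverse_Suc_le:
  fixes c e :: real
  assumes "0 < e"
  shows "\<forall>\<^sub>F n in sequentially. c / real (Suc n) \<le> e"
proof -
  have "(\<lambda>n. c / real (Suc n)) \<longlonglongrightarrow> 0"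
    using tendsto_mult_right[OF LIMSEQ_inverse_real_of_nat, of c] by (simp add: divide_inverse mult.commute)
  then have "\<forall>\<^sub>F n in sequentially. c / real (Suc n) < e" using assms by (rule order_tendstoD)
  then show ?thesis by eventually_elim simp
qed

lemma tendsto_of_inverse_Suc_bound:
  fixes a :: "nat \<Rightarrow> real"
  assumes "\<And>n. \<bar>a n - b\<bar> \<le> c / real (Suc n)"
  shows "a \<longlonglongrightarrow> b"
proof (rule tendstoI)
  fix e :: real assume "0 < e"
  then have "\<forall>\<^sub>F n in sequentially. c / real (Suc n) \<le> e / 2" by (intro eventually_inverse_Suc_le) simp
  then show "\<forall>\<^sub>F n in sequentially. dist (a n) b < e"
  proof eventually_elim
    case (elim n)
    have "\<bar>a n - b\<bar> < e" using elim assms[of n] \<open>0 < e\<close> by linarith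
    then show ?case by (simp add: dist_real_def)
  qed
qed

text \<open>The error carries a power of 1 + x, so convergence is uniform only for bounded x.
  Continuity is local, and the strip up to x + 1 decides it at a point with abscissa x.\<close>

lemma P_continuous:
  assumes d: "0 < d" and g: "weighted m C g"
  shows "continuous_on ({0..T} \<times> {0..}) (\<lambda>(t, x). P d g t x)"
proof -
  obtain L A where L: "\<And>n. pos_rates (L n)" "0 < A"
    "\<And>i n t x. i \<le> 0 \<Longrightarrow> t \<in> {0..T} \<Longrightarrow> 0 \<le> x \<Longrightarrow>
      \<bar>laplace_sum d (L n) i t x - P d g t x\<bar> \<le> A * (1 + x) ^ (Suc m + 0) / real (Suc n)"
    by (rule approximating_sequence[of 0 "\<lambda>_. g" m "\<lambda>_. C" "\<lambda>_. d" T]) (use g d in auto)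
  have loc: "continuous_on ({0..T} \<times> {0..R}) (\<lambda>(t, x). P d g t x)" for R
  proof (rule uniform_limit_theorem)
    show "\<forall>\<^sub>F n in sequentially. continuous_on ({0..T} \<times> {0..R}) (\<lambda>(t, x). laplace_sum d (L n) 0 t x)"
      by (intro always_eventually allI continuous_on_subset[OF laplace_sum_continuous[OF L(1)]]) auto
    show "uniform_limit ({0..T} \<times> {0..R}) (\<lambda>n (t, x). laplace_sum d (L n) 0 t x) (\<lambda>(t, x). P d g t x) sequentially"
    proof (rule uniform_limitI)
      fix e :: real assume e: "0 < e"
      have "\<forall>\<^sub>F n in sequentially. A * (1 + R) ^ Suc m / real (Suc n) \<le> e / 2"
        using e by (intro eventually_inverse_Suc_le) simp
      then show "\<forall>\<^sub>F n in sequentially. \<forall>p\<in>{0..T} \<times> {0..R}. dist (case p of (t, x) \<Rightarrow> laplace_sum d (L n) 0 t x) (case p of (t, x) \<Rightarrow> P d g t x) < e"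
      proof (eventually_elim, safe)
        fix n t x assume n: "A * (1 + R) ^ Suc m / real (Suc n) \<le> e / 2" and t: "t \<in> {0..T}" and x: "x \<in> {0..R}"
        have "\<bar>laplace_sum d (L n) 0 t x - P d g t x\<bar> \<le> A * (1 + x) ^ Suc m / real (Suc n)"
          using L(3)[of 0 t x n] t x by simp
        also have "\<dots> \<le> A * (1 + R) ^ Suc m / real (Suc n)"
          using x L(2) by (intro divide_right_mono mult_left_mono power_mono) auto
        also have "\<dots> < e" using n e by linarith
        finally show "dist (laplace_sum d (L n) 0 t x) (P d g t x) < e" by (simp add: dist_real_def)
      qed
    qed
  qed simp
  show ?thesis
    unfolding continuous_on_eq_continuous_within
  proof
    fix p assume p: "p \<in> {0..T} \<times> {0::real..}"
    let ?R = "snd p + 1"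
    have "at p within {0..T} \<times> {0..} = at p within {0..T} \<times> {0..?R}"
    proof (rule at_within_nhd[of _ "UNIV \<times> {..<?R}"])
      show "open (UNIV \<times> {..<?R} :: (real \<times> real) set)" by (intro open_Times) auto
      show "p \<in> UNIV \<times> {..<?R}" by (simp add: mem_Times_iff)
      show "{0..T} \<times> {0..} \<inter> UNIV \<times> {..<?R} - {p} = {0..T} \<times> {0..?R} \<inter> UNIV \<times> {..<?R} - {p}" by auto
    qed
    moreover have "continuous (at p within {0..T} \<times> {0..?R}) (\<lambda>(t, x). P d g t x)"
    proof -
      have "p \<in> {0..T} \<times> {0..?R}" using p by (auto simp: mem_Times_iff)
      then show ?thesis using loc[of ?R] unfolding continuous_on_eq_continuous_within by blast
    qed
    ultimately show "continuous (at p within {0..T} \<times> {0..}) (\<lambda>(t, x). P d g t x)" by simp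
  qed
qed

lemma P_deriv_x:
  assumes d: "0 < d" and f: "weighted m C f" "weighted m C' f'"
    and der: "\<And>z. 0 \<le> z \<Longrightarrow> (f has_real_derivative f' z) (at z within {0..})"
    and t: "0 \<le> t" and x: "0 \<le> x"
  shows "(P d f t has_real_derivative exp (- \<theta> * t) * P (d + 1) f' t x) (at x within {0..})"
proof -
  obtain L A where L: "\<And>n. pos_rates (L n)" "0 < A"
    "\<And>i n s y. i \<le> 1 \<Longrightarrow> s \<in> {0..t} \<Longrightarrow> 0 \<le> y \<Longrightarrow>
      \<bar>laplace_sum (d + real i) (L n) i s y - P (d + real i) ([f, f'] ! i) s y\<bar> \<le> A * (1 + y) ^ (Suc m + 1) / real (Suc n)"
  proof (rule approximating_sequence[of 1 "\<lambda>i. [f, f'] ! i" m "\<lambda>i. [C, C'] ! i" "\<lambda>i. d + real i" t])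
    show "weighted m ([C, C'] ! i) ([f, f'] ! i)" if "i \<le> 1" for i using f that by (cases i) auto
  qed (use der d in auto)
  \<comment> \<open>On this interval the polynomial error bound is uniform, and near
    \<open>x\<close> it coincides with the half line, so the one-sided derivative at 0 is
    included.\<close>
  let ?S = "{0..x + 1}"
  have "(P d f t has_real_derivative exp (- \<theta> * t) * P (d + 1) f' t x) (at x within ?S)"
  proof (rule has_real_derivative_limit[where F="\<lambda>n. laplace_sum d (L n) 0 t" and G="\<lambda>n y. exp (- \<theta> * t) * laplace_sum (d + 1) (L n) 1 t y"])
    show "(laplace_sum d (L n) 0 t has_real_derivative exp (- \<theta> * t) * laplace_sum (d + 1) (L n) 1 t y) (at y within ?S)" for n y
      using laplace_sum_deriv_x[OF t L(1), of d n 0] by simp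
    show "(\<lambda>n. laplace_sum d (L n) 0 t y) \<longlonglongrightarrow> P d f t y" if "y \<in> ?S" for y
      by (rule tendsto_of_inverse_Suc_bound) (use L(3)[of 0 t y] that t in simp)
    fix e :: real assume e: "0 < e"
    have "\<forall>\<^sub>F n in sequentially. A * (1 + (x + 1)) ^ (Suc m + 1) / real (Suc n) \<le> e"
      by (rule eventually_inverse_Suc_le[OF e])
    then show "\<forall>\<^sub>F n in sequentially. \<forall>y\<in>?S. \<bar>exp (- \<theta> * t) * laplace_sum (d + 1) (L n) 1 t y - exp (- \<theta> * t) * P (d + 1) f' t y\<bar> \<le> e"
    proof eventually_elim
      case (elim n)
      show ?case
      proof
        fix y assume y: "y \<in> ?S"
        have "\<bar>exp (- \<theta> * t) * laplace_sum (d + 1) (L n) 1 t y - exp (- \<theta> * t) * P (d + 1) f' t y\<bar>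
          = exp (- \<theta> * t) * \<bar>laplace_sum (d + 1) (L n) 1 t y - P (d + 1) f' t y\<bar>"
          by (simp add: right_diff_distrib[symmetric] abs_mult)
        also have "\<dots> \<le> 1 * \<bar>laplace_sum (d + 1) (L n) 1 t y - P (d + 1) f' t y\<bar>"
          using \<theta> t by (intro mult_right_mono) auto
        also have "\<dots> \<le> A * (1 + y) ^ (Suc m + 1) / real (Suc n)" using L(3)[of 1 t y n] y t by simp
        also have "\<dots> \<le> A * (1 + (x + 1)) ^ (Suc m + 1) / real (Suc n)"
          using y L(2) by (intro divide_right_mono mult_left_mono power_mono) auto
        finally show "\<bar>exp (- \<theta> * t) * laplace_sum (d + 1) (L n) 1 t y - exp (- \<theta> * t) * P (d + 1) f' t y\<bar> \<le> e"
          using elim by linarith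
      qed
    qed
  qed (use x in auto)
  moreover have "at x within ?S = at x within {0..}"
    by (rule at_within_nhd[of _ "{..<x + 1}"]) auto
  ultimately show ?thesis by simp
qed

lemma P_deriv_t:
  assumes d: "0 < d" and f: "weighted m C f" "weighted m C' f'" "weighted m C'' f''"
    and der: "\<And>z. 0 \<le> z \<Longrightarrow> (f has_real_derivative f' z) (at z within {0..})"
      "\<And>z. 0 \<le> z \<Longrightarrow> (f' has_real_derivative f'' z) (at z within {0..})"
    and t: "t \<in> {0..T}" and x: "0 \<le> x"
  shows "((\<lambda>t. P d f t x) has_real_derivative exp (- \<theta> * t) * (d * \<sigma>\<^sup>2 / 2 - \<theta> * x) * P (d + 1) f' t x
      + \<sigma>\<^sup>2 / 2 * x * (exp (- \<theta> * t))\<^sup>2 * P (d + 2) f'' t x) (at t within {0..T})"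
proof -
  obtain L A where L: "\<And>n. pos_rates (L n)" "0 < A"
    "\<And>i n s y. i \<le> 2 \<Longrightarrow> s \<in> {0..T} \<Longrightarrow> 0 \<le> y \<Longrightarrow>
      \<bar>laplace_sum (d + real i) (L n) i s y - P (d + real i) ([f, f', f''] ! i) s y\<bar> \<le> A * (1 + y) ^ (Suc m + 2) / real (Suc n)"
  proof (rule approximating_sequence[of 2 "\<lambda>i. [f, f', f''] ! i" m "\<lambda>i. [C, C', C''] ! i" "\<lambda>i. d + real i" T])
    show "weighted m ([C, C', C''] ! i) ([f, f', f''] ! i)" if "i \<le> 2" for i
    proof -
      have "i = 0 \<or> i = 1 \<or> i = 2" using that by auto
      then show ?thesis using f by (auto simp: numeral_2_eq_2)
    qed
    show "([f, f', f''] ! i has_real_derivative ([f, f', f''] ! Suc i) z) (at z within {0..})" if "i < 2" "0 \<le> z" for i z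
    proof -
      have "i = 0 \<or> i = 1" using that by auto
      then show ?thesis using der that by auto
    qed
  qed (use d in auto)
  let ?a = "\<lambda>s. exp (- \<theta> * s) * (d * \<sigma>\<^sup>2 / 2 - \<theta> * x)" and ?b = "\<lambda>s. \<sigma>\<^sup>2 / 2 * x * (exp (- \<theta> * s))\<^sup>2"
  \<comment> \<open>Bounds on the two coefficients that are uniform in time, because the
    exponentials are at most 1; \<open>x\<close> is fixed, so no localisation is required.\<close>
  let ?c = "\<bar>d * \<sigma>\<^sup>2 / 2 - \<theta> * x\<bar>" and ?c' = "\<sigma>\<^sup>2 / 2 * x"
  let ?B = "A * (1 + x) ^ (Suc m + 2)"
  show ?thesis
  proof (rule has_real_derivative_limit[where F="\<lambda>n s. laplace_sum d (L n) 0 s x"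
        and G="\<lambda>n s. ?a s * laplace_sum (d + 1) (L n) 1 s x + ?b s * laplace_sum (d + 2) (L n) 2 s x"])
    show "((\<lambda>s. laplace_sum d (L n) 0 s x) has_real_derivative ?a s * laplace_sum (d + 1) (L n) 1 s x + ?b s * laplace_sum (d + 2) (L n) 2 s x) (at s within {0..T})"
      if "s \<in> {0..T}" for n s
      using laplace_sum_deriv_t[OF _ L(1), of s d n 0 x] that by (simp add: numeral_2_eq_2)
    show "(\<lambda>n. laplace_sum d (L n) 0 s x) \<longlonglongrightarrow> P d f s x" if "s \<in> {0..T}" for s
      by (rule tendsto_of_inverse_Suc_bound) (use L(3)[of 0 s x] that x in simp)
    fix e :: real assume e: "0 < e"
    have "\<forall>\<^sub>F n in sequentially. (?c + ?c') * ?B / real (Suc n) \<le> e"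
      by (rule eventually_inverse_Suc_le[OF e])
    then show "\<forall>\<^sub>F n in sequentially. \<forall>s\<in>{0..T}. \<bar>?a s * laplace_sum (d + 1) (L n) 1 s x + ?b s * laplace_sum (d + 2) (L n) 2 s x
        - (?a s * P (d + 1) f' s x + ?b s * P (d + 2) f'' s x)\<bar> \<le> e"
    proof eventually_elim
      case (elim n)
      show ?case
      proof
        fix s assume s: "s \<in> {0..T}"
        let ?u = "laplace_sum (d + 1) (L n) 1 s x - P (d + 1) f' s x" and ?v = "laplace_sum (d + 2) (L n) 2 s x - P (d + 2) f'' s x"
        have uv: "\<bar>?u\<bar> \<le> ?B / real (Suc n)" "\<bar>?v\<bar> \<le> ?B / real (Suc n)"
          using L(3)[of 1 s x n] L(3)[of 2 s x n] s x by simp_all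
        have e1: "exp (- \<theta> * s) \<le> 1" using \<theta> s by simp
        have "\<bar>?a s\<bar> \<le> 1 * ?c" unfolding abs_mult using e1 by (intro mult_mono) auto
        then have a: "\<bar>?a s * ?u\<bar> \<le> ?c * (?B / real (Suc n))"
          unfolding abs_mult[of "?a s"] using uv by (intro mult_mono) auto
        have "(exp (- \<theta> * s))\<^sup>2 \<le> 1" using e1 by (intro power_le_one) auto
        then have "?b s \<le> ?c' * 1" using x by (intro mult_left_mono) auto
        then have "\<bar>?b s\<bar> \<le> ?c'" using x by simp
        then have b: "\<bar>?b s * ?v\<bar> \<le> ?c' * (?B / real (Suc n))"
          unfolding abs_mult[of "?b s"] using uv x by (intro mult_mono) auto
        have "?a s * laplace_sum (d + 1) (L n) 1 s x + ?b s * laplace_sum (d + 2) (L n) 2 s x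
          - (?a s * P (d + 1) f' s x + ?b s * P (d + 2) f'' s x) = ?a s * ?u + ?b s * ?v" by (simp add: algebra_simps)
        also have "\<bar>\<dots>\<bar> \<le> ?c * (?B / real (Suc n)) + ?c' * (?B / real (Suc n))" using a b by linarith
        also have "\<dots> = (?c + ?c') * ?B / real (Suc n)" by (simp add: distrib_right add_divide_distrib)
        finally show "\<bar>?a s * laplace_sum (d + 1) (L n) 1 s x + ?b s * laplace_sum (d + 2) (L n) 2 s x
          - (?a s * P (d + 1) f' s x + ?b s * P (d + 2) f'' s x)\<bar> \<le> e" using elim by linarith
      qed
    qed
  qed (use t in auto)
qed

lemma P_0:
  assumes "0 < d" "0 \<le> x" "weighted m C g"
  shows "P d g 0 x = g x"
proof -
  have [measurable]: "(\<lambda>z. g (max 0 z)) \<in> borel_measurable borel" by (rule weighted_measurable[OF assms(3)])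
  show ?thesis using assms(2) unfolding P_def cir_kernel_def by (simp add: integral_return)
qed

text \<open>No moment of the law is assumed: it is recovered from compactly supported test functions.\<close>

lemma law_determined_by_laplace:
  assumes N: "prob_space N" and Z[measurable]: "Z \<in> borel_measurable N" and Z0: "\<And>\<omega>. \<omega> \<in> space N \<Longrightarrow> 0 \<le> Z \<omega>"
    and d: "0 < d" and t: "0 \<le> t" and x: "0 \<le> x"
    and lap: "\<And>l. 0 < l \<Longrightarrow> (\<integral>\<omega>. exp (- l * Z \<omega>) \<partial>N) = cir_laplace \<theta> \<sigma> d t x l"
    and g: "weighted m C g"
  shows "integrable N (\<lambda>\<omega>. g (Z \<omega>)) \<and> (\<integral>\<omega>. g (Z \<omega>) \<partial>N) = P d g t x"
proof -
  interpret prob_space N by fact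
  have expi: "integrable N (\<lambda>\<omega>. exp (- l * Z \<omega>))" if "0 < l" for l
    using Z0 that by (intro integrable_const_bound[where B=1]) (auto intro!: AE_I2)
  have es: "integrable N (\<lambda>\<omega>. exp_sum L 0 (Z \<omega>)) \<and> (\<integral>\<omega>. exp_sum L 0 (Z \<omega>) \<partial>N) = P d (exp_sum L 0) t x" if L: "pos_rates L" for L
  proof -
    have "integrable N (\<lambda>\<omega>. exp_sum L 0 (Z \<omega>)) \<and> (\<integral>\<omega>. exp_sum L 0 (Z \<omega>) \<partial>N) = laplace_sum d L 0 t x"
      using L
    proof (induction L)
      case (Cons p L)
      obtain c l where p: "p = (c, l)" by (cases p)
      then show ?case using Cons expi[of l] lap[of l] by simp
    qed simp
    then show ?thesis using P_exp_sum[OF d t x L] by simp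
  qed
  have meas: "(\<lambda>\<omega>. h (Z \<omega>)) \<in> borel_measurable N" if "weighted m' C' h" for h m' C'
  proof -
    have "(\<lambda>\<omega>. h (max 0 (Z \<omega>))) \<in> borel_measurable N" by (rule measurable_compose[OF Z weighted_measurable[OF that]])
    then show ?thesis by (rule measurable_cong[THEN iffD1, rotated]) (use Z0 in auto)
  qed
  \<comment> \<open>Approximation of \<open>g\<close> by exponential sums loses one power, so one
    moment more than the growth of \<open>g\<close> has to be recovered.\<close>
  define M where "M = Suc m"
  obtain A where A: "0 < A" "\<And>s y. s \<in> {0..t} \<Longrightarrow> 0 \<le> y \<Longrightarrow>
      integrable (cir_kernel \<theta> \<sigma> d s y) (\<lambda>z. (1 + max 0 z) ^ M)"
    "\<And>s y. s \<in> {0..t} \<Longrightarrow> 0 \<le> y \<Longrightarrow> (\<integral>z. (1 + max 0 z) ^ M \<partial>cir_kernel \<theta> \<sigma> d s y) \<le> A * (1 + y) ^ M"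
    by (rule kernel_moment[OF d]) blast
  have tt: "t \<in> {0..t}" using t by simp
  let ?w = "\<lambda>z::real. (1 + z) ^ M"
  let ?w' = "\<lambda>k z. ?w z * cutoff (real k) z"
  \<comment> \<open>A truncated weight has compact support, so exponential sums approximate it
    uniformly, with weight exponent 0. Its expectation thus equals its kernel integral before any
    integrability of \<open>Z\<close> is known.\<close>
  have cut: "integrable N (\<lambda>\<omega>. ?w' k (Z \<omega>)) \<and> (\<integral>\<omega>. ?w' k (Z \<omega>) \<partial>N) \<le> A * (1 + x) ^ M" for k
  proof -
    have wc: "continuous_on {0..} (?w' k)" by (intro continuous_intros cutoff_continuous)
    have w1: "?w' k z \<le> ?w z" "0 \<le> ?w' k z" if "0 \<le> z" for z
      using cutoff_bounds[where R="real k" and z=z] that by (auto intro!: mult_left_le mult_nonneg_nonneg)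
    have ww: "weighted (M) 1 (?w' k)"
      unfolding weighted_def
    proof (intro conjI allI impI wc)
      show "\<bar>?w' k z\<bar> \<le> 1 * (1 + z) ^ M" if "0 \<le> z" for z using w1[OF that] by simp
    qed
    have wb: "?w' k z \<le> (2 + real k) ^ M" if "0 \<le> z" for z
    proof (cases "z \<le> real k + 1")
      case True
      have "?w' k z \<le> ?w z" using w1 that by blast
      also have "\<dots> \<le> (2 + real k) ^ M" using True that by (intro power_mono) auto
      finally show ?thesis .
    qed (use cutoff_bounds[of "real k" z] in auto)
    have int: "integrable N (\<lambda>\<omega>. ?w' k (Z \<omega>))"
      using wb w1(2) Z0 meas[OF ww] by (intro integrable_const_bound[where B="(2 + real k) ^ M"]) (auto intro!: AE_I2)
    obtain A0 where A0: "0 < A0" "\<And>s y g h C C' m' e. s \<in> {0..t} \<Longrightarrow> 0 \<le> y \<Longrightarrow> weighted m' C g \<Longrightarrow> weighted m' C' h \<Longrightarrow>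
      (\<And>z. 0 \<le> z \<Longrightarrow> \<bar>g z - h z\<bar> \<le> e * (1 + z) ^ 0) \<Longrightarrow> \<bar>P d g s y - P d h s y\<bar> \<le> e * A0 * (1 + y) ^ 0"
      by (rule P_close[OF d]) blast
    have "\<bar>(\<integral>\<omega>. ?w' k (Z \<omega>) \<partial>N) - P d (?w' k) t x\<bar> \<le> e" if e: "0 < e" for e
    proof -
      define e' where "e' = e / (1 + A0)"
      have e': "0 < e'" using e A0(1) by (simp add: e'_def)
      obtain L where L: "pos_rates L" "\<And>z. z \<ge> 0 \<Longrightarrow> \<bar>?w' k z - exp_sum L 0 z\<bar> \<le> e'"
      proof -
        have "\<exists>L. pos_rates L \<and> (\<forall>z\<ge>0. \<bar>?w' k z - exp_sum L 0 z\<bar> \<le> e')"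
          by (rule exp_sum_dense_compact_support[OF wc, of "real k + 1"]) (use e' in \<open>simp_all add: cutoff_bounds(4)\<close>)
        then show thesis using that by blast
      qed
      obtain C' where C': "weighted (M) C' (exp_sum L 0)" using weighted_exp_sum[OF L(1)] by blast
      have 1: "\<bar>P d (?w' k) t x - P d (exp_sum L 0) t x\<bar> \<le> e' * A0"
        using A0(2)[OF tt x ww C', of e'] L(2) by simp
      have "\<bar>(\<integral>\<omega>. ?w' k (Z \<omega>) \<partial>N) - (\<integral>\<omega>. exp_sum L 0 (Z \<omega>) \<partial>N)\<bar> = \<bar>\<integral>\<omega>. ?w' k (Z \<omega>) - exp_sum L 0 (Z \<omega>) \<partial>N\<bar>"
        using int es[OF L(1)] by simp
      also have "\<dots> \<le> (\<integral>\<omega>. \<bar>?w' k (Z \<omega>) - exp_sum L 0 (Z \<omega>)\<bar> \<partial>N)" by (rule integral_abs_bound)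
      also have "\<dots> \<le> (\<integral>\<omega>. e' \<partial>N)"
        using int es[OF L(1)] L(2) Z0 by (intro integral_mono) auto
      finally have "\<bar>(\<integral>\<omega>. ?w' k (Z \<omega>) \<partial>N) - P d (exp_sum L 0) t x\<bar> \<le> e'"
        using es[OF L(1)] by (simp add: prob_space)
      with 1 have "\<bar>(\<integral>\<omega>. ?w' k (Z \<omega>) \<partial>N) - P d (?w' k) t x\<bar> \<le> e' + e' * A0" by linarith
      also have "\<dots> = e"
      proof -
        have "e' * (1 + A0) = e" using A0(1) by (simp add: e'_def)
        then show ?thesis by (simp add: algebra_simps)
      qed
      finally show ?thesis .
    qed
    then have "\<bar>(\<integral>\<omega>. ?w' k (Z \<omega>) \<partial>N) - P d (?w' k) t x\<bar> \<le> 0" by (rule field_le_epsilon) simp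
    then have "(\<integral>\<omega>. ?w' k (Z \<omega>) \<partial>N) = P d (?w' k) t x" by simp
    also have "\<dots> \<le> (\<integral>z. ?w (max 0 z) \<partial>cir_kernel \<theta> \<sigma> d t x)"
      unfolding P_def
    proof (rule integral_mono)
      show "integrable (cir_kernel \<theta> \<sigma> d t x) (\<lambda>z. ?w' k (max 0 z))" by (rule integrable_weighted[OF d t x ww])
      show "integrable (cir_kernel \<theta> \<sigma> d t x) (\<lambda>z. ?w (max 0 z))" by (rule A(2)[OF tt x])
      show "?w' k (max 0 z) \<le> ?w (max 0 z)" for z by (rule w1(1)) simp
    qed
    also have "\<dots> \<le> A * (1 + x) ^ M" by (rule A(3)[OF tt x])
    finally show ?thesis using int by simp
  qed
  \<comment> \<open>Fatou's lemma removes the truncation: the bound by the kernel moment does not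
    depend on k.\<close>
  have wint: "integrable N (\<lambda>\<omega>. ?w (Z \<omega>)) \<and> (\<integral>\<omega>. ?w (Z \<omega>) \<partial>N) \<le> A * (1 + x) ^ M"
  proof -
    have "(\<integral>\<^sup>+\<omega>. ennreal (?w (Z \<omega>)) \<partial>N) \<le> (\<integral>\<^sup>+\<omega>. liminf (\<lambda>k. ennreal (?w' k (Z \<omega>))) \<partial>N)"
    proof (rule nn_integral_mono)
      fix \<omega>
      obtain k0 where k0: "Z \<omega> \<le> real k0" using real_arch_simple by blast
      have "\<forall>\<^sub>F k in sequentially. ennreal (?w (Z \<omega>)) \<le> ennreal (?w' k (Z \<omega>))"
        using eventually_ge_at_top[of k0] by eventually_elim (use k0 in \<open>simp add: cutoff_bounds\<close>)
      then show "ennreal (?w (Z \<omega>)) \<le> liminf (\<lambda>k. ennreal (?w' k (Z \<omega>)))" by (rule Liminf_bounded)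
    qed
    also have "\<dots> \<le> liminf (\<lambda>k. \<integral>\<^sup>+\<omega>. ennreal (?w' k (Z \<omega>)) \<partial>N)"
      by (rule nn_integral_liminf)
        (rule measurable_compose[OF borel_measurable_integrable[OF conjunct1[OF cut]] measurable_ennreal])
    also have "\<dots> \<le> liminf (\<lambda>k. ennreal (A * (1 + x) ^ M))"
    proof (rule Liminf_mono, rule always_eventually, rule allI)
      fix k
      have "(\<integral>\<^sup>+\<omega>. ennreal (?w' k (Z \<omega>)) \<partial>N) = ennreal (\<integral>\<omega>. ?w' k (Z \<omega>) \<partial>N)"
        using cut[of k] Z0 cutoff_bounds(1) by (intro nn_integral_eq_integral) (auto intro!: AE_I2 mult_nonneg_nonneg)
      also have "\<dots> \<le> ennreal (A * (1 + x) ^ M)" using cut[of k] by (intro ennreal_leI) blast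
      finally show "(\<integral>\<^sup>+\<omega>. ennreal (?w' k (Z \<omega>)) \<partial>N) \<le> ennreal (A * (1 + x) ^ M)" .
    qed
    also have "\<dots> = ennreal (A * (1 + x) ^ M)" by (simp add: Liminf_const)
    finally have fin: "(\<integral>\<^sup>+\<omega>. ennreal (?w (Z \<omega>)) \<partial>N) \<le> ennreal (A * (1 + x) ^ M)" .
    then have int: "integrable N (\<lambda>\<omega>. ?w (Z \<omega>))"
      using Z0 by (intro integrableI_nonneg) (auto intro: le_less_trans intro!: AE_I2)
    have "ennreal (\<integral>\<omega>. ?w (Z \<omega>) \<partial>N) \<le> ennreal (A * (1 + x) ^ M)"
      using fin Z0 by (subst nn_integral_eq_integral[OF int, symmetric]) (auto intro!: AE_I2)
    then show ?thesis using int A(1) x by (subst (asm) ennreal_le_iff) auto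
  qed
  have gint: "integrable N (\<lambda>\<omega>. g (Z \<omega>))"
  proof (rule Bochner_Integration.integrable_bound[where f="\<lambda>\<omega>. C * ?w (Z \<omega>)"])
    show "AE \<omega> in N. norm (g (Z \<omega>)) \<le> norm (C * ?w (Z \<omega>))"
    proof (rule AE_I2)
      fix \<omega> assume "\<omega> \<in> space N"
      from weightedD[OF weighted_mono_exponent[OF g] Z0[OF this], of M]
      show "norm (g (Z \<omega>)) \<le> norm (C * ?w (Z \<omega>))" by (simp add: M_def)
    qed
  qed (use wint meas[OF g] in auto)
  \<comment> \<open>Now that the moment of order \<open>M\<close> is finite under both laws, the
    weighted approximation of \<open>g\<close> can be integrated on either side.\<close>
  obtain A1 where A1: "0 < A1" "\<And>s y g h C C' m' e. s \<in> {0..t} \<Longrightarrow> 0 \<le> y \<Longrightarrow> weighted m' C g \<Longrightarrow> weighted m' C' h \<Longrightarrow>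
    (\<And>z. 0 \<le> z \<Longrightarrow> \<bar>g z - h z\<bar> \<le> e * (1 + z) ^ M) \<Longrightarrow> \<bar>P d g s y - P d h s y\<bar> \<le> e * A1 * (1 + y) ^ M"
    by (rule P_close[OF d]) blast
  have "\<bar>(\<integral>\<omega>. g (Z \<omega>) \<partial>N) - P d g t x\<bar> \<le> e" if e: "0 < e" for e
  proof -
    define K where "K = (A + A1) * (1 + x) ^ M"
    have K: "0 < K" using A(1) A1(1) x unfolding K_def by (intro mult_pos_pos zero_less_power) auto
    define e' where "e' = e / K"
    have e': "0 < e'" using e K by (simp add: e'_def)
    obtain L where L: "pos_rates L" "\<And>z. z \<ge> 0 \<Longrightarrow> \<bar>g z - exp_sum L 0 z\<bar> \<le> e' * ?w z"
      using exp_sum_dense_weighted[OF g e'] unfolding M_def by blast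
    obtain C' where C': "weighted m C' (exp_sum L 0)" using weighted_exp_sum[OF L(1)] by blast
    have 1: "\<bar>P d g t x - P d (exp_sum L 0) t x\<bar> \<le> e' * A1 * (1 + x) ^ M"
      by (rule A1(2)[OF tt x g C' L(2)])
    have "\<bar>(\<integral>\<omega>. g (Z \<omega>) \<partial>N) - (\<integral>\<omega>. exp_sum L 0 (Z \<omega>) \<partial>N)\<bar> = \<bar>\<integral>\<omega>. g (Z \<omega>) - exp_sum L 0 (Z \<omega>) \<partial>N\<bar>"
      using gint es[OF L(1)] by simp
    also have "\<dots> \<le> (\<integral>\<omega>. \<bar>g (Z \<omega>) - exp_sum L 0 (Z \<omega>)\<bar> \<partial>N)" by (rule integral_abs_bound)
    also have "\<dots> \<le> (\<integral>\<omega>. e' * ?w (Z \<omega>) \<partial>N)"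
      using gint es[OF L(1)] L(2) Z0 wint by (intro integral_mono) auto
    also have "\<dots> = e' * (\<integral>\<omega>. ?w (Z \<omega>) \<partial>N)" by simp
    also have "\<dots> \<le> e' * (A * (1 + x) ^ M)" using wint e' by (intro mult_left_mono) auto
    finally have "\<bar>(\<integral>\<omega>. g (Z \<omega>) \<partial>N) - P d (exp_sum L 0) t x\<bar> \<le> e' * (A * (1 + x) ^ M)"
      using es[OF L(1)] by simp
    with 1 have "\<bar>(\<integral>\<omega>. g (Z \<omega>) \<partial>N) - P d g t x\<bar> \<le> e' * (A * (1 + x) ^ M) + e' * A1 * (1 + x) ^ M" by linarith
    also have "\<dots> = e' * K" by (simp add: K_def algebra_simps)
    also have "\<dots> = e" using K by (simp add: e'_def)
    finally show ?thesis .
  qed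
  then have "\<bar>(\<integral>\<omega>. g (Z \<omega>) \<partial>N) - P d g t x\<bar> \<le> 0" by (rule field_le_epsilon) simp
  then show ?thesis using gint by simp
qed

end

section \<open>Simple integrals and convergence in probability\<close>

text \<open>Completing the square: exponential tilting by c shifts the mean of the Gaussian law to c
  v, and the result is again a probability density.\<close>

lemma normal_exponential_integral:
  assumes v: "v > 0"
  shows "(\<integral>\<^sup>+z. ennreal (exp (c * z - c\<^sup>2 * v / 2)) * ennreal (normal_density 0 (sqrt v) z) \<partial>lborel) = 1"
proof -
  have "exp (c * z - c\<^sup>2 * v / 2) * normal_density 0 (sqrt v) z = normal_density (c * v) (sqrt v) z" for z
  proof -
    have "c * z - c\<^sup>2 * v / 2 + - z\<^sup>2 / (2 * v) = - (z - c * v)\<^sup>2 / (2 * v)"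
      using v by (simp add: field_simps power2_eq_square)
    then show ?thesis
      using v by (simp add: normal_density_def exp_add[symmetric])
  qed
  then have "(\<integral>\<^sup>+z. ennreal (exp (c * z - c\<^sup>2 * v / 2)) * ennreal (normal_density 0 (sqrt v) z) \<partial>lborel)
      = (\<integral>\<^sup>+z. ennreal (normal_density (c * v) (sqrt v) z) \<partial>lborel)"
    by (simp add: ennreal_mult'[symmetric])
  also have "\<dots> = emeasure (density lborel (normal_density (c * v) (sqrt v))) UNIV"
    by (simp add: emeasure_density)
  also have "\<dots> = 1"
    using prob_space.emeasure_space_1[OF prob_space_normal_density[of "sqrt v" "c * v"]] v by simp
  finally show ?thesis .
qed

section \<open>Independent increments, discrete exponential martingales and the isometry on
  grids\<close>

locale brownian =
  fixes M :: "'a measure" and F :: "real \<Rightarrow> 'a measure" and B :: "real \<Rightarrow> 'a \<Rightarrow> real"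
  assumes bm: "brownian_motion M F B"

sublocale brownian \<subseteq> prob_space M
  using bm by (simp add: brownian_motion_def)

context brownian
begin

lemma subalgebra_F: "subalgebra M (F t)"
  using bm by (simp add: brownian_motion_def)

lemma space_F: "space (F t) = space M"
  using subalgebra_F by (simp add: subalgebra_def)

lemma measurable_F: "f \<in> measurable (F t) N \<Longrightarrow> f \<in> measurable M N"
  by (rule measurable_from_subalg[OF subalgebra_F])

lemma measurable_F_mono:
  assumes "f \<in> measurable (F s) N" "s \<le> t"
  shows "f \<in> measurable (F t) N"
proof (rule measurable_from_subalg[OF _ assms(1)])
  have "filtration (space M) F"
    using bm by (simp add: brownian_motion_def)
  then show "subalgebra (F t) (F s)"
    using assms(2) by (auto simp: subalgebra_def space_F filtration.sets_F_mono)
qed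

lemma B_measurable_F: "0 \<le> t \<Longrightarrow> B t \<in> borel_measurable (F t)"
  using bm by (simp add: brownian_motion_def)

lemma B_measurable: "0 \<le> t \<Longrightarrow> B t \<in> borel_measurable M"
  using B_measurable_F measurable_F by blast

lemma increment_distributed:
  "0 \<le> s \<Longrightarrow> s < t \<Longrightarrow> distributed M lborel (\<lambda>\<omega>. B t \<omega> - B s \<omega>) (normal_density 0 (sqrt (t - s)))"
  using bm by (simp add: brownian_motion_def)

lemma increment_indep:
  assumes "0 \<le> s" "s < t" "U \<in> measurable (F s) N" and g[measurable]: "g \<in> measurable borel N'"
  shows "indep_var N U N' (\<lambda>\<omega>. g (B t \<omega> - B s \<omega>))"
proof -
  let ?D = "\<lambda>\<omega>. B t \<omega> - B s \<omega>"
  have ind: "indep_set (sets (F s)) (sets (vimage_algebra (space M) ?D borel))"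
    using bm assms by (simp add: brownian_motion_def)
  have D[measurable]: "?D \<in> borel_measurable M" using assms by (intro borel_measurable_diff B_measurable) auto
  have 1: "sigma_sets (space M) {U -` A \<inter> space M |A. A \<in> sets N} \<subseteq> sets (F s)"
    using measurable_sets[OF assms(3)] by (subst space_F[of s, symmetric])+ (intro sets.sigma_sets_subset, auto simp: space_F)
  have 2: "sigma_sets (space M) {(\<lambda>\<omega>. g (?D \<omega>)) -` A \<inter> space M |A. A \<in> sets N'}
      \<subseteq> sets (vimage_algebra (space M) ?D borel)"
  proof -
    have "(\<lambda>\<omega>. g (?D \<omega>)) -` A \<inter> space M \<in> sets (vimage_algebra (space M) ?D borel)" if "A \<in> sets N'" for A
    proof -
      have "(\<lambda>\<omega>. g (?D \<omega>)) -` A \<inter> space M = ?D -` (g -` A) \<inter> space M" by auto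
      moreover have "g -` A \<in> sets borel" using measurable_sets[OF g that] by simp
      ultimately show ?thesis by (simp add: in_vimage_algebra)
    qed
    then have "sigma_sets (space (vimage_algebra (space M) ?D borel)) {(\<lambda>\<omega>. g (?D \<omega>)) -` A \<inter> space M |A. A \<in> sets N'}
      \<subseteq> sets (vimage_algebra (space M) ?D borel)"
      by (intro sets.sigma_sets_subset) auto
    then show ?thesis by simp
  qed
  have "indep_set (sigma_sets (space M) {U -` A \<inter> space M |A. A \<in> sets N})
     (sigma_sets (space M) {(\<lambda>\<omega>. g (?D \<omega>)) -` A \<inter> space M |A. A \<in> sets N'})"
    using 1 2 indep_setD_ev1[OF ind] indep_setD_ev2[OF ind] indep_setD[OF ind]
    by (intro indep_setI) blast+
  moreover have "random_variable N U" by (rule measurable_F[OF assms(3)])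
  moreover have "random_variable N' (\<lambda>\<omega>. g (?D \<omega>))" by measurable
  ultimately show ?thesis unfolding indep_var_eq by simp
qed

text \<open>Conditioning in integrated form: the past \<open>U\<close> and the increment are
  independent, so their joint law is a product and the increment may be integrated first with the
  past held fixed.\<close>

lemma nn_integral_freeze:
  fixes U :: "'a \<Rightarrow> real \<times> real"
  assumes "0 \<le> s" "s < t" "U \<in> borel_measurable (F s)" and \<phi>[measurable]: "\<phi> \<in> borel_measurable (borel \<Otimes>\<^sub>M borel)"
  shows "(\<integral>\<^sup>+\<omega>. \<phi> (U \<omega>, B t \<omega> - B s \<omega>) \<partial>M)
    = (\<integral>\<^sup>+\<omega>. (\<integral>\<^sup>+z. \<phi> (U \<omega>, z) * ennreal (normal_density 0 (sqrt (t - s)) z) \<partial>lborel) \<partial>M)"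
proof -
  let ?D = "\<lambda>\<omega>. B t \<omega> - B s \<omega>" and ?N = "borel :: (real \<times> real) measure"
  \<comment> \<open>Padding the increment with 0 gives it the same value type as the pair
    \<open>U\<close>, as \<open>indep_var\<close> requires of its two variables.\<close>
  let ?E = "\<lambda>\<omega>. (?D \<omega>, 0::real)"
  have U[measurable]: "U \<in> measurable M ?N" by (rule measurable_F[OF assms(3)])
  have D[measurable]: "?D \<in> borel_measurable M" using assms by (intro borel_measurable_diff B_measurable) auto
  interpret P2: prob_space "distr M ?N ?E" by (rule prob_space_distr) simp
  have j: "distr M ?N U \<Otimes>\<^sub>M distr M ?N ?E = distr M (?N \<Otimes>\<^sub>M ?N) (\<lambda>\<omega>. (U \<omega>, ?E \<omega>))"
    using increment_indep[OF assms(1-3), of "\<lambda>z. (z, 0)" ?N] by (simp add: indep_var_distribution_eq)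
  have [measurable]: "(fst :: real \<times> real \<Rightarrow> real) \<in> borel_measurable borel"
    by (intro borel_measurable_continuous_onI continuous_intros)
  define hh :: "(real \<times> real) \<times> (real \<times> real) \<Rightarrow> ennreal" where "hh = (\<lambda>p. \<phi> (fst p, fst (snd p)))"
  have hh[measurable]: "hh \<in> borel_measurable (?N \<Otimes>\<^sub>M ?N)" unfolding hh_def by measurable
  have m: "hh \<in> borel_measurable (distr M ?N U \<Otimes>\<^sub>M distr M ?N ?E)"
    using hh by (simp cong: measurable_cong_sets sets_pair_measure_cong)
  have "(\<integral>\<^sup>+\<omega>. \<phi> (U \<omega>, ?D \<omega>) \<partial>M) = (\<integral>\<^sup>+p. hh p \<partial>(distr M (?N \<Otimes>\<^sub>M ?N) (\<lambda>\<omega>. (U \<omega>, ?E \<omega>))))"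
    by (simp add: nn_integral_distr hh_def)
  also have "\<dots> = (\<integral>\<^sup>+u. \<integral>\<^sup>+z. hh (u, z) \<partial>(distr M ?N ?E) \<partial>(distr M ?N U))"
    unfolding j[symmetric] by (rule P2.nn_integral_fst[OF m, symmetric])
  also have "\<dots> = (\<integral>\<^sup>+\<omega>. \<integral>\<^sup>+z. hh (U \<omega>, z) \<partial>(distr M ?N ?E) \<partial>M)"
    by (rule nn_integral_distr) (use m in \<open>simp_all cong: measurable_cong_sets\<close>)
  also have "\<dots> = (\<integral>\<^sup>+\<omega>. (\<integral>\<^sup>+z. \<phi> (U \<omega>, z) * ennreal (normal_density 0 (sqrt (t - s)) z) \<partial>lborel) \<partial>M)"
  proof (rule nn_integral_cong)
    fix \<omega>
    have "(\<integral>\<^sup>+z. hh (U \<omega>, z) \<partial>(distr M ?N ?E)) = (\<integral>\<^sup>+\<omega>'. \<phi> (U \<omega>, ?D \<omega>') \<partial>M)"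
      by (simp add: nn_integral_distr hh_def)
    also have "\<dots> = (\<integral>\<^sup>+z. ennreal (normal_density 0 (sqrt (t - s)) z) * \<phi> (U \<omega>, z) \<partial>lborel)"
      using distributed_nn_integral[OF increment_distributed[OF assms(1,2)], of "\<lambda>z. \<phi> (U \<omega>, z)"] by simp
    finally show "(\<integral>\<^sup>+z. hh (U \<omega>, z) \<partial>(distr M ?N ?E)) = (\<integral>\<^sup>+z. \<phi> (U \<omega>, z) * ennreal (normal_density 0 (sqrt (t - s)) z) \<partial>lborel)"
      by (simp add: mult.commute)
  qed
  finally show ?thesis .
qed

lemma grid_mono:
  fixes q :: "nat \<Rightarrow> real"
  assumes "\<And>j. j < n \<Longrightarrow> q j < q (Suc j)" "i \<le> j" "j \<le> n"
  shows "q i \<le> q j"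
  using assms(2,3)
proof (induction j)
  case (Suc j)
  then show ?case using assms(1)[of j] by (cases "i = Suc j") auto
qed simp

lemma grid_sum_measurable:
  assumes q: "0 \<le> q 0" "\<And>j. j < n \<Longrightarrow> q j < q (Suc j)"
    and \<xi>: "\<And>j. j < n \<Longrightarrow> \<xi> j \<in> borel_measurable (F (q j))" and n: "k \<le> n"
  shows "(\<lambda>\<omega>. \<Sum>j<k. \<xi> j \<omega> * (B (q (Suc j)) \<omega> - B (q j) \<omega>)) \<in> borel_measurable (F (q k))"
    and "(\<lambda>\<omega>. \<Sum>j<k. (\<xi> j \<omega>)\<^sup>2 * (q (Suc j) - q j)) \<in> borel_measurable (F (q k))"
proof -
  have m: "q i \<le> q j" if "i \<le> j" "j \<le> n" for i j by (rule grid_mono[where n=n]) (use q(2) that in auto)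
  have B1: "B (q j) \<in> borel_measurable (F (q k))" if "j \<le> k" for j
    using m[of 0 j] m[of j k] that n q(1) by (intro measurable_F_mono[OF B_measurable_F]) auto
  have X1: "\<xi> j \<in> borel_measurable (F (q k))" if "j < k" for j
    using m[of j k] that n by (intro measurable_F_mono[OF \<xi>]) auto
  show "(\<lambda>\<omega>. \<Sum>j<k. \<xi> j \<omega> * (B (q (Suc j)) \<omega> - B (q j) \<omega>)) \<in> borel_measurable (F (q k))"
    by (intro borel_measurable_sum borel_measurable_times borel_measurable_diff B1 X1) auto
  show "(\<lambda>\<omega>. \<Sum>j<k. (\<xi> j \<omega>)\<^sup>2 * (q (Suc j) - q j)) \<in> borel_measurable (F (q k))"
    by (intro borel_measurable_sum borel_measurable_times borel_measurable_power X1 borel_measurable_const) auto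
qed

text \<open>The last increment is integrated first, given the past: by the tilting identity its
  factor has integral 1, and the rest is the shorter sum. The integrand is nonnegative, so unbounded
  coefficients raise no question of integrability.\<close>

lemma exponential_martingale_grid:
  assumes q: "0 \<le> q 0" "\<And>j. j < n \<Longrightarrow> q j < q (Suc j)"
    and \<xi>: "\<And>j. j < n \<Longrightarrow> \<xi> j \<in> borel_measurable (F (q j))"
  shows "(\<integral>\<^sup>+\<omega>. ennreal (exp ((\<Sum>j<n. \<xi> j \<omega> * (B (q (Suc j)) \<omega> - B (q j) \<omega>))
      - (\<Sum>j<n. (\<xi> j \<omega>)\<^sup>2 * (q (Suc j) - q j)) / 2)) \<partial>M) = 1"
  using assms
proof (induction n)
  case 0
  then show ?case by (simp add: emeasure_space_1)
next
  case (Suc n)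
  let ?I = "\<lambda>\<omega>. \<Sum>j<n. \<xi> j \<omega> * (B (q (Suc j)) \<omega> - B (q j) \<omega>)"
  let ?V = "\<lambda>\<omega>. \<Sum>j<n. (\<xi> j \<omega>)\<^sup>2 * (q (Suc j) - q j)"
  define v where "v = q (Suc n) - q n"
  have v: "v > 0" using Suc.prems(2)[of n] by (simp add: v_def)
  have qn: "0 \<le> q n" using grid_mono[of "Suc n" q 0 n] Suc.prems by auto
  have [measurable]: "(fst :: real \<times> real \<Rightarrow> real) \<in> borel_measurable borel"
    "(snd :: real \<times> real \<Rightarrow> real) \<in> borel_measurable borel"
    by (intro borel_measurable_continuous_onI continuous_intros)+
  define \<phi> :: "(real \<times> real) \<times> real \<Rightarrow> ennreal"
    where "\<phi> = (\<lambda>p. ennreal (exp (fst (fst p))) * ennreal (exp (snd (fst p) * snd p - (snd (fst p))\<^sup>2 * v / 2)))"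
  have U: "(\<lambda>\<omega>. (?I \<omega> - ?V \<omega> / 2, \<xi> n \<omega>)) \<in> borel_measurable (F (q n))"
    using grid_sum_measurable[of q "Suc n" \<xi> n] Suc.prems
    by (intro borel_measurable_Pair borel_measurable_diff borel_measurable_divide) auto
  have "(\<integral>\<^sup>+\<omega>. ennreal (exp ((\<Sum>j<Suc n. \<xi> j \<omega> * (B (q (Suc j)) \<omega> - B (q j) \<omega>))
      - (\<Sum>j<Suc n. (\<xi> j \<omega>)\<^sup>2 * (q (Suc j) - q j)) / 2)) \<partial>M)
    = (\<integral>\<^sup>+\<omega>. \<phi> ((?I \<omega> - ?V \<omega> / 2, \<xi> n \<omega>), B (q (Suc n)) \<omega> - B (q n) \<omega>) \<partial>M)"
    by (intro nn_integral_cong)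
      (simp add: \<phi>_def ennreal_mult'[symmetric] exp_add[symmetric] v_def algebra_simps add_divide_distrib diff_divide_distrib)
  also have "\<dots> = (\<integral>\<^sup>+\<omega>. (\<integral>\<^sup>+z. \<phi> ((?I \<omega> - ?V \<omega> / 2, \<xi> n \<omega>), z) * ennreal (normal_density 0 (sqrt (q (Suc n) - q n)) z) \<partial>lborel) \<partial>M)"
    by (rule nn_integral_freeze[OF qn _ U]) (use Suc.prems(2)[of n] in \<open>auto simp: \<phi>_def\<close>)
  also have "\<dots> = (\<integral>\<^sup>+\<omega>. ennreal (exp (?I \<omega> - ?V \<omega> / 2)) \<partial>M)"
    using normal_exponential_integral[OF v]
    by (intro nn_integral_cong) (simp add: \<phi>_def v_def[symmetric] mult.assoc nn_integral_cmult)
  also have "\<dots> = 1"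
    using Suc.IH Suc.prems by simp
  finally show ?case .
qed

lemma increment_moments:
  assumes "0 \<le> s" "s < t"
  shows "integrable M (\<lambda>\<omega>. B t \<omega> - B s \<omega>)" "(\<integral>\<omega>. B t \<omega> - B s \<omega> \<partial>M) = 0"
    "integrable M (\<lambda>\<omega>. (B t \<omega> - B s \<omega>)\<^sup>2)" "(\<integral>\<omega>. (B t \<omega> - B s \<omega>)\<^sup>2 \<partial>M) = t - s"
proof -
  let ?D = "\<lambda>\<omega>. B t \<omega> - B s \<omega>"
  have v: "0 < sqrt (t - s)" using assms by simp
  note D = increment_distributed[OF assms]
  show "integrable M ?D"
    using integrable_normal_moment_nz_1[OF v, of 0]
    by (subst distributed_integrable[OF D, of "\<lambda>x. x", symmetric]) auto
  show E: "(\<integral>\<omega>. ?D \<omega> \<partial>M) = 0" by (rule normal_distributed_expectation[OF v D])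
  show "integrable M (\<lambda>\<omega>. (?D \<omega>)\<^sup>2)"
    using integrable_normal_moment[OF v, of 0 2]
    by (subst distributed_integrable[OF D, of "\<lambda>x. x\<^sup>2", symmetric]) auto
  show "(\<integral>\<omega>. (?D \<omega>)\<^sup>2 \<partial>M) = t - s"
    using normal_distributed_variance[OF v D] E assms by simp
qed

text \<open>On expanding the square, the cross term is the mean of an integrable past quantity times
  an independent centred increment, hence 0. Boundedness of the coefficients supplies the
  integrability.\<close>

lemma isometry_grid:
  assumes q: "0 \<le> q 0" "\<And>j. j < n \<Longrightarrow> q j < q (Suc j)"
    and \<xi>: "\<And>j. j < n \<Longrightarrow> \<xi> j \<in> borel_measurable (F (q j))"
    and bd: "\<And>j. j < n \<Longrightarrow> \<exists>c. \<forall>\<omega>\<in>space M. \<bar>\<xi> j \<omega>\<bar> \<le> c"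
  shows "integrable M (\<lambda>\<omega>. (\<Sum>j<n. \<xi> j \<omega> * (B (q (Suc j)) \<omega> - B (q j) \<omega>))\<^sup>2) \<and>
    integrable M (\<lambda>\<omega>. \<Sum>j<n. (\<xi> j \<omega>)\<^sup>2 * (q (Suc j) - q j)) \<and>
    (\<integral>\<omega>. (\<Sum>j<n. \<xi> j \<omega> * (B (q (Suc j)) \<omega> - B (q j) \<omega>))\<^sup>2 \<partial>M) = (\<integral>\<omega>. (\<Sum>j<n. (\<xi> j \<omega>)\<^sup>2 * (q (Suc j) - q j)) \<partial>M)"
  using assms
proof (induction n)
  case 0
  then show ?case by simp
next
  case (Suc n)
  let ?I = "\<lambda>\<omega>. \<Sum>j<n. \<xi> j \<omega> * (B (q (Suc j)) \<omega> - B (q j) \<omega>)"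
  let ?V = "\<lambda>\<omega>. \<Sum>j<n. (\<xi> j \<omega>)\<^sup>2 * (q (Suc j) - q j)"
  let ?D = "\<lambda>\<omega>. B (q (Suc n)) \<omega> - B (q n) \<omega>"
  have qn: "0 \<le> q n" "q n < q (Suc n)" using grid_mono[of "Suc n" q 0 n] Suc.prems by auto
  have IH: "integrable M (\<lambda>\<omega>. (?I \<omega>)\<^sup>2)" "integrable M ?V" "(\<integral>\<omega>. (?I \<omega>)\<^sup>2 \<partial>M) = (\<integral>\<omega>. ?V \<omega> \<partial>M)"
    using Suc.IH Suc.prems by auto
  obtain c where c: "\<And>\<omega>. \<omega> \<in> space M \<Longrightarrow> \<bar>\<xi> n \<omega>\<bar> \<le> c" using Suc.prems(4)[of n] by auto
  have xF: "\<xi> n \<in> borel_measurable (F (q n))" using Suc.prems by auto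
  have x[measurable]: "\<xi> n \<in> borel_measurable M" using measurable_F[OF xF] .
  have IF: "?I \<in> borel_measurable (F (q n))" using grid_sum_measurable(1)[of q "Suc n" \<xi> n] Suc.prems by auto
  have I[measurable]: "?I \<in> borel_measurable M" using measurable_F[OF IF] .
  have Iint: "integrable M ?I" by (rule square_integrable_imp_integrable[OF I IH(1)])
  have UF: "(\<lambda>\<omega>. ?I \<omega> * \<xi> n \<omega>) \<in> borel_measurable (F (q n))" using IF xF by (intro borel_measurable_times)
  have Uint: "integrable M (\<lambda>\<omega>. ?I \<omega> * \<xi> n \<omega>)"
  proof (rule Bochner_Integration.integrable_bound[where f="\<lambda>\<omega>. c * ?I \<omega>"])
    show "AE \<omega> in M. norm (?I \<omega> * \<xi> n \<omega>) \<le> norm (c * ?I \<omega>)"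
    proof (rule AE_I2)
      fix \<omega> assume "\<omega> \<in> space M"
      with c have "\<bar>\<xi> n \<omega>\<bar> \<le> \<bar>c\<bar>" by force
      then show "norm (?I \<omega> * \<xi> n \<omega>) \<le> norm (c * ?I \<omega>)"
        by (simp add: abs_mult mult.commute mult_right_mono)
    qed
  qed (use Iint in auto)
  have x2F: "(\<lambda>\<omega>. (\<xi> n \<omega>)\<^sup>2) \<in> borel_measurable (F (q n))" using xF by (intro borel_measurable_power)
  have x2int: "integrable M (\<lambda>\<omega>. (\<xi> n \<omega>)\<^sup>2)"
  proof (rule integrable_const_bound[where B="c\<^sup>2"])
    show "AE \<omega> in M. norm ((\<xi> n \<omega>)\<^sup>2) \<le> c\<^sup>2"
      using c by (intro AE_I2) (simp add: abs_le_square_iff[symmetric] power2_abs, metis abs_le_self_iff abs_of_nonneg abs_ge_zero order_trans power2_abs power_mono)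
  qed simp
  have ind1: "indep_var borel (\<lambda>\<omega>. ?I \<omega> * \<xi> n \<omega>) borel ?D"
    by (rule increment_indep[OF qn UF, of "\<lambda>x. x" borel]) simp
  note mom = increment_moments[OF qn]
  have c1: "(\<integral>\<omega>. (?I \<omega> * \<xi> n \<omega>) * ?D \<omega> \<partial>M) = 0" "integrable M (\<lambda>\<omega>. (?I \<omega> * \<xi> n \<omega>) * ?D \<omega>)"
    using indep_var_lebesgue_integral[OF ind1 Uint mom(1)]
      indep_var_integrable[OF ind1 Uint mom(1)] mom(2) by auto
  have ind2: "indep_var borel (\<lambda>\<omega>. (\<xi> n \<omega>)\<^sup>2) borel (\<lambda>\<omega>. (?D \<omega>)\<^sup>2)"
    by (rule increment_indep[OF qn x2F, of "\<lambda>x. x\<^sup>2" borel]) simp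
  have c2: "(\<integral>\<omega>. (\<xi> n \<omega>)\<^sup>2 * (?D \<omega>)\<^sup>2 \<partial>M) = (\<integral>\<omega>. (\<xi> n \<omega>)\<^sup>2 \<partial>M) * (q (Suc n) - q n)" "integrable M (\<lambda>\<omega>. (\<xi> n \<omega>)\<^sup>2 * (?D \<omega>)\<^sup>2)"
    using indep_var_lebesgue_integral[OF ind2 x2int mom(3)]
      indep_var_integrable[OF ind2 x2int mom(3)] mom(4) by auto
  have e: "(\<Sum>j<Suc n. \<xi> j \<omega> * (B (q (Suc j)) \<omega> - B (q j) \<omega>))\<^sup>2
    = (?I \<omega>)\<^sup>2 + 2 * ((?I \<omega> * \<xi> n \<omega>) * ?D \<omega>) + (\<xi> n \<omega>)\<^sup>2 * (?D \<omega>)\<^sup>2" for \<omega>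
    by (simp add: power2_eq_square algebra_simps)
  have i1: "integrable M (\<lambda>\<omega>. (\<Sum>j<Suc n. \<xi> j \<omega> * (B (q (Suc j)) \<omega> - B (q j) \<omega>))\<^sup>2)"
    unfolding e using IH(1) c1(2) c2(2) by (intro Bochner_Integration.integrable_add integrable_mult_right) auto
  have i2: "integrable M (\<lambda>\<omega>. \<Sum>j<Suc n. (\<xi> j \<omega>)\<^sup>2 * (q (Suc j) - q j))"
    using IH(2) x2int by simp
  have "(\<integral>\<omega>. (\<Sum>j<Suc n. \<xi> j \<omega> * (B (q (Suc j)) \<omega> - B (q j) \<omega>))\<^sup>2 \<partial>M)
    = (\<integral>\<omega>. (?I \<omega>)\<^sup>2 \<partial>M) + 2 * (\<integral>\<omega>. (?I \<omega> * \<xi> n \<omega>) * ?D \<omega> \<partial>M) + (\<integral>\<omega>. (\<xi> n \<omega>)\<^sup>2 * (?D \<omega>)\<^sup>2 \<partial>M)"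
    unfolding e using IH(1) c1(2) c2(2) by (simp add: Bochner_Integration.integral_add)
  also have "\<dots> = (\<integral>\<omega>. (\<Sum>j<Suc n. (\<xi> j \<omega>)\<^sup>2 * (q (Suc j) - q j)) \<partial>M)"
    using IH x2int c1(1) c2(1) by simp
  finally show ?case using i1 i2 by blast
qed

end

section \<open>Lenglart's inequality for elementary integrands\<close>

context brownian
begin

text \<open>The sum is stopped before its accumulated variance exceeds \<delta>. The stopped sum has
  second moment at most \<delta>, so Markov's inequality gives the second term; where the total
  variance is at most \<delta>, stopping changes nothing.\<close>

lemma lenglart_grid:
  assumes q: "0 \<le> q 0" "\<And>j. j < n \<Longrightarrow> q j < q (Suc j)"
    and \<xi>: "\<And>j. j < n \<Longrightarrow> \<xi> j \<in> borel_measurable (F (q j))"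
    and bd: "\<And>j. j < n \<Longrightarrow> \<exists>c. \<forall>\<omega>\<in>space M. \<bar>\<xi> j \<omega>\<bar> \<le> c"
    and pos: "0 < \<delta>" "0 < \<epsilon>"
  shows "prob {\<omega>\<in>space M. \<epsilon> < \<bar>\<Sum>j<n. \<xi> j \<omega> * (B (q (Suc j)) \<omega> - B (q j) \<omega>)\<bar>}
    \<le> prob {\<omega>\<in>space M. \<delta> < (\<Sum>j<n. (\<xi> j \<omega>)\<^sup>2 * (q (Suc j) - q j))} + \<delta> / \<epsilon>\<^sup>2"
proof -
  define w where "w j \<omega> = (\<xi> j \<omega>)\<^sup>2 * (q (Suc j) - q j)" for j \<omega>
  have w0: "0 \<le> w j \<omega>" if "j < n" for j \<omega> using q(2)[OF that] by (simp add: w_def)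
  \<comment> \<open>The accumulated variance includes the j-th term. That term is already known at
    time q j, so the coefficient stays measurable there and the retained variance never overshoots
    \<delta>.\<close>
  define \<zeta> where "\<zeta> j \<omega> = (if (\<Sum>i<Suc j. w i \<omega>) \<le> \<delta> then \<xi> j \<omega> else 0)" for j \<omega>
  let ?I = "\<lambda>\<omega>. \<Sum>j<n. \<xi> j \<omega> * (B (q (Suc j)) \<omega> - B (q j) \<omega>)"
  let ?J = "\<lambda>\<omega>. \<Sum>j<n. \<zeta> j \<omega> * (B (q (Suc j)) \<omega> - B (q j) \<omega>)"
  have m: "q i \<le> q j" if "i \<le> j" "j \<le> n" for i j by (rule grid_mono[where n=n]) (use q(2) that in auto)
  have wF: "(\<lambda>\<omega>. \<Sum>i<Suc j. w i \<omega>) \<in> borel_measurable (F (q j))" if "j < n" for j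
    unfolding w_def using that
    by (intro borel_measurable_sum borel_measurable_times borel_measurable_power borel_measurable_const
        measurable_F_mono[OF \<xi>] m) auto
  have \<zeta>F: "\<zeta> j \<in> borel_measurable (F (q j))" if "j < n" for j
    unfolding \<zeta>_def using wF[OF that] \<xi>[OF that] by measurable
  have \<zeta>bd: "\<exists>c. \<forall>\<omega>\<in>space M. \<bar>\<zeta> j \<omega>\<bar> \<le> c" if j: "j < n" for j
  proof -
    obtain c where "\<forall>\<omega>\<in>space M. \<bar>\<xi> j \<omega>\<bar> \<le> c" using bd[OF j] by blast
    then have "\<forall>\<omega>\<in>space M. \<bar>\<zeta> j \<omega>\<bar> \<le> \<bar>c\<bar>" unfolding \<zeta>_def by force
    then show ?thesis by blast
  qed
  have le: "(\<Sum>j<k. (\<zeta> j \<omega>)\<^sup>2 * (q (Suc j) - q j)) \<le> \<delta>" if "k \<le> n" for k \<omega>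
    using that
  proof (induction k)
    case (Suc k)
    have le1: "(\<zeta> j \<omega>)\<^sup>2 * (q (Suc j) - q j) \<le> w j \<omega>" if "j < n" for j
      using w0[OF that, of \<omega>] by (simp add: \<zeta>_def w_def)
    show ?case
    proof (cases "(\<Sum>i<Suc k. w i \<omega>) \<le> \<delta>")
      case True
      have "(\<Sum>j<Suc k. (\<zeta> j \<omega>)\<^sup>2 * (q (Suc j) - q j)) \<le> (\<Sum>i<Suc k. w i \<omega>)"
        by (rule sum_mono) (use le1 Suc.prems in auto)
      with True show ?thesis by simp
    next
      case False
      then show ?thesis using Suc by (simp add: \<zeta>_def)
    qed
  qed (use pos in simp)
  note iso = isometry_grid[of q n \<zeta>, OF q \<zeta>F \<zeta>bd]
  have EJ: "(\<integral>\<omega>. (?J \<omega>)\<^sup>2 \<partial>M) \<le> \<delta>"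
  proof -
    have "(\<integral>\<omega>. (?J \<omega>)\<^sup>2 \<partial>M) = (\<integral>\<omega>. (\<Sum>j<n. (\<zeta> j \<omega>)\<^sup>2 * (q (Suc j) - q j)) \<partial>M)" using iso by blast
    also have "\<dots> \<le> (\<integral>\<omega>. \<delta> \<partial>M)" by (rule integral_mono) (use iso le in auto)
    finally show ?thesis by (simp add: prob_space)
  qed
  have Imeas[measurable]: "?I \<in> borel_measurable M"
    by (rule measurable_F[OF grid_sum_measurable(1)[of q n \<xi> n]]) (use q \<xi> in auto)
  have Jmeas[measurable]: "?J \<in> borel_measurable M"
    by (rule measurable_F[OF grid_sum_measurable(1)[of q n \<zeta> n]]) (use q \<zeta>F in auto)
  have Vmeas[measurable]: "(\<lambda>\<omega>. \<Sum>j<n. w j \<omega>) \<in> borel_measurable M"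
    unfolding w_def
    by (rule measurable_F[OF grid_sum_measurable(2)[of q n \<xi> n]]) (use q \<xi> in auto)
  have sub: "{\<omega>\<in>space M. \<epsilon> < \<bar>?I \<omega>\<bar>} \<subseteq> {\<omega>\<in>space M. \<delta> < (\<Sum>j<n. w j \<omega>)} \<union> {\<omega>\<in>space M. \<epsilon>\<^sup>2 \<le> (?J \<omega>)\<^sup>2}"
  proof safe
    fix \<omega> assume w: "\<omega> \<in> space M" "\<epsilon> < \<bar>?I \<omega>\<bar>" and nJ: "\<not> \<epsilon>\<^sup>2 \<le> (?J \<omega>)\<^sup>2"
    show "\<delta> < (\<Sum>j<n. w j \<omega>)"
    proof (rule ccontr)
      assume c: "\<not> \<delta> < (\<Sum>j<n. w j \<omega>)"
      have "(\<Sum>i<Suc j. w i \<omega>) \<le> (\<Sum>j<n. w j \<omega>)" if "j < n" for j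
        by (rule sum_mono2) (use w0 that in auto)
      then have "\<zeta> j \<omega> = \<xi> j \<omega>" if "j < n" for j using c that unfolding \<zeta>_def by fastforce
      then have "?J \<omega> = ?I \<omega>" by simp
      then show False using w(2) nJ pos by (simp add: abs_le_square_iff[symmetric])
    qed
  qed
  have "prob {\<omega>\<in>space M. \<epsilon> < \<bar>?I \<omega>\<bar>} \<le> prob ({\<omega>\<in>space M. \<delta> < (\<Sum>j<n. w j \<omega>)} \<union> {\<omega>\<in>space M. \<epsilon>\<^sup>2 \<le> (?J \<omega>)\<^sup>2})"
    by (rule finite_measure_mono[OF sub]) measurable
  also have "\<dots> \<le> prob {\<omega>\<in>space M. \<delta> < (\<Sum>j<n. w j \<omega>)} + prob {\<omega>\<in>space M. \<epsilon>\<^sup>2 \<le> (?J \<omega>)\<^sup>2}"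
    by (rule measure_Un_le) measurable
  also have "prob {\<omega>\<in>space M. \<epsilon>\<^sup>2 \<le> (?J \<omega>)\<^sup>2} \<le> (\<integral>\<omega>. (?J \<omega>)\<^sup>2 \<partial>M) / \<epsilon>\<^sup>2"
  proof (rule integral_Markov_inequality_measure[where A="{}"])
    show "integrable M (\<lambda>\<omega>. (?J \<omega>)\<^sup>2)" using iso by blast
    show "0 < \<epsilon>\<^sup>2" using pos by simp
  qed auto
  also have "\<dots> \<le> \<delta> / \<epsilon>\<^sup>2" using EJ pos by (simp add: divide_right_mono)
  finally show ?thesis unfolding w_def by simp
qed

text \<open>Pairs an integrand with its integral independently of any partition, so sums and
  differences of simple processes with different partitions need no common refinement at this
  stage.\<close>

inductive elementary :: "(real \<Rightarrow> 'a \<Rightarrow> real) \<Rightarrow> ('a \<Rightarrow> real) \<Rightarrow> bool" where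
  elementary_zero: "elementary (\<lambda>s \<omega>. 0) (\<lambda>\<omega>. 0)"
| elementary_step: "elementary G I \<Longrightarrow> 0 \<le> a \<Longrightarrow> a \<le> b \<Longrightarrow> \<zeta> \<in> borel_measurable (F a) \<Longrightarrow>
    \<exists>c. \<forall>\<omega>\<in>space M. \<bar>\<zeta> \<omega>\<bar> \<le> c \<Longrightarrow>
    elementary (\<lambda>s \<omega>. G s \<omega> + \<zeta> \<omega> * indicator {a<..b} s) (\<lambda>\<omega>. I \<omega> + \<zeta> \<omega> * (B b \<omega> - B a \<omega>))"

lemma elementary_add:
  "elementary G' I' \<Longrightarrow> elementary G I \<Longrightarrow> elementary (\<lambda>s \<omega>. G s \<omega> + G' s \<omega>) (\<lambda>\<omega>. I \<omega> + I' \<omega>)"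
proof (induction rule: elementary.induct)
  case (elementary_step G' I' a b \<zeta>)
  then show ?case
    using elementary.elementary_step[OF elementary_step.IH[OF elementary_step.prems] elementary_step.hyps(2-5)]
    by (simp add: add.assoc)
qed simp

lemma elementary_uminus: "elementary G I \<Longrightarrow> elementary (\<lambda>s \<omega>. - G s \<omega>) (\<lambda>\<omega>. - I \<omega>)"
proof (induction rule: elementary.induct)
  case (elementary_step G I a b \<zeta>)
  have "elementary (\<lambda>s \<omega>. - G s \<omega> + - \<zeta> \<omega> * indicator {a<..b} s) (\<lambda>\<omega>. - I \<omega> + - \<zeta> \<omega> * (B b \<omega> - B a \<omega>))"
    using elementary_step by (intro elementary.elementary_step) auto
  then show ?case by (simp add: algebra_simps)
qed (simp add: elementary_zero)

lemma elementary_diff: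
  "elementary G I \<Longrightarrow> elementary G' I' \<Longrightarrow> elementary (\<lambda>s \<omega>. G s \<omega> - G' s \<omega>) (\<lambda>\<omega>. I \<omega> - I' \<omega>)"
  using elementary_add[OF elementary_uminus] by fastforce

lemma elementary_sum:
  assumes "finite A" "\<And>i. i \<in> A \<Longrightarrow> elementary (G i) (I i)"
  shows "elementary (\<lambda>s \<omega>. \<Sum>i\<in>A. G i s \<omega>) (\<lambda>\<omega>. \<Sum>i\<in>A. I i \<omega>)"
  using assms
proof (induction A)
  case (insert x A)
  then show ?case using elementary_add[of "\<lambda>s \<omega>. \<Sum>i\<in>A. G i s \<omega>" "\<lambda>\<omega>. \<Sum>i\<in>A. I i \<omega>" "G x" "I x"] by simp
qed (simp add: elementary_zero)

lemma elementary_term: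
  assumes "0 \<le> a" "a \<le> b" "\<zeta> \<in> borel_measurable (F a)" "\<exists>c. \<forall>\<omega>\<in>space M. \<bar>\<zeta> \<omega>\<bar> \<le> c"
  shows "elementary (\<lambda>s \<omega>. \<zeta> \<omega> * indicator {a<..b} s) (\<lambda>\<omega>. \<zeta> \<omega> * (B b \<omega> - B a \<omega>))"
  using elementary_step[OF elementary_zero assms] by simp

lemma elementary_measurable:
  assumes "elementary G I"
  shows "(\<lambda>(s, \<omega>). G s \<omega>) \<in> borel_measurable (borel \<Otimes>\<^sub>M M)" "I \<in> borel_measurable M"
  using assms
proof (induction rule: elementary.induct)
  case (elementary_step G I a b \<zeta>)
  have z[measurable]: "\<zeta> \<in> borel_measurable M" by (rule measurable_F) fact
  have [measurable]: "B a \<in> borel_measurable M" "B b \<in> borel_measurable M"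
    using elementary_step by (auto intro: B_measurable)
  note elementary_step(6,7)[measurable]
  { case 1 show ?case by (subst split_beta') (use elementary_step(6) in \<open>simp add: split_beta'\<close>) }
  { case 2 show ?case by measurable }
qed simp_all

text \<open>The break points are exposed as a finite set and the representation is claimed on every
  grid through them; an induction step then only has to add the two new end points. Values are read
  at right end points because the intervals are open on the left.\<close>

lemma elementary_grid:
  assumes "elementary G I"
  shows "\<exists>A. finite A \<and> A \<subseteq> {0..} \<and> (\<forall>n q. 0 \<le> q 0 \<longrightarrow> (\<forall>j<n. q j < q (Suc j)) \<longrightarrow> A \<subseteq> q ` {..n} \<longrightarrow>
    (\<forall>j<n. (\<lambda>\<omega>. G (q (Suc j)) \<omega>) \<in> borel_measurable (F (q j)) \<and>
      (\<exists>c. \<forall>\<omega>\<in>space M. \<bar>G (q (Suc j)) \<omega>\<bar> \<le> c) \<and>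
      (\<forall>s\<in>{q j<..q (Suc j)}. \<forall>\<omega>. G s \<omega> = G (q (Suc j)) \<omega>)) \<and>
    (\<forall>\<omega>. I \<omega> = (\<Sum>j<n. G (q (Suc j)) \<omega> * (B (q (Suc j)) \<omega> - B (q j) \<omega>))))"
  using assms
proof (induction rule: elementary.induct)
  case elementary_zero
  show ?case by (rule exI[of _ "{}"]) auto
next
  case (elementary_step G I a b \<zeta>)
  from elementary_step.IH obtain A where A: "finite A" "A \<subseteq> {0..}"
    and rep: "\<And>n q. 0 \<le> q 0 \<Longrightarrow> (\<forall>j<n. q j < q (Suc j)) \<Longrightarrow> A \<subseteq> q ` {..n} \<Longrightarrow>
    (\<forall>j<n. (\<lambda>\<omega>. G (q (Suc j)) \<omega>) \<in> borel_measurable (F (q j)) \<and>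
      (\<exists>c. \<forall>\<omega>\<in>space M. \<bar>G (q (Suc j)) \<omega>\<bar> \<le> c) \<and>
      (\<forall>s\<in>{q j<..q (Suc j)}. \<forall>\<omega>. G s \<omega> = G (q (Suc j)) \<omega>)) \<and>
    (\<forall>\<omega>. I \<omega> = (\<Sum>j<n. G (q (Suc j)) \<omega> * (B (q (Suc j)) \<omega> - B (q j) \<omega>)))"
    by blast
  show ?case
  proof (intro exI[of _ "insert a (insert b A)"] conjI allI impI ballI)
    show "finite (insert a (insert b A))" "insert a (insert b A) \<subseteq> {0..}"
      using A elementary_step by auto
    fix n and q :: "nat \<Rightarrow> real"
    assume q: "0 \<le> q 0" "\<forall>j<n. q j < q (Suc j)" and sub: "insert a (insert b A) \<subseteq> q ` {..n}"
    have le: "q i \<le> q j" if "i \<le> j" "j \<le> n" for i j by (rule grid_mono[where n=n]) (use q that in auto)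
    have lt: "q i < q j" if "i < j" "j \<le> n" for i j
      using q(2) le[of "Suc i" j] that by (meson Suc_leI less_le_trans order_less_le_trans)
    obtain \<alpha> \<beta> where ab: "a = q \<alpha>" "b = q \<beta>" "\<alpha> \<le> n" "\<beta> \<le> n" using sub by auto
    have \<alpha>\<beta>: "\<alpha> \<le> \<beta>" using lt[of \<beta> \<alpha>] ab elementary_step.hyps by (meson leD not_le_imp_less)
    have ind: "indicator {a<..b} s = (if \<alpha> \<le> j \<and> j < \<beta> then 1 else 0 :: real)"
      if "j < n" "s \<in> {q j<..q (Suc j)}" for j s
    proof -
      have "a < s \<longleftrightarrow> \<alpha> \<le> j" using le[of \<alpha> j] le[of "Suc j" \<alpha>] that ab
        by (metis Suc_leI greaterThanAtMost_iff leD le_less_trans less_imp_le_nat not_less order.trans)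
      moreover have "s \<le> b \<longleftrightarrow> j < \<beta>" using le[of \<beta> j] le[of "Suc j" \<beta>] that ab
        by (metis Suc_leI greaterThanAtMost_iff leD less_imp_le_nat not_less order.trans)
      ultimately show ?thesis by (simp add: indicator_def)
    qed
    have ind1: "indicator {a<..b} (q (Suc j)) = (if \<alpha> \<le> j \<and> j < \<beta> then 1 else 0 :: real)" if "j < n" for j
      using ind[OF that, of "q (Suc j)"] q(2) that by simp
    have sub': "A \<subseteq> q ` {..n}" using sub by simp
    note R = rep[OF q(1,2) sub']
    have R1: "(\<lambda>\<omega>. G (q (Suc j)) \<omega>) \<in> borel_measurable (F (q j))" if "j < n" for j
      using conjunct1[OF R, rule_format, OF that] by (elim conjE)
    have R2: "\<exists>c. \<forall>\<omega>\<in>space M. \<bar>G (q (Suc j)) \<omega>\<bar> \<le> c" if "j < n" for j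
      using conjunct1[OF R, rule_format, OF that] by (elim conjE)
    have R3: "G s \<omega> = G (q (Suc j)) \<omega>" if "j < n" "s \<in> {q j<..q (Suc j)}" for j s \<omega>
      using conjunct1[OF R, rule_format, OF that(1)] that(2) by (elim conjE) (drule (1) bspec, erule spec)
    note R4 = conjunct2[OF R, rule_format]
    obtain c0 where c0: "\<And>\<omega>. \<omega> \<in> space M \<Longrightarrow> \<bar>\<zeta> \<omega>\<bar> \<le> c0" using elementary_step.hyps by blast
    show "(\<lambda>\<omega>. G (q (Suc j)) \<omega> + \<zeta> \<omega> * indicator {a<..b} (q (Suc j))) \<in> borel_measurable (F (q j))"
      if j: "j < n" for j
    proof (cases "\<alpha> \<le> j \<and> j < \<beta>")
      case True
      have "\<zeta> \<in> borel_measurable (F (q j))"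
        using True j ab le[of \<alpha> j] by (intro measurable_F_mono[OF elementary_step.hyps(4)]) auto
      moreover have "(\<lambda>\<omega>. G (q (Suc j)) \<omega> + \<zeta> \<omega> * indicator {a<..b} (q (Suc j))) = (\<lambda>\<omega>. G (q (Suc j)) \<omega> + \<zeta> \<omega>)"
        using True by (simp add: ind1[OF j])
      ultimately show ?thesis by (simp only: borel_measurable_add R1[OF j])
    next
      case False
      then have "indicator {a<..b} (q (Suc j)) = (0::real)" using ind1[OF j] by simp
      then show ?thesis using R1[OF j] by simp
    qed
    show "\<exists>c. \<forall>\<omega>\<in>space M. \<bar>G (q (Suc j)) \<omega> + \<zeta> \<omega> * indicator {a<..b} (q (Suc j))\<bar> \<le> c" if j: "j < n" for j
    proof -
      obtain c where c: "\<And>\<omega>. \<omega> \<in> space M \<Longrightarrow> \<bar>G (q (Suc j)) \<omega>\<bar> \<le> c" using R2[OF j] by blast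
      have "\<bar>G (q (Suc j)) \<omega> + \<zeta> \<omega> * indicator {a<..b} (q (Suc j))\<bar> \<le> c + c0" if w: "\<omega> \<in> space M" for \<omega>
        using c[OF w] c0[OF w] by (auto simp: indicator_def)
      then show ?thesis by blast
    qed
    show "G s \<omega> + \<zeta> \<omega> * indicator {a<..b} s = G (q (Suc j)) \<omega> + \<zeta> \<omega> * indicator {a<..b} (q (Suc j))"
      if "j < n" "s \<in> {q j<..q (Suc j)}" for j s \<omega>
      using R3[OF that, of \<omega>] by (simp only: ind[OF that] ind1[OF that(1)])
    fix \<omega>
    let ?d = "\<lambda>j. B (q (Suc j)) \<omega> - B (q j) \<omega>"
    have "(\<Sum>j<n. \<zeta> \<omega> * indicator {a<..b} (q (Suc j)) * ?d j) = (\<Sum>j<n. if j \<in> {\<alpha>..<\<beta>} then \<zeta> \<omega> * ?d j else 0)"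
      by (rule sum.cong) (auto simp: ind1)
    also have "\<dots> = (\<Sum>j\<in>{\<alpha>..<\<beta>}. \<zeta> \<omega> * ?d j)"
      using ab \<alpha>\<beta> by (subst sum.inter_restrict[symmetric]) (auto intro!: sum.cong)
    also have "\<dots> = \<zeta> \<omega> * (B b \<omega> - B a \<omega>)"
      using sum_Suc_diff'[OF \<alpha>\<beta>, of "\<lambda>j. B (q j) \<omega>"] ab by (simp add: sum_distrib_left[symmetric])
    finally have "(\<Sum>j<n. \<zeta> \<omega> * indicator {a<..b} (q (Suc j)) * ?d j) = \<zeta> \<omega> * (B b \<omega> - B a \<omega>)" .
    then show "I \<omega> + \<zeta> \<omega> * (B b \<omega> - B a \<omega>) =
      (\<Sum>j<n. (G (q (Suc j)) \<omega> + \<zeta> \<omega> * indicator {a<..b} (q (Suc j))) * ?d j)"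
      by (simp add: R4[of \<omega>] distrib_right sum.distrib)
  qed
qed

lemma lenglart_elementary:
  assumes el: "elementary G I" and pos: "0 < \<delta>" "0 < \<epsilon>"
  shows "prob {\<omega>\<in>space M. \<epsilon> < \<bar>I \<omega>\<bar>} \<le> prob {\<omega>\<in>space M. ennreal \<delta> < (\<integral>\<^sup>+s. ennreal ((G s \<omega>)\<^sup>2) \<partial>lborel)} + \<delta> / \<epsilon>\<^sup>2"
proof -
  obtain A where A: "finite A" "A \<subseteq> {0..}"
    and rep: "\<And>n q. 0 \<le> q 0 \<Longrightarrow> (\<forall>j<n. q j < q (Suc j)) \<Longrightarrow> A \<subseteq> q ` {..n} \<Longrightarrow>
    (\<forall>j<n. (\<lambda>\<omega>. G (q (Suc j)) \<omega>) \<in> borel_measurable (F (q j)) \<and>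
      (\<exists>c. \<forall>\<omega>\<in>space M. \<bar>G (q (Suc j)) \<omega>\<bar> \<le> c) \<and>
      (\<forall>s\<in>{q j<..q (Suc j)}. \<forall>\<omega>. G s \<omega> = G (q (Suc j)) \<omega>)) \<and>
    (\<forall>\<omega>. I \<omega> = (\<Sum>j<n. G (q (Suc j)) \<omega> * (B (q (Suc j)) \<omega> - B (q j) \<omega>)))"
    using elementary_grid[OF el] by blast
  \<comment> \<open>Adding 0 keeps the grid nonempty even when there are no break points.\<close>
  define xs where "xs = sorted_list_of_set (insert 0 A)"
  have fin: "finite (insert 0 A)" using A by simp
  have xs: "set xs = insert 0 A" "sorted_wrt (<) xs"
    unfolding xs_def using set_sorted_list_of_set[OF fin] strict_sorted_list_of_set[of "insert 0 A"] by blast+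
  then have xs_ne: "xs \<noteq> []" by auto
  define q where "q j = xs ! j" for j
  define n where "n = length xs - 1"
  have q1: "\<forall>j<n. q j < q (Suc j)" using xs(2) by (simp add: q_def n_def sorted_wrt_iff_nth_less)
  have im: "q ` {..n} = set xs"
  proof -
    have "{..n} = {..<length xs}" using xs_ne by (auto simp: n_def) (metis Suc_pred length_greater_0_conv less_Suc_eq_le)
    then show ?thesis by (auto simp: q_def set_conv_nth)
  qed
  have q0: "0 \<le> q 0"
  proof -
    have "q 0 \<in> set xs" using im by auto
    then show ?thesis using A(2) xs(1) by auto
  qed
  have sub: "A \<subseteq> q ` {..n}" using im xs by auto
  note R = rep[OF q0 q1 sub]
  have R1: "(\<lambda>\<omega>. G (q (Suc j)) \<omega>) \<in> borel_measurable (F (q j))" if "j < n" for j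
    using conjunct1[OF R, rule_format, OF that] by (elim conjE)
  have R2: "\<exists>c. \<forall>\<omega>\<in>space M. \<bar>G (q (Suc j)) \<omega>\<bar> \<le> c" if "j < n" for j
    using conjunct1[OF R, rule_format, OF that] by (elim conjE)
  have R3: "G s \<omega> = G (q (Suc j)) \<omega>" if "j < n" "s \<in> {q j<..q (Suc j)}" for j s \<omega>
    using conjunct1[OF R, rule_format, OF that(1)] that(2) by (elim conjE) (drule (1) bspec, erule spec)
  note R4 = conjunct2[OF R, rule_format]
  let ?g = "\<lambda>j \<omega>. G (q (Suc j)) \<omega>"
  \<comment> \<open>The grid intervals are disjoint and the integrand is constant on each, so the
    discrete variance is the part of the energy that lies on the grid.\<close>
  have V: "ennreal (\<Sum>j<n. (?g j \<omega>)\<^sup>2 * (q (Suc j) - q j)) \<le> (\<integral>\<^sup>+s. ennreal ((G s \<omega>)\<^sup>2) \<partial>lborel)" for \<omega>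
  proof -
    have "ennreal (\<Sum>j<n. (?g j \<omega>)\<^sup>2 * (q (Suc j) - q j)) = (\<Sum>j<n. ennreal ((?g j \<omega>)\<^sup>2 * (q (Suc j) - q j)))"
      using q1 by (intro sum_ennreal[symmetric]) auto
    also have "\<dots> = (\<Sum>j<n. (\<integral>\<^sup>+s. ennreal ((?g j \<omega>)\<^sup>2) * indicator {q j<..q (Suc j)} s \<partial>lborel))"
      using q1 by (intro sum.cong refl) (simp add: nn_integral_cmult_indicator ennreal_mult less_imp_le)
    also have "\<dots> = (\<integral>\<^sup>+s. (\<Sum>j<n. ennreal ((?g j \<omega>)\<^sup>2) * indicator {q j<..q (Suc j)} s) \<partial>lborel)"
      by (rule nn_integral_sum[symmetric]) simp
    also have "\<dots> \<le> (\<integral>\<^sup>+s. ennreal ((G s \<omega>)\<^sup>2) \<partial>lborel)"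
    proof (rule nn_integral_mono)
      fix s
      show "(\<Sum>j<n. ennreal ((?g j \<omega>)\<^sup>2) * indicator {q j<..q (Suc j)} s) \<le> ennreal ((G s \<omega>)\<^sup>2)"
      proof (cases "\<exists>j<n. s \<in> {q j<..q (Suc j)}")
        case True
        then obtain j where j: "j < n" "s \<in> {q j<..q (Suc j)}" by blast
        have "s \<notin> {q i<..q (Suc i)}" if "i < n" "i \<noteq> j" for i
        proof (cases "i < j")
          case True
          then have "q (Suc i) \<le> q j" by (intro grid_mono[where n=n]) (use q1 j in auto)
          then show ?thesis using j by auto
        next
          case False
          then have "q (Suc j) \<le> q i" by (intro grid_mono[where n=n]) (use q1 that in auto)
          then show ?thesis using j by auto
        qed
        then have "(\<Sum>i<n. ennreal ((?g i \<omega>)\<^sup>2) * indicator {q i<..q (Suc i)} s)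
          = (\<Sum>i<n. if i = j then ennreal ((?g j \<omega>)\<^sup>2) else 0)"
          using j by (intro sum.cong) auto
        also have "\<dots> = ennreal ((G s \<omega>)\<^sup>2)" using j R3[OF j, of \<omega>] by simp
        finally show ?thesis by simp
      next
        case False
        then have "(\<Sum>j<n. ennreal ((?g j \<omega>)\<^sup>2) * indicator {q j<..q (Suc j)} s) = 0"
          by (intro sum.neutral) auto
        then show ?thesis by simp
      qed
    qed
    finally show ?thesis .
  qed
  note elementary_measurable(1)[OF el, measurable]
  have "prob {\<omega>\<in>space M. \<epsilon> < \<bar>I \<omega>\<bar>} = prob {\<omega>\<in>space M. \<epsilon> < \<bar>\<Sum>j<n. ?g j \<omega> * (B (q (Suc j)) \<omega> - B (q j) \<omega>)\<bar>}"
    by (simp only: R4)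
  also have "\<dots> \<le> prob {\<omega>\<in>space M. \<delta> < (\<Sum>j<n. (?g j \<omega>)\<^sup>2 * (q (Suc j) - q j))} + \<delta> / \<epsilon>\<^sup>2"
    by (rule lenglart_grid) (use q0 q1 R1 R2 pos in auto)
  also have "prob {\<omega>\<in>space M. \<delta> < (\<Sum>j<n. (?g j \<omega>)\<^sup>2 * (q (Suc j) - q j))}
    \<le> prob {\<omega>\<in>space M. ennreal \<delta> < (\<integral>\<^sup>+s. ennreal ((G s \<omega>)\<^sup>2) \<partial>lborel)}"
  proof (rule finite_measure_mono)
    show "{\<omega>\<in>space M. \<delta> < (\<Sum>j<n. (?g j \<omega>)\<^sup>2 * (q (Suc j) - q j))}
      \<subseteq> {\<omega>\<in>space M. ennreal \<delta> < (\<integral>\<^sup>+s. ennreal ((G s \<omega>)\<^sup>2) \<partial>lborel)}"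
    proof safe
      fix \<omega> assume "\<delta> < (\<Sum>j<n. (?g j \<omega>)\<^sup>2 * (q (Suc j) - q j))"
      then have "ennreal \<delta> < ennreal (\<Sum>j<n. (?g j \<omega>)\<^sup>2 * (q (Suc j) - q j))"
        using pos by (simp add: ennreal_less_iff)
      also note V
      finally show "ennreal \<delta> < (\<integral>\<^sup>+s. ennreal ((G s \<omega>)\<^sup>2) \<partial>lborel)" .
    qed
    show "{\<omega>\<in>space M. ennreal \<delta> < (\<integral>\<^sup>+s. ennreal ((G s \<omega>)\<^sup>2) \<partial>lborel)} \<in> events"
      by measurable
  qed
  finally show ?thesis by simp
qed

text \<open>Increments of a simple integral between two times, multiplied by a coefficient known at
  the earlier one, are again elementary. Such terms arise when a stochastic integral is weighted
  along a grid.\<close>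

lemma simple_elementary:
  assumes S: "simple_process_data M F (n, p, \<xi>)" and r: "0 \<le> r" "r \<le> r'"
    and \<eta>: "\<eta> \<in> borel_measurable (F r)" "\<exists>c. \<forall>\<omega>\<in>space M. \<bar>\<eta> \<omega>\<bar> \<le> c"
  shows "elementary (\<lambda>s \<omega>. \<eta> \<omega> * simple_process (n, p, \<xi>) s \<omega> * indicator {r<..r'} s)
    (\<lambda>\<omega>. \<eta> \<omega> * (simple_integral B (n, p, \<xi>) r' \<omega> - simple_integral B (n, p, \<xi>) r \<omega>))"
proof -
  have p0: "0 \<le> p i" if "i \<le> n" for i
    using that
  proof (induction i)
    case (Suc i)
    then have "0 \<le> p i" "p i \<le> p (Suc i)" using S by auto
    then show ?case by simp
  qed (use S in simp)
  obtain c where c: "\<And>\<omega>. \<omega> \<in> space M \<Longrightarrow> \<bar>\<eta> \<omega>\<bar> \<le> c" using \<eta> by blast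
  let ?G = "\<lambda>i s \<omega>. \<eta> \<omega> * \<xi> i \<omega> * (indicator {p i<..p (Suc i)} s * indicator {r<..r'} s)"
  let ?I = "\<lambda>i \<omega>. \<eta> \<omega> * \<xi> i \<omega> * ((B (min r' (p (Suc i))) \<omega> - B (min r' (p i)) \<omega>)
      - (B (min r (p (Suc i))) \<omega> - B (min r (p i)) \<omega>))"
  have "elementary (?G i) (?I i)" if i: "i < n" for i
  \<comment> \<open>The i-th interval is clipped to lie between r and r'. When it begins at r' or
    later, the clipped end points would be in the wrong order, but both sides are then 0.\<close>
  proof (cases "p i < r'")
    case True
    let ?a = "max r (p i)" and ?b = "max r (min r' (p (Suc i)))"
    have pp: "p i \<le> p (Suc i)" and \<xi>F: "\<xi> i \<in> borel_measurable (F (p i))" using S i by auto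
    obtain d where d: "\<And>\<omega>. \<omega> \<in> space M \<Longrightarrow> \<bar>\<xi> i \<omega>\<bar> \<le> d" using S i by force
    have "elementary (\<lambda>s \<omega>. (\<eta> \<omega> * \<xi> i \<omega>) * indicator {?a<..?b} s) (\<lambda>\<omega>. (\<eta> \<omega> * \<xi> i \<omega>) * (B ?b \<omega> - B ?a \<omega>))"
    proof (rule elementary_term)
      show "(\<lambda>\<omega>. \<eta> \<omega> * \<xi> i \<omega>) \<in> borel_measurable (F ?a)"
        by (intro borel_measurable_times measurable_F_mono[OF \<eta>(1)] measurable_F_mono[OF \<xi>F]) auto
      have "\<bar>\<eta> \<omega> * \<xi> i \<omega>\<bar> \<le> c * d" if "\<omega> \<in> space M" for \<omega>
        using c[OF that] d[OF that] unfolding abs_mult by (intro mult_mono) auto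
      then show "\<exists>c. \<forall>\<omega>\<in>space M. \<bar>\<eta> \<omega> * \<xi> i \<omega>\<bar> \<le> c" by blast
    qed (use r pp True in auto)
    moreover have "indicator {?a<..?b} s = (indicator {p i<..p (Suc i)} s * indicator {r<..r'} s :: real)" for s
      by (auto simp: indicator_def)
    moreover have "B ?b \<omega> - B ?a \<omega> = (B (min r' (p (Suc i))) \<omega> - B (min r' (p i)) \<omega>)
      - (B (min r (p (Suc i))) \<omega> - B (min r (p i)) \<omega>)" for \<omega>
      using True pp r by (auto simp: min_def max_def)
    ultimately show ?thesis by simp
  next
    case False
    have pp: "p i \<le> p (Suc i)" using S i by auto
    have "indicator {p i<..p (Suc i)} s * indicator {r<..r'} s = (0::real)" for s
      using False by (auto simp: indicator_def)
    moreover have "(B (min r' (p (Suc i))) \<omega> - B (min r' (p i)) \<omega>)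
      - (B (min r (p (Suc i))) \<omega> - B (min r (p i)) \<omega>) = 0" for \<omega>
      using False pp r by (simp add: min_def)
    ultimately show ?thesis using elementary_zero by (simp only: mult_zero_right)
  qed
  then have "elementary (\<lambda>s \<omega>. \<Sum>i<n. ?G i s \<omega>) (\<lambda>\<omega>. \<Sum>i<n. ?I i \<omega>)" by (intro elementary_sum) auto
  moreover have "(\<Sum>i<n. ?G i s \<omega>) = \<eta> \<omega> * simple_process (n, p, \<xi>) s \<omega> * indicator {r<..r'} s" for s \<omega>
    by (simp only: simple_process.simps sum_distrib_left sum_distrib_right mult.assoc)
  moreover have "(\<Sum>i<n. ?I i \<omega>) = \<eta> \<omega> * (simple_integral B (n, p, \<xi>) r' \<omega> - simple_integral B (n, p, \<xi>) r \<omega>)" for \<omega>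
    by (simp add: sum_distrib_left sum_subtractf[symmetric] algebra_simps)
  ultimately show ?thesis by simp
qed

end

lemma tendsto_zero_dominated:
  fixes f g :: "nat \<Rightarrow> real"
  assumes "g \<longlonglongrightarrow> 0" "\<And>m. 0 \<le> f m" "\<And>m. f m \<le> g m"
  shows "f \<longlonglongrightarrow> 0"
  by (rule tendsto_sandwich[of "\<lambda>_. 0" f sequentially g]) (use assms in auto)

lemma nn_integral_affine:
  assumes "f \<in> borel_measurable N" "g \<in> borel_measurable N"
  shows "(\<integral>\<^sup>+s. 2 * (c * f s + g s) \<partial>N) = 2 * (c * (\<integral>\<^sup>+s. f s \<partial>N) + (\<integral>\<^sup>+s. g s \<partial>N))"
  using assms by (simp add: nn_integral_cmult nn_integral_add)

text \<open>Prepares the use of (a + b)^2 \<le> 2 (a^2 + b^2): if the energy of a sum exceeds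
  \<delta>, one of the two energies exceeds a quarter of it.\<close>

lemma ennreal_less_double_sum:
  assumes "0 < \<delta>" "ennreal \<delta> < W" "W \<le> 2 * (V1 + V2)"
  shows "ennreal (\<delta> / 4) < V1 \<or> ennreal (\<delta> / 4) < V2"
proof (rule ccontr)
  assume "\<not> ?thesis"
  then have "W \<le> 2 * (ennreal (\<delta> / 4) + ennreal (\<delta> / 4))"
    using assms(3) by (meson add_mono mult_left_mono order_trans linorder_not_less zero_le)
  also have "\<dots> = ennreal \<delta>"
    using assms(1) by (subst ennreal_plus[symmetric]) (simp_all flip: ennreal_mult ennreal_numeral)
  finally show False using assms(2) by simp
qed

section \<open>Convergence in probability and the Ito integral along a grid\<close>

context brownian
begin

lemma sum_indicator_grid:
  fixes q :: "nat \<Rightarrow> real"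
  assumes "\<And>j. j < n \<Longrightarrow> q j < q (Suc j)"
  shows "(\<Sum>j<n. indicator {q j<..q (Suc j)} s) = (indicator {q 0<..q n} s :: real)"
  using assms
proof (induction n)
  case (Suc n)
  have "q 0 \<le> q n" by (rule grid_mono[where n=n]) (use Suc.prems in auto)
  then show ?case using Suc.IH Suc.prems less_imp_le[OF Suc.prems[of n]]
    by (auto simp: indicator_def split: if_splits)
qed simp

lemma nn_integral_time_measurable:
  fixes g :: "real \<times> 'a \<Rightarrow> real"
  assumes [measurable]: "g \<in> borel_measurable (borel \<Otimes>\<^sub>M M)"
  shows "(\<lambda>\<omega>. \<integral>\<^sup>+s. ennreal (g (s, \<omega>)) \<partial>lborel) \<in> borel_measurable M"
proof (rule lborel.borel_measurable_nn_integral)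
  have "(\<lambda>p. (snd p, fst p)) \<in> measurable (M \<Otimes>\<^sub>M lborel) (borel \<Otimes>\<^sub>M M)" by measurable
  from measurable_compose[OF this assms]
  show "(\<lambda>(\<omega>, s). ennreal (g (s, \<omega>))) \<in> borel_measurable (M \<Otimes>\<^sub>M lborel)" by (simp add: split_beta')
qed

text \<open>Measurability is part of the notion because \<open>prob\<close> assigns 0 to a
  nonmeasurable set, which would make the convergence empty of content.\<close>

definition null_in_prob :: "(nat \<Rightarrow> 'a \<Rightarrow> real) \<Rightarrow> bool" where
  "null_in_prob Z \<longleftrightarrow> (\<forall>m. Z m \<in> borel_measurable M) \<and>
     (\<forall>\<epsilon>>0. (\<lambda>m. prob {\<omega>\<in>space M. \<epsilon> < \<bar>Z m \<omega>\<bar>}) \<longlonglongrightarrow> 0)"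

lemma null_in_probD: "null_in_prob Z \<Longrightarrow> 0 < \<epsilon> \<Longrightarrow> (\<lambda>m. prob {\<omega>\<in>space M. \<epsilon> < \<bar>Z m \<omega>\<bar>}) \<longlonglongrightarrow> 0"
  by (simp add: null_in_prob_def)

lemma null_in_prob_add:
  assumes "null_in_prob Z" "null_in_prob W"
  shows "null_in_prob (\<lambda>m \<omega>. Z m \<omega> + W m \<omega>)"
  unfolding null_in_prob_def
proof (intro conjI allI impI)
  have [measurable]: "Z m \<in> borel_measurable M" "W m \<in> borel_measurable M" for m
    using assms by (auto simp: null_in_prob_def)
  show "(\<lambda>\<omega>. Z m \<omega> + W m \<omega>) \<in> borel_measurable M" for m by measurable
  fix \<epsilon> :: real assume \<epsilon>: "\<epsilon> > 0"
  show "(\<lambda>m. prob {\<omega>\<in>space M. \<epsilon> < \<bar>Z m \<omega> + W m \<omega>\<bar>}) \<longlonglongrightarrow> 0"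
  proof (rule tendsto_zero_dominated)
    show "(\<lambda>m. prob {\<omega>\<in>space M. \<epsilon>/2 < \<bar>Z m \<omega>\<bar>} + prob {\<omega>\<in>space M. \<epsilon>/2 < \<bar>W m \<omega>\<bar>}) \<longlonglongrightarrow> 0"
      using \<epsilon> by (intro tendsto_add_zero null_in_probD[OF assms(1)] null_in_probD[OF assms(2)]) auto
    show "prob {\<omega>\<in>space M. \<epsilon> < \<bar>Z m \<omega> + W m \<omega>\<bar>}
        \<le> prob {\<omega>\<in>space M. \<epsilon>/2 < \<bar>Z m \<omega>\<bar>} + prob {\<omega>\<in>space M. \<epsilon>/2 < \<bar>W m \<omega>\<bar>}" for m
    proof -
      have "prob {\<omega>\<in>space M. \<epsilon> < \<bar>Z m \<omega> + W m \<omega>\<bar>} \<le> prob ({\<omega>\<in>space M. \<epsilon>/2 < \<bar>Z m \<omega>\<bar>} \<union> {\<omega>\<in>space M. \<epsilon>/2 < \<bar>W m \<omega>\<bar>})"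
        by (rule finite_measure_mono) auto
      also have "\<dots> \<le> prob {\<omega>\<in>space M. \<epsilon>/2 < \<bar>Z m \<omega>\<bar>} + prob {\<omega>\<in>space M. \<epsilon>/2 < \<bar>W m \<omega>\<bar>}"
        by (rule measure_Un_le) measurable
      finally show "prob {\<omega>\<in>space M. \<epsilon> < \<bar>Z m \<omega> + W m \<omega>\<bar>}
        \<le> prob {\<omega>\<in>space M. \<epsilon>/2 < \<bar>Z m \<omega>\<bar>} + prob {\<omega>\<in>space M. \<epsilon>/2 < \<bar>W m \<omega>\<bar>}" .
    qed
  qed simp
qed

lemma null_in_prob_mult_bounded:
  assumes "null_in_prob Z" and g[measurable]: "g \<in> borel_measurable M" and c: "\<And>\<omega>. \<omega> \<in> space M \<Longrightarrow> \<bar>g \<omega>\<bar> \<le> c"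
  shows "null_in_prob (\<lambda>m \<omega>. g \<omega> * Z m \<omega>)"
  unfolding null_in_prob_def
proof (intro conjI allI impI)
  have [measurable]: "Z m \<in> borel_measurable M" for m
    using assms by (auto simp: null_in_prob_def)
  show "(\<lambda>\<omega>. g \<omega> * Z m \<omega>) \<in> borel_measurable M" for m by measurable
  fix \<epsilon> :: real assume \<epsilon>: "\<epsilon> > 0"
  let ?e = "\<epsilon> / (\<bar>c\<bar> + 1)"
  show "(\<lambda>m. prob {\<omega>\<in>space M. \<epsilon> < \<bar>g \<omega> * Z m \<omega>\<bar>}) \<longlonglongrightarrow> 0"
  proof (rule tendsto_zero_dominated)
    have "?e > 0" using \<epsilon> by (simp add: add_nonneg_pos)
    then show "(\<lambda>m. prob {\<omega>\<in>space M. ?e < \<bar>Z m \<omega>\<bar>}) \<longlonglongrightarrow> 0"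
      using assms by (simp add: null_in_prob_def)
    show "prob {\<omega>\<in>space M. \<epsilon> < \<bar>g \<omega> * Z m \<omega>\<bar>} \<le> prob {\<omega>\<in>space M. ?e < \<bar>Z m \<omega>\<bar>}" for m
    proof (rule finite_measure_mono)
      show "{\<omega>\<in>space M. \<epsilon> < \<bar>g \<omega> * Z m \<omega>\<bar>} \<subseteq> {\<omega>\<in>space M. ?e < \<bar>Z m \<omega>\<bar>}"
      proof safe
        fix \<omega> assume w: "\<omega> \<in> space M" "\<epsilon> < \<bar>g \<omega> * Z m \<omega>\<bar>"
        have "\<bar>g \<omega> * Z m \<omega>\<bar> \<le> (\<bar>c\<bar> + 1) * \<bar>Z m \<omega>\<bar>"
          using c[OF w(1)] unfolding abs_mult by (intro mult_right_mono) auto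
        then have "\<epsilon> < \<bar>Z m \<omega>\<bar> * (\<bar>c\<bar> + 1)" using w by (simp add: mult.commute)
        then show "?e < \<bar>Z m \<omega>\<bar>" by (subst pos_divide_less_eq) auto
      qed
    qed measurable
  qed simp
qed

lemma null_in_prob_sum:
  assumes "finite A" "\<And>i. i \<in> A \<Longrightarrow> null_in_prob (Z i)"
  shows "null_in_prob (\<lambda>m \<omega>. \<Sum>i\<in>A. Z i m \<omega>)"
  using assms
proof (induction A)
  case empty
  then show ?case by (simp add: null_in_prob_def)
next
  case (insert x A)
  then show ?case using null_in_prob_add[of "Z x" "\<lambda>m \<omega>. \<Sum>i\<in>A. Z i m \<omega>"] by simp
qed

lemma null_in_prob_uminus: "null_in_prob Z \<Longrightarrow> null_in_prob (\<lambda>m \<omega>. - Z m \<omega>)"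
  by (simp add: null_in_prob_def)

text \<open>Lenglart's inequality with \<delta> = e \<epsilon>^2 / 2, which makes its deterministic
  term equal to e/2.\<close>

lemma null_in_prob_elementary:
  assumes el: "\<And>m. elementary (G m) (I m)"
    and lim: "\<And>\<delta>. 0 < \<delta> \<Longrightarrow> (\<lambda>m. prob {\<omega>\<in>space M. ennreal \<delta> < (\<integral>\<^sup>+s. ennreal ((G m s \<omega>)\<^sup>2) \<partial>lborel)}) \<longlonglongrightarrow> 0"
  shows "null_in_prob I"
  unfolding null_in_prob_def
proof (intro conjI allI impI)
  show "I m \<in> borel_measurable M" for m by (rule elementary_measurable(2)[OF el])
  fix \<epsilon> :: real assume \<epsilon>: "\<epsilon> > 0"
  show "(\<lambda>m. prob {\<omega>\<in>space M. \<epsilon> < \<bar>I m \<omega>\<bar>}) \<longlonglongrightarrow> 0"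
  proof (rule tendstoI)
    fix e :: real assume e: "e > 0"
    define \<delta> where "\<delta> = e * \<epsilon>\<^sup>2 / 2"
    have \<delta>: "\<delta> > 0" using e \<epsilon> by (simp add: \<delta>_def)
    have "\<forall>\<^sub>F m in sequentially. prob {\<omega>\<in>space M. ennreal \<delta> < (\<integral>\<^sup>+s. ennreal ((G m s \<omega>)\<^sup>2) \<partial>lborel)} < e / 2"
      using order_tendstoD(2)[OF lim[OF \<delta>], of "e/2"] e by simp
    then show "\<forall>\<^sub>F m in sequentially. dist (prob {\<omega>\<in>space M. \<epsilon> < \<bar>I m \<omega>\<bar>}) 0 < e"
    proof eventually_elim
      case (elim m)
      have "\<delta> / \<epsilon>\<^sup>2 = e / 2" using \<epsilon> by (simp add: \<delta>_def)
      then have "prob {\<omega>\<in>space M. \<epsilon> < \<bar>I m \<omega>\<bar>} < e"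
        using lenglart_elementary[OF el[of m] \<delta> \<epsilon>] elim by linarith
      then show ?case by simp
    qed
  qed
qed

text \<open>Extension by zero turns progressive measurability up to \<open>r\<close> into joint
  measurability on the whole line; clamping time to [0, r] provides the map into the restricted
  space.\<close>

lemma measurable_progressive:
  fixes H :: "real \<Rightarrow> 'a \<Rightarrow> real"
  assumes H: "(\<lambda>(s, \<omega>). H s \<omega>) \<in> borel_measurable (restrict_space borel {0..r} \<Otimes>\<^sub>M F r)" and r: "0 \<le> r"
  shows "(\<lambda>(s, \<omega>). indicator {0..r} s * H s \<omega>) \<in> borel_measurable (borel \<Otimes>\<^sub>M M)"
proof -
  let ?R = "restrict_space borel {0..r} :: real measure"
  have id: "(\<lambda>\<omega>. \<omega>) \<in> measurable M (F r)" by (rule measurable_F[of _ r]) simp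
  have c: "(\<lambda>s. max 0 (min r s)) \<in> measurable borel ?R"
    using r by (intro measurable_restrict_space2) auto
  have "(\<lambda>p. (max 0 (min r (fst p)), snd p)) \<in> measurable (borel \<Otimes>\<^sub>M M) (?R \<Otimes>\<^sub>M F r)"
    by (intro measurable_Pair measurable_compose[OF measurable_fst c] measurable_compose[OF measurable_snd id])
  from measurable_compose[OF this H]
  have [measurable]: "(\<lambda>p. H (max 0 (min r (fst p))) (snd p)) \<in> borel_measurable (borel \<Otimes>\<^sub>M M)"
    by (simp add: split_beta')
  have "(\<lambda>(s, \<omega>). indicator {0..r} s * H s \<omega>) = (\<lambda>p. indicator {0..r} (fst p) * H (max 0 (min r (fst p))) (snd p))"
    by (auto simp: indicator_def fun_eq_iff)
  then show ?thesis by simp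
qed

lemma simple_process_measurable:
  assumes "simple_process_data M F S"
  shows "(\<lambda>(s, \<omega>). simple_process S s \<omega>) \<in> borel_measurable (borel \<Otimes>\<^sub>M M)"
proof (cases S)
  case (fields n p \<xi>)
  have [measurable]: "\<xi> i \<in> borel_measurable M" if "i < n" for i
    by (rule measurable_F[of _ "p i"]) (use assms that fields in auto)
  have "(\<lambda>x. \<Sum>i<n. \<xi> i (snd x) * indicator {p i<..p (Suc i)} (fst x)) \<in> borel_measurable (borel \<Otimes>\<^sub>M M)"
    by (intro borel_measurable_sum borel_measurable_times) (auto intro: measurable_compose[OF measurable_snd])
  then show ?thesis by (simp add: fields split_beta')
qed

lemma simple_integral_0:
  assumes "simple_process_data M F S"
  shows "simple_integral B S 0 \<omega> = 0"
proof (cases S)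
  case (fields n p \<xi>)
  have p0: "0 \<le> p i" if "i \<le> n" for i
    using that
  proof (induction i)
    case (Suc i)
    then have "0 \<le> p i" "p i \<le> p (Suc i)" using assms fields by auto
    then show ?case by simp
  qed (use assms fields in simp)
  then show ?thesis by (simp add: fields min_def Suc_leI)
qed

text \<open>The condition on the integrands alone, separated from the convergence of the integrals
  so that one sequence can be examined at several times.\<close>

definition approximates :: "(nat \<Rightarrow> 'a simple_data) \<Rightarrow> (real \<Rightarrow> 'a \<Rightarrow> real) \<Rightarrow> real \<Rightarrow> bool" where
  "approximates S H t \<longleftrightarrow> (\<forall>m. simple_process_data M F (S m)) \<and>
    (\<forall>\<epsilon>>0. (\<lambda>m. prob {\<omega>\<in>space M.
      ennreal \<epsilon> < (\<integral>\<^sup>+s\<in>{0..t}. ennreal ((simple_process (S m) s \<omega> - H s \<omega>)\<^sup>2) \<partial>lborel)}) \<longlonglongrightarrow> 0)"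

lemma has_ito_integralE:
  assumes "has_ito_integral M F B H t Y" "0 \<le> t"
  obtains S where "approximates S H t" "null_in_prob (\<lambda>m \<omega>. simple_integral B (S m) t \<omega> - Y \<omega>)"
proof -
  from assms obtain S where S: "\<forall>m. simple_process_data M F (S m)"
    "\<forall>\<epsilon>>0. (\<lambda>m. prob {\<omega>\<in>space M.
      ennreal \<epsilon> < (\<integral>\<^sup>+s\<in>{0..t}. ennreal ((simple_process (S m) s \<omega> - H s \<omega>)\<^sup>2) \<partial>lborel)}) \<longlonglongrightarrow> 0"
    "\<forall>\<epsilon>>0. (\<lambda>m. prob {\<omega>\<in>space M. \<epsilon> < \<bar>simple_integral B (S m) t \<omega> - Y \<omega>\<bar>}) \<longlonglongrightarrow> 0"
    and Y[measurable]: "Y \<in> borel_measurable M"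
    unfolding has_ito_integral_def by blast
  have "(\<lambda>\<omega>. simple_integral B (S m) t \<omega> - Y \<omega>) \<in> borel_measurable M" for m
  proof (cases "S m")
    case (fields n p \<xi>)
    have S': "simple_process_data M F (n, p, \<xi>)" using S(1) fields by metis
    have "elementary (\<lambda>s \<omega>. 1 * simple_process (n, p, \<xi>) s \<omega> * indicator {0<..t} s)
      (\<lambda>\<omega>. 1 * (simple_integral B (n, p, \<xi>) t \<omega> - simple_integral B (n, p, \<xi>) 0 \<omega>))"
      by (rule simple_elementary[OF S']) (use assms(2) in auto)
    from elementary_measurable(2)[OF this] have "simple_integral B (n, p, \<xi>) t \<in> borel_measurable M"
      by (simp only: simple_integral_0[OF S'] mult_1 diff_zero)
    then show ?thesis unfolding fields by measurable
  qed
  then show thesis using S that[of S] unfolding approximates_def null_in_prob_def by blast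
qed

text \<open>The Ito integrals at different times are given with unrelated approximating sequences. A
  sequence that is good up to time t and one that is good up to r differ on [0, r] by little energy,
  so by Lenglart their integrals at r have the same limit. One sequence therefore serves a whole
  grid.\<close>

lemma simple_integral_earlier_time:
  assumes S: "approximates S H t" and r: "0 \<le> r" "r \<le> t"
    and Ht: "has_ito_integral M F B H t Yt" and Hr: "has_ito_integral M F B H r Y"
  shows "null_in_prob (\<lambda>m \<omega>. simple_integral B (S m) r \<omega> - Y \<omega>)"
proof -
  obtain S' where S': "approximates S' H r" "null_in_prob (\<lambda>m \<omega>. simple_integral B (S' m) r \<omega> - Y \<omega>)"
    by (rule has_ito_integralE[OF Hr r(1)])
  \<comment> \<open>The integrand extended by zero, which agrees with \<open>H\<close> on the
    relevant interval and is jointly measurable, so that the energies are random variables.\<close>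
  define K where "K s \<omega> = indicator {0..t} s * H s \<omega>" for s \<omega>
  have [measurable]: "(\<lambda>(s, \<omega>). K s \<omega>) \<in> borel_measurable (borel \<Otimes>\<^sub>M M)"
    unfolding K_def using Ht r by (intro measurable_progressive) (auto simp: has_ito_integral_def)
  have data: "simple_process_data M F (S m)" "simple_process_data M F (S' m)" for m
    using S S' by (auto simp: approximates_def)
  note sm[measurable] = simple_process_measurable[OF data(1)] simple_process_measurable[OF data(2)]
  let ?G = "\<lambda>m s \<omega>. 1 * simple_process (S m) s \<omega> * indicator {0<..r} s
    - 1 * simple_process (S' m) s \<omega> * indicator {0<..r} s"
  let ?I = "\<lambda>m \<omega>. 1 * (simple_integral B (S m) r \<omega> - simple_integral B (S m) 0 \<omega>)
    - 1 * (simple_integral B (S' m) r \<omega> - simple_integral B (S' m) 0 \<omega>)"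
  have "elementary (?G m) (?I m)" for m
  proof -
    have "elementary (\<lambda>s \<omega>. 1 * simple_process R s \<omega> * indicator {0<..r} s)
      (\<lambda>\<omega>. 1 * (simple_integral B R r \<omega> - simple_integral B R 0 \<omega>))" if "simple_process_data M F R" for R
    proof (cases R)
      case (fields n p \<xi>)
      show ?thesis unfolding fields by (rule simple_elementary) (use that fields r in auto)
    qed
    from elementary_diff[OF this[OF data(1)] this[OF data(2)]] show ?thesis .
  qed
  then have "null_in_prob ?I"
  proof (rule null_in_prob_elementary)
    fix \<delta> :: real assume \<delta>: "\<delta> > 0"
    let ?V = "\<lambda>m \<omega>. (\<integral>\<^sup>+s\<in>{0..t}. ennreal ((simple_process (S m) s \<omega> - H s \<omega>)\<^sup>2) \<partial>lborel)"
    let ?V' = "\<lambda>m \<omega>. (\<integral>\<^sup>+s\<in>{0..r}. ennreal ((simple_process (S' m) s \<omega> - H s \<omega>)\<^sup>2) \<partial>lborel)"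
    have VK: "?V m \<omega> = (\<integral>\<^sup>+s. ennreal ((simple_process (S m) s \<omega> - K s \<omega>)\<^sup>2) * indicator {0..t} s \<partial>lborel)" for m \<omega>
      by (intro nn_integral_cong) (auto simp: K_def indicator_def)
    have V'K: "?V' m \<omega> = (\<integral>\<^sup>+s. ennreal ((simple_process (S' m) s \<omega> - K s \<omega>)\<^sup>2) * indicator {0..r} s \<partial>lborel)" for m \<omega>
      using r by (intro nn_integral_cong) (auto simp: K_def indicator_def)
    have Vm[measurable]: "?V m \<in> borel_measurable M" "?V' m \<in> borel_measurable M" for m
      unfolding VK V'K by measurable
    have W: "(\<integral>\<^sup>+s. ennreal ((?G m s \<omega>)\<^sup>2) \<partial>lborel) \<le> 2 * (?V m \<omega> + ?V' m \<omega>)" if w: "\<omega> \<in> space M" for m \<omega>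
    proof -
      have [measurable]: "(\<lambda>s. simple_process (S m) s \<omega>) \<in> borel_measurable borel"
        "(\<lambda>s. simple_process (S' m) s \<omega>) \<in> borel_measurable borel" "(\<lambda>s. K s \<omega>) \<in> borel_measurable borel"
        using w by measurable
      have "(\<integral>\<^sup>+s. ennreal ((?G m s \<omega>)\<^sup>2) \<partial>lborel)
        \<le> (\<integral>\<^sup>+s. 2 * (ennreal ((simple_process (S m) s \<omega> - K s \<omega>)\<^sup>2) * indicator {0..t} s
          + ennreal ((simple_process (S' m) s \<omega> - K s \<omega>)\<^sup>2) * indicator {0..r} s) \<partial>lborel)"
      proof (rule nn_integral_mono)
        fix s
        show "ennreal ((?G m s \<omega>)\<^sup>2) \<le> 2 * (ennreal ((simple_process (S m) s \<omega> - K s \<omega>)\<^sup>2) * indicator {0..t} s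
          + ennreal ((simple_process (S' m) s \<omega> - K s \<omega>)\<^sup>2) * indicator {0..r} s)"
        proof (cases "s \<in> {0<..r}")
          case True
          let ?x = "simple_process (S m) s \<omega> - K s \<omega>" and ?y = "simple_process (S' m) s \<omega> - K s \<omega>"
          have "(?x - ?y)\<^sup>2 \<le> 2 * (?x\<^sup>2 + ?y\<^sup>2)"
            using sum_squares_bound[of ?x "- ?y"] by (simp add: power2_eq_square algebra_simps)
          then have "ennreal ((?x - ?y)\<^sup>2) \<le> ennreal (2 * (?x\<^sup>2 + ?y\<^sup>2))" by (rule ennreal_leI)
          also have "\<dots> = 2 * (ennreal (?x\<^sup>2) + ennreal (?y\<^sup>2))" by (simp add: ennreal_mult)
          finally show ?thesis using True r by simp
        next
          case False
          then show ?thesis by (simp add: indicator_def)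
        qed
      qed
      also have "\<dots> = 2 * (?V m \<omega> + ?V' m \<omega>)"
        unfolding VK V'K by (simp add: nn_integral_cmult nn_integral_add)
      finally show ?thesis .
    qed
    show "(\<lambda>m. prob {\<omega>\<in>space M. ennreal \<delta> < (\<integral>\<^sup>+s. ennreal ((?G m s \<omega>)\<^sup>2) \<partial>lborel)}) \<longlonglongrightarrow> 0"
    proof (rule tendsto_zero_dominated)
      show "(\<lambda>m. prob {\<omega>\<in>space M. ennreal (\<delta>/4) < ?V m \<omega>} + prob {\<omega>\<in>space M. ennreal (\<delta>/4) < ?V' m \<omega>}) \<longlonglongrightarrow> 0"
        using S S' \<delta> by (intro tendsto_add_zero) (auto simp: approximates_def)
      show "prob {\<omega>\<in>space M. ennreal \<delta> < (\<integral>\<^sup>+s. ennreal ((?G m s \<omega>)\<^sup>2) \<partial>lborel)}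
        \<le> prob {\<omega>\<in>space M. ennreal (\<delta>/4) < ?V m \<omega>} + prob {\<omega>\<in>space M. ennreal (\<delta>/4) < ?V' m \<omega>}" for m
    proof -
        have "prob {\<omega>\<in>space M. ennreal \<delta> < (\<integral>\<^sup>+s. ennreal ((?G m s \<omega>)\<^sup>2) \<partial>lborel)}
          \<le> prob ({\<omega>\<in>space M. ennreal (\<delta>/4) < ?V m \<omega>} \<union> {\<omega>\<in>space M. ennreal (\<delta>/4) < ?V' m \<omega>})"
          using ennreal_less_double_sum[OF \<delta> _ W] by (intro finite_measure_mono) auto
        also have "\<dots> \<le> prob {\<omega>\<in>space M. ennreal (\<delta>/4) < ?V m \<omega>} + prob {\<omega>\<in>space M. ennreal (\<delta>/4) < ?V' m \<omega>}"
          by (rule measure_Un_le) measurable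
        finally show "prob {\<omega>\<in>space M. ennreal \<delta> < (\<integral>\<^sup>+s. ennreal ((?G m s \<omega>)\<^sup>2) \<partial>lborel)}
          \<le> prob {\<omega>\<in>space M. ennreal (\<delta>/4) < ?V m \<omega>} + prob {\<omega>\<in>space M. ennreal (\<delta>/4) < ?V' m \<omega>}" .
      qed
    qed simp
  qed
  from null_in_prob_add[OF this S'(2)] show ?thesis
    by (simp add: simple_integral_0[OF data(1)] simple_integral_0[OF data(2)])
qed

text \<open>With one approximating sequence for all grid times, the error is up to a null sequence
  an elementary integral. Its energy is at most twice the approximation energy, which vanishes as m
  grows, times L^2 plus the step energy; Lenglart is applied before m tends to infinity. Only the
  products of \<eta> and \<open>h\<close> are assumed bounded, which is what stopping provides when
  \<open>h\<close> is not.\<close>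

lemma ito_riemann_error:
  fixes H :: "real \<Rightarrow> 'a \<Rightarrow> real"
  assumes q: "0 \<le> q 0" "\<And>j. j < n \<Longrightarrow> q j < q (Suc j)"
    and H: "\<And>j. j \<le> n \<Longrightarrow> has_ito_integral M F B H (q j) (Y j)"
    and \<eta>: "\<And>j. j < n \<Longrightarrow> \<eta> j \<in> borel_measurable (F (q j))" "\<And>j \<omega>. j < n \<Longrightarrow> \<omega> \<in> space M \<Longrightarrow> \<bar>\<eta> j \<omega>\<bar> \<le> L"
    and h: "\<And>j. j < n \<Longrightarrow> h j \<in> borel_measurable (F (q j))" "\<And>j. j < n \<Longrightarrow> \<exists>c. \<forall>\<omega>\<in>space M. \<bar>\<eta> j \<omega> * h j \<omega>\<bar> \<le> c"
    and L: "0 < L" and pos: "0 < \<delta>" "0 < \<epsilon>"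
  shows "prob {\<omega>\<in>space M. 2 * \<epsilon> < \<bar>\<Sum>j<n. \<eta> j \<omega> * (Y (Suc j) \<omega> - Y j \<omega> - h j \<omega> * (B (q (Suc j)) \<omega> - B (q j) \<omega>))\<bar>}
    \<le> prob {\<omega>\<in>space M. ennreal (\<delta> / 4) <
        (\<integral>\<^sup>+s. ennreal ((\<Sum>j<n. \<eta> j \<omega> * (H s \<omega> - h j \<omega>) * indicator {q j<..q (Suc j)} s)\<^sup>2) \<partial>lborel)} + \<delta> / \<epsilon>\<^sup>2"
proof -
  have le: "q i \<le> q j" if "i \<le> j" "j \<le> n" for i j by (rule grid_mono[where n=n]) (use q that in auto)
  have q0: "0 \<le> q j" if "j \<le> n" for j using le[of 0 j] q that by simp
  obtain S where S: "approximates S H (q n)" "null_in_prob (\<lambda>m \<omega>. simple_integral B (S m) (q n) \<omega> - Y n \<omega>)"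
    by (rule has_ito_integralE[OF H[OF order_refl] q0[OF order_refl]])
  have data: "simple_process_data M F (S m)" for m using S by (auto simp: approximates_def)
  have SY: "null_in_prob (\<lambda>m \<omega>. simple_integral B (S m) (q j) \<omega> - Y j \<omega>)" if "j \<le> n" for j
    by (rule simple_integral_earlier_time[OF S(1) q0[OF that] _ H[OF order_refl] H[OF that]]) (use le that in auto)
  have Y[measurable]: "Y j \<in> borel_measurable M" if "j \<le> n" for j using H[OF that] by (simp add: has_ito_integral_def)
  have \<eta>M[measurable]: "\<eta> j \<in> borel_measurable M" if "j < n" for j by (rule measurable_F[OF \<eta>(1)[OF that]])
  have hM[measurable]: "h j \<in> borel_measurable M" if "j < n" for j by (rule measurable_F[OF h(1)[OF that]])
  have BM[measurable]: "B (q j) \<in> borel_measurable M" if "j \<le> n" for j by (rule B_measurable[OF q0[OF that]])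
  define K where "K s \<omega> = indicator {0..q n} s * H s \<omega>" for s \<omega>
  have [measurable]: "(\<lambda>(s, \<omega>). K s \<omega>) \<in> borel_measurable (borel \<Otimes>\<^sub>M M)"
    unfolding K_def using H[of n] q0 by (intro measurable_progressive) (auto simp: has_ito_integral_def)
  note sm[measurable] = simple_process_measurable[OF data]
  let ?ind = "\<lambda>j s. indicator {q j<..q (Suc j)} s :: real"
  let ?Z = "\<lambda>\<omega>. \<Sum>j<n. \<eta> j \<omega> * (Y (Suc j) \<omega> - Y j \<omega> - h j \<omega> * (B (q (Suc j)) \<omega> - B (q j) \<omega>))"
  let ?V = "\<lambda>\<omega>. \<integral>\<^sup>+s. ennreal ((\<Sum>j<n. \<eta> j \<omega> * (H s \<omega> - h j \<omega>) * ?ind j s)\<^sup>2) \<partial>lborel"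
  let ?U = "\<lambda>m \<omega>. (\<integral>\<^sup>+s\<in>{0..q n}. ennreal ((simple_process (S m) s \<omega> - H s \<omega>)\<^sup>2) \<partial>lborel)"
  let ?G = "\<lambda>m s \<omega>. \<Sum>j<n. (\<eta> j \<omega> * simple_process (S m) s \<omega> * ?ind j s - (\<eta> j \<omega> * h j \<omega>) * ?ind j s)"
  let ?I = "\<lambda>m \<omega>. \<Sum>j<n. (\<eta> j \<omega> * (simple_integral B (S m) (q (Suc j)) \<omega> - simple_integral B (S m) (q j) \<omega>)
      - (\<eta> j \<omega> * h j \<omega>) * (B (q (Suc j)) \<omega> - B (q j) \<omega>))"
  have el: "elementary (?G m) (?I m)" for m
  proof (intro elementary_sum elementary_diff finite_lessThan)
    fix j assume "j \<in> {..<n}"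
    then have j: "j < n" by simp
    have \<eta>b: "\<exists>c. \<forall>\<omega>\<in>space M. \<bar>\<eta> j \<omega>\<bar> \<le> c" if "j < n" for j using \<eta>(2)[OF that] by blast
    obtain k p \<xi> where fields: "S m = (k, p, \<xi>)" by (cases "S m") auto
    show "elementary (\<lambda>s \<omega>. \<eta> j \<omega> * simple_process (S m) s \<omega> * ?ind j s)
      (\<lambda>\<omega>. \<eta> j \<omega> * (simple_integral B (S m) (q (Suc j)) \<omega> - simple_integral B (S m) (q j) \<omega>))"
      unfolding fields by (rule simple_elementary) (use data[of m] fields j q0 q(2)[OF j] \<eta>(1) \<eta>b[OF j] in auto)
    show "elementary (\<lambda>s \<omega>. (\<eta> j \<omega> * h j \<omega>) * ?ind j s) (\<lambda>\<omega>. (\<eta> j \<omega> * h j \<omega>) * (B (q (Suc j)) \<omega> - B (q j) \<omega>))"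
      by (rule elementary_term) (use j q0 q(2)[OF j] \<eta>(1) h in \<open>auto intro: borel_measurable_times\<close>)
  qed
  have UK: "?U m \<omega> = (\<integral>\<^sup>+s. ennreal ((simple_process (S m) s \<omega> - K s \<omega>)\<^sup>2) * indicator {0..q n} s \<partial>lborel)" for m \<omega>
    by (intro nn_integral_cong) (auto simp: K_def indicator_def)
  have VK: "?V \<omega> = (\<integral>\<^sup>+s. ennreal ((\<Sum>j<n. \<eta> j \<omega> * (K s \<omega> - h j \<omega>) * ?ind j s)\<^sup>2) \<partial>lborel)" for \<omega>
  proof (intro nn_integral_cong arg_cong[where f="\<lambda>x. ennreal (x\<^sup>2)"] sum.cong refl)
    fix s j assume "j \<in> {..<n}"
    then show "\<eta> j \<omega> * (H s \<omega> - h j \<omega>) * ?ind j s = \<eta> j \<omega> * (K s \<omega> - h j \<omega>) * ?ind j s"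
      using q0[of j] le[of "Suc j" n] by (auto simp: K_def indicator_def)
  qed
  have Vm': "(\<lambda>p. (\<Sum>j<n. \<eta> j (snd p) * (K (fst p) (snd p) - h j (snd p)) * ?ind j (fst p))\<^sup>2) \<in> borel_measurable (borel \<Otimes>\<^sub>M M)"
    by (intro borel_measurable_power borel_measurable_sum borel_measurable_times borel_measurable_diff
      measurable_compose[OF measurable_snd \<eta>M] measurable_compose[OF measurable_snd hM]) auto
  have Vm[measurable]: "?V \<in> borel_measurable M"
    unfolding VK using nn_integral_time_measurable[OF Vm'] by (simp only: fst_conv snd_conv)
  have Um[measurable]: "?U m \<in> borel_measurable M" for m unfolding UK by measurable
  \<comment> \<open>The integrand splits into the approximation error, multiplied by the sum of
    \<eta> over disjoint intervals, and the step error. Disjointness bounds that multiplier by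
    \<open>L\<close> instead of n L.\<close>
  have W: "(\<integral>\<^sup>+s. ennreal ((?G m s \<omega>)\<^sup>2) \<partial>lborel) \<le> 2 * (ennreal (L\<^sup>2) * ?U m \<omega> + ?V \<omega>)" if w: "\<omega> \<in> space M" for m \<omega>
  proof -
    have [measurable]: "(\<lambda>s. simple_process (S m) s \<omega>) \<in> borel_measurable borel" "(\<lambda>s. K s \<omega>) \<in> borel_measurable borel"
      using w by measurable
    have "(\<integral>\<^sup>+s. ennreal ((?G m s \<omega>)\<^sup>2) \<partial>lborel)
      \<le> (\<integral>\<^sup>+s. 2 * (ennreal (L\<^sup>2) * (ennreal ((simple_process (S m) s \<omega> - K s \<omega>)\<^sup>2) * indicator {0..q n} s)
        + ennreal ((\<Sum>j<n. \<eta> j \<omega> * (K s \<omega> - h j \<omega>) * ?ind j s)\<^sup>2)) \<partial>lborel)"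
    proof (rule nn_integral_mono)
      fix s
      let ?d = "simple_process (S m) s \<omega> - K s \<omega>"
      let ?x = "(\<Sum>j<n. \<eta> j \<omega> * ?ind j s) * ?d" and ?y = "\<Sum>j<n. \<eta> j \<omega> * (K s \<omega> - h j \<omega>) * ?ind j s"
      have G: "?G m s \<omega> = ?x + ?y"
        unfolding sum_distrib_right sum.distrib[symmetric] by (rule sum.cong) (simp_all add: algebra_simps)
      have "\<bar>\<Sum>j<n. \<eta> j \<omega> * ?ind j s\<bar> \<le> (\<Sum>j<n. L * ?ind j s)"
        by (rule order_trans[OF sum_abs sum_mono]) (auto simp: abs_mult \<eta>(2)[OF _ w] indicator_def)
      also have "\<dots> = L * indicator {q 0<..q n} s" using sum_indicator_grid[of n q s] q by (simp add: sum_distrib_left[symmetric])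
      also have "\<dots> \<le> L * indicator {0..q n} s" using L q by (intro mult_left_mono) (auto simp: indicator_def)
      finally have c: "\<bar>\<Sum>j<n. \<eta> j \<omega> * ?ind j s\<bar> \<le> L * indicator {0..q n} s" .
      have "\<bar>?x\<bar> \<le> (L * indicator {0..q n} s) * \<bar>?d\<bar>" unfolding abs_mult by (rule mult_right_mono[OF c]) simp
      also have "\<dots> = \<bar>(L * indicator {0..q n} s) * ?d\<bar>" using L by (simp add: abs_mult)
      finally have "?x\<^sup>2 \<le> ((L * indicator {0..q n} s) * ?d)\<^sup>2" by (simp only: abs_le_square_iff)
      also have "\<dots> = L\<^sup>2 * ?d\<^sup>2 * indicator {0..q n} s" by (simp add: power2_eq_square indicator_def)
      finally have x: "?x\<^sup>2 \<le> L\<^sup>2 * ?d\<^sup>2 * indicator {0..q n} s" .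
      have "(?x + ?y)\<^sup>2 \<le> 2 * (?x\<^sup>2 + ?y\<^sup>2)"
        using sum_squares_bound[of ?x ?y] by (simp add: power2_eq_square algebra_simps)
      also have "\<dots> \<le> 2 * (L\<^sup>2 * ?d\<^sup>2 * indicator {0..q n} s + ?y\<^sup>2)" using x by simp
      finally have "ennreal ((?G m s \<omega>)\<^sup>2) \<le> ennreal (2 * (L\<^sup>2 * ?d\<^sup>2 * indicator {0..q n} s + ?y\<^sup>2))"
        unfolding G by (rule ennreal_leI)
      also have "\<dots> = 2 * (ennreal (L\<^sup>2) * (ennreal (?d\<^sup>2) * indicator {0..q n} s) + ennreal (?y\<^sup>2))"
        by (auto simp: ennreal_mult indicator_def)
      finally show "ennreal ((?G m s \<omega>)\<^sup>2) \<le> 2 * (ennreal (L\<^sup>2) * (ennreal (?d\<^sup>2) * indicator {0..q n} s) + ennreal (?y\<^sup>2))" .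
    qed
    also have "\<dots> = 2 * (ennreal (L\<^sup>2) * ?U m \<omega> + ?V \<omega>)"
      unfolding VK UK by (rule nn_integral_affine) measurable
    finally show ?thesis .
  qed
  have cip: "null_in_prob (\<lambda>m \<omega>. ?Z \<omega> - ?I m \<omega>)"
  proof -
    have "null_in_prob (\<lambda>m \<omega>. \<Sum>j<n. - (\<eta> j \<omega> * ((simple_integral B (S m) (q (Suc j)) \<omega> - Y (Suc j) \<omega>)
        + - (simple_integral B (S m) (q j) \<omega> - Y j \<omega>))))"
      by (intro null_in_prob_sum null_in_prob_uminus null_in_prob_mult_bounded null_in_prob_add SY)
        (use \<eta> in auto)
    moreover have "(\<Sum>j<n. - (\<eta> j \<omega> * ((simple_integral B (S m) (q (Suc j)) \<omega> - Y (Suc j) \<omega>)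
        + - (simple_integral B (S m) (q j) \<omega> - Y j \<omega>)))) = ?Z \<omega> - ?I m \<omega>" for m \<omega>
      unfolding sum_subtractf[symmetric] by (intro sum.cong refl) (simp add: algebra_simps)
    ultimately show ?thesis by simp
  qed
  have Zm[measurable]: "?Z \<in> borel_measurable M"
    by (intro borel_measurable_sum borel_measurable_times borel_measurable_diff) auto
  have Im[measurable]: "?I m \<in> borel_measurable M" for m by (rule elementary_measurable(2)[OF el])
  \<comment> \<open>The part of the bound that vanishes as m grows; the division by L^2 undoes the
    factor in front of the approximation energy.\<close>
  let ?a = "\<lambda>m. prob {\<omega>\<in>space M. \<epsilon> < \<bar>?Z \<omega> - ?I m \<omega>\<bar>} + prob {\<omega>\<in>space M. ennreal (\<delta> / 4 / L\<^sup>2) < ?U m \<omega>}"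
  have a: "?a \<longlonglongrightarrow> 0"
    using S(1) pos L cip by (intro tendsto_add_zero) (auto simp: null_in_prob_def approximates_def)
  have bound: "prob {\<omega>\<in>space M. 2 * \<epsilon> < \<bar>?Z \<omega>\<bar>} \<le> ?a m + (prob {\<omega>\<in>space M. ennreal (\<delta> / 4) < ?V \<omega>} + \<delta> / \<epsilon>\<^sup>2)" for m
  proof -
    have "prob {\<omega>\<in>space M. 2 * \<epsilon> < \<bar>?Z \<omega>\<bar>} \<le> prob ({\<omega>\<in>space M. \<epsilon> < \<bar>?Z \<omega> - ?I m \<omega>\<bar>} \<union> {\<omega>\<in>space M. \<epsilon> < \<bar>?I m \<omega>\<bar>})"
      by (rule finite_measure_mono) auto
    also have "\<dots> \<le> prob {\<omega>\<in>space M. \<epsilon> < \<bar>?Z \<omega> - ?I m \<omega>\<bar>} + prob {\<omega>\<in>space M. \<epsilon> < \<bar>?I m \<omega>\<bar>}"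
      by (rule measure_Un_le) measurable
    also have "prob {\<omega>\<in>space M. \<epsilon> < \<bar>?I m \<omega>\<bar>}
      \<le> prob {\<omega>\<in>space M. ennreal \<delta> < (\<integral>\<^sup>+s. ennreal ((?G m s \<omega>)\<^sup>2) \<partial>lborel)} + \<delta> / \<epsilon>\<^sup>2"
      by (rule lenglart_elementary[OF el pos])
    also have "prob {\<omega>\<in>space M. ennreal \<delta> < (\<integral>\<^sup>+s. ennreal ((?G m s \<omega>)\<^sup>2) \<partial>lborel)}
      \<le> prob ({\<omega>\<in>space M. ennreal (\<delta> / 4 / L\<^sup>2) < ?U m \<omega>} \<union> {\<omega>\<in>space M. ennreal (\<delta> / 4) < ?V \<omega>})"
    proof (rule finite_measure_mono)
      have "ennreal (\<delta> / 4 / L\<^sup>2) < u" if "ennreal (\<delta> / 4) < ennreal (L\<^sup>2) * u" for u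
      proof (rule ccontr)
        assume "\<not> ennreal (\<delta> / 4 / L\<^sup>2) < u"
        then have "ennreal (L\<^sup>2) * u \<le> ennreal (L\<^sup>2) * ennreal (\<delta> / 4 / L\<^sup>2)" by (intro mult_left_mono) auto
        also have "\<dots> = ennreal (\<delta> / 4)" using L pos by (simp flip: ennreal_mult)
        finally show False using that by simp
      qed
      then show "{\<omega>\<in>space M. ennreal \<delta> < (\<integral>\<^sup>+s. ennreal ((?G m s \<omega>)\<^sup>2) \<partial>lborel)}
        \<subseteq> {\<omega>\<in>space M. ennreal (\<delta> / 4 / L\<^sup>2) < ?U m \<omega>} \<union> {\<omega>\<in>space M. ennreal (\<delta> / 4) < ?V \<omega>}"
        using ennreal_less_double_sum[OF pos(1) _ W] by blast
    qed measurable
    also have "\<dots> \<le> prob {\<omega>\<in>space M. ennreal (\<delta> / 4 / L\<^sup>2) < ?U m \<omega>} + prob {\<omega>\<in>space M. ennreal (\<delta> / 4) < ?V \<omega>}"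
      by (rule measure_Un_le) measurable
    finally show ?thesis by simp
  qed
  have "(\<lambda>m. ?a m + (prob {\<omega>\<in>space M. ennreal (\<delta> / 4) < ?V \<omega>} + \<delta> / \<epsilon>\<^sup>2)) \<longlonglongrightarrow> 0 + (prob {\<omega>\<in>space M. ennreal (\<delta> / 4) < ?V \<omega>} + \<delta> / \<epsilon>\<^sup>2)"
    by (intro tendsto_add a tendsto_const)
  from LIMSEQ_le_const[OF this] bound show ?thesis by auto
qed

end

section \<open>The Laplace transform of the solution\<close>

lemma uniform_grid_modulus:
  fixes g :: "real \<Rightarrow> real"
  assumes g: "continuous_on {0..t} g" and t: "t > 0" and e: "e > 0"
  shows "\<exists>N. \<forall>n\<ge>N. \<forall>u\<in>{0..t}. \<forall>v\<in>{0..t}. \<bar>u - v\<bar> \<le> t / real (Suc n) \<longrightarrow> \<bar>g u - g v\<bar> \<le> e"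
proof -
  have "uniformly_continuous_on {0..t} g" by (rule compact_uniformly_continuous[OF g]) simp
  then obtain d where d: "d > 0" "\<And>u v. u \<in> {0..t} \<Longrightarrow> v \<in> {0..t} \<Longrightarrow> dist u v < d \<Longrightarrow> dist (g u) (g v) < e"
    using e unfolding uniformly_continuous_on_def by metis
  obtain N where N: "inverse (real (Suc N)) < d / t" using reals_Archimedean[of "d / t"] d t by auto
  show ?thesis
  proof (intro exI[of _ N] allI impI ballI)
    fix n u v assume n: "N \<le> n" and uv: "u \<in> {0..t}" "v \<in> {0..t}" "\<bar>u - v\<bar> \<le> t / real (Suc n)"
    have "t / real (Suc n) \<le> t / real (Suc N)" using n t by (intro divide_left_mono) auto
    also have "\<dots> < d" using N t by (simp add: field_simps inverse_eq_divide)
    finally have "dist u v < d" using uv by (simp add: dist_real_def)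
    then show "\<bar>g u - g v\<bar> \<le> e" using d(2)[OF uv(1,2)] by (simp add: dist_real_def)
  qed
qed

lemma continuous_on_interval_bound:
  fixes g :: "real \<Rightarrow> real"
  assumes g: "continuous_on {0..t} g" and t: "t > 0"
  obtains G where "G > 0" "\<And>s. s \<in> {0..t} \<Longrightarrow> \<bar>g s\<bar> \<le> G"
proof -
  have "bounded (g ` {0..t})" by (rule compact_imp_bounded[OF compact_continuous_image[OF g]]) simp
  then obtain G where "G > 0" "\<forall>y\<in>g ` {0..t}. norm y \<le> G" unfolding bounded_pos by blast
  then show thesis using that[of G] by auto
qed

text \<open>With \<open>g\<close> a path of X and \<open>J\<close> its drift integral, the product
  rule gives \<psi> d(g - J) = d(\<psi> g) - (\<psi>' - \<theta> \<psi>) g ds - \<theta> \<kappa>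
  \<psi> ds, and the Riccati equation turns the middle bracket into \<sigma>^2 \<psi>^2 / 2. The
  rule needs only continuity of \<open>g\<close> because \<psi> is differentiable. All k are covered
  uniformly, since the stopping index depends on the path.\<close>

lemma riccati_riemann_sum:
  fixes g \<psi> \<Psi> J :: "real \<Rightarrow> real"
  assumes t: "t > 0" and g: "continuous_on {0..t} g"
    and \<psi>: "\<And>s. s \<in> {0..t} \<Longrightarrow> (\<psi> has_real_derivative \<theta> * \<psi> s + \<sigma>\<^sup>2 / 2 * (\<psi> s)\<^sup>2) (at s within {0..t})"
    and \<Psi>: "\<And>s. s \<in> {0..t} \<Longrightarrow> (\<Psi> has_real_derivative \<psi> s) (at s within {0..t})"
    and J: "\<And>s. s \<in> {0..t} \<Longrightarrow> (J has_real_derivative \<theta> * (\<kappa> - g s)) (at s within {0..t})"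
    and e: "e > 0"
  defines "q \<equiv> \<lambda>n j. t * real j / real (Suc n)"
  shows "\<exists>N. \<forall>n\<ge>N. \<forall>k\<le>Suc n.
    \<bar>(\<Sum>j<k. \<psi> (q n j) * ((g (q n (Suc j)) - J (q n (Suc j))) - (g (q n j) - J (q n j)))
        + \<sigma>\<^sup>2 / 2 * (\<psi> (q n j))\<^sup>2 * g (q n j) * (q n (Suc j) - q n j))
      - (\<psi> (q n k) * g (q n k) - \<psi> 0 * g 0 - \<theta> * \<kappa> * (\<Psi> (q n k) - \<Psi> 0))\<bar> \<le> e"
proof -
  have \<psi>c: "continuous_on {0..t} \<psi>"
    using \<psi> by (meson DERIV_continuous continuous_on_eq_continuous_within)
  obtain G where G: "G > 0" "\<And>s. s \<in> {0..t} \<Longrightarrow> \<bar>g s\<bar> \<le> G" by (rule continuous_on_interval_bound[OF g t]) blast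
  obtain L where L: "L > 0" "\<And>s. s \<in> {0..t} \<Longrightarrow> \<bar>\<psi> s\<bar> \<le> L" by (rule continuous_on_interval_bound[OF \<psi>c t]) blast
  \<comment> \<open>Collects the coefficients of the modulus \<eta> in the bound on f' below; the
    final 1 makes it positive.\<close>
  define C where "C = \<bar>\<theta> * \<kappa>\<bar> + \<bar>\<theta>\<bar> * (G + L) + \<sigma>\<^sup>2 / 2 * (2 * L * G + L\<^sup>2) + 1"
  have C: "C > 0" unfolding C_def using G L by (intro add_nonneg_pos add_nonneg_nonneg mult_nonneg_nonneg) auto
  define \<eta> where "\<eta> = e / (C * t)"
  have \<eta>: "\<eta> > 0" using e C t by (simp add: \<eta>_def)
  obtain N1 where N1: "\<And>n u v. n \<ge> N1 \<Longrightarrow> u \<in> {0..t} \<Longrightarrow> v \<in> {0..t} \<Longrightarrow> \<bar>u - v\<bar> \<le> t / real (Suc n) \<Longrightarrow> \<bar>g u - g v\<bar> \<le> \<eta>"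
    using uniform_grid_modulus[OF g t \<eta>] by blast
  obtain N2 where N2: "\<And>n u v. n \<ge> N2 \<Longrightarrow> u \<in> {0..t} \<Longrightarrow> v \<in> {0..t} \<Longrightarrow> \<bar>u - v\<bar> \<le> t / real (Suc n) \<Longrightarrow> \<bar>\<psi> u - \<psi> v\<bar> \<le> \<eta>"
    using uniform_grid_modulus[OF \<psi>c t \<eta>] by blast
  show ?thesis
  proof (intro exI[of _ "max N1 N2"] allI impI)
    fix n k assume n: "max N1 N2 \<le> n" and k: "k \<le> Suc n"
    have q_step: "q n (Suc j) - q n j = t / real (Suc n)" for j unfolding q_def diff_divide_distrib[symmetric] right_diff_distrib[symmetric] by simp
    have q_mono: "q n i \<le> q n j" if "i \<le> j" for i j using that t by (simp add: q_def divide_right_mono)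
    have q_end: "q n 0 = 0" "q n (Suc n) = t" by (simp_all add: q_def)
    define c where "c j = \<psi> (q n j) * ((g (q n (Suc j)) - J (q n (Suc j))) - (g (q n j) - J (q n j)))
        + \<sigma>\<^sup>2 / 2 * (\<psi> (q n j))\<^sup>2 * g (q n j) * (q n (Suc j) - q n j)" for j
    define E where "E k = \<psi> (q n k) * g (q n k) - \<psi> 0 * g 0 - \<theta> * \<kappa> * (\<Psi> (q n k) - \<Psi> 0)" for k
    have cell: "\<bar>c j - (E (Suc j) - E j)\<bar> \<le> e / real (Suc n)" if j: "j < Suc n" for j
    proof -
      let ?u = "q n j" and ?v = "q n (Suc j)"
      have uv: "0 \<le> ?u" "?u \<le> ?v" "?v \<le> t" using q_mono[of 0 j] q_mono[of "Suc j" "Suc n"] q_mono[of j "Suc j"] q_end j by auto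
      \<comment> \<open>Increments of \<open>g\<close>, which is not differentiable, cancel
        algebraically: \<psi> is paired with the right end value of \<open>g\<close> and the
        remaining factors are frozen at the left end. The error of the cell becomes an increment of
        this differentiable function, whose derivative is of the order of the modulus.\<close>
      define f where "f s = - \<psi> s * g ?v - \<psi> ?u * J s + \<sigma>\<^sup>2 / 2 * (\<psi> ?u)\<^sup>2 * g ?u * s + \<theta> * \<kappa> * \<Psi> s" for s
      define f' where "f' s = - (\<theta> * \<psi> s + \<sigma>\<^sup>2 / 2 * (\<psi> s)\<^sup>2) * g ?v - \<psi> ?u * (\<theta> * (\<kappa> - g s))
        + \<sigma>\<^sup>2 / 2 * (\<psi> ?u)\<^sup>2 * g ?u + \<theta> * \<kappa> * \<psi> s" for s
      have "norm (f ?v - f ?u) \<le> (\<eta> * C) * norm (?v - ?u)"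
      proof (rule field_differentiable_bound[where S="{?u..?v}" and f'=f'])
        fix s assume s: "s \<in> {?u..?v}"
        then have s0: "s \<in> {0..t}" using uv by auto
        have sub: "{?u..?v} \<subseteq> {0..t}" using uv by auto
        show "(f has_field_derivative f' s) (at s within {?u..?v})"
          unfolding f_def f'_def
          by (auto intro!: derivative_eq_intros DERIV_subset[OF \<psi>[OF s0] sub] DERIV_subset[OF \<Psi>[OF s0] sub]
              DERIV_subset[OF J[OF s0] sub] simp: algebra_simps)
        have d: "\<bar>s - ?u\<bar> \<le> t / real (Suc n)" "\<bar>s - ?v\<bar> \<le> t / real (Suc n)" "\<bar>?u - ?v\<bar> \<le> t / real (Suc n)"
          using s q_step[of j] by auto
        have u0: "?u \<in> {0..t}" "?v \<in> {0..t}" using uv by auto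
        have gs: "\<bar>g s - g ?v\<bar> \<le> \<eta>" "\<bar>g ?u - g ?v\<bar> \<le> \<eta>" using N1[OF _ s0 u0(2) d(2)] N1[OF _ u0 d(3)] n by auto
        have ps: "\<bar>\<psi> s - \<psi> ?u\<bar> \<le> \<eta>" using N2[OF _ s0 u0(1) d(1)] n by auto
        have e1: "f' s = \<theta> * \<kappa> * (\<psi> s - \<psi> ?u) + \<theta> * (\<psi> s * (g s - g ?v) - (\<psi> s - \<psi> ?u) * g s)
            + \<sigma>\<^sup>2 / 2 * ((\<psi> ?u)\<^sup>2 * (g ?u - g ?v) - (\<psi> s - \<psi> ?u) * (\<psi> s + \<psi> ?u) * g ?v)"
          by (simp add: f'_def power2_eq_square algebra_simps)
        have b1: "\<bar>\<theta> * \<kappa> * (\<psi> s - \<psi> ?u)\<bar> \<le> \<bar>\<theta> * \<kappa>\<bar> * \<eta>" unfolding abs_mult[of "\<theta> * \<kappa>"] using ps by (intro mult_left_mono) auto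
        have "\<bar>\<psi> s * (g s - g ?v) - (\<psi> s - \<psi> ?u) * g s\<bar> \<le> \<bar>\<psi> s\<bar> * \<bar>g s - g ?v\<bar> + \<bar>\<psi> s - \<psi> ?u\<bar> * \<bar>g s\<bar>"
          by (rule order_trans[OF abs_triangle_ineq4]) (simp add: abs_mult)
        also have "\<dots> \<le> L * \<eta> + \<eta> * G" using gs ps G(2)[OF s0] L(2)[OF s0] L(1) \<eta> by (intro add_mono mult_mono) auto
        finally have b2: "\<bar>\<theta> * (\<psi> s * (g s - g ?v) - (\<psi> s - \<psi> ?u) * g s)\<bar> \<le> \<bar>\<theta>\<bar> * (L * \<eta> + \<eta> * G)"
          unfolding abs_mult[of \<theta>] by (rule mult_left_mono) simp
        have "\<bar>(\<psi> ?u)\<^sup>2 * (g ?u - g ?v) - (\<psi> s - \<psi> ?u) * (\<psi> s + \<psi> ?u) * g ?v\<bar>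
          \<le> \<bar>\<psi> ?u\<bar>\<^sup>2 * \<bar>g ?u - g ?v\<bar> + \<bar>\<psi> s - \<psi> ?u\<bar> * \<bar>\<psi> s + \<psi> ?u\<bar> * \<bar>g ?v\<bar>"
          by (rule order_trans[OF abs_triangle_ineq4]) (simp add: abs_mult)
        also have "\<dots> \<le> L\<^sup>2 * \<eta> + \<eta> * (2 * L) * G"
          using gs ps G(2)[OF u0(2)] L(2)[OF s0] L(2)[OF u0(1)] L(1) \<eta>
          by (intro add_mono mult_mono power_mono) auto
        finally have b3: "\<bar>\<sigma>\<^sup>2 / 2 * ((\<psi> ?u)\<^sup>2 * (g ?u - g ?v) - (\<psi> s - \<psi> ?u) * (\<psi> s + \<psi> ?u) * g ?v)\<bar>
          \<le> \<sigma>\<^sup>2 / 2 * (L\<^sup>2 * \<eta> + \<eta> * (2 * L) * G)"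
          unfolding abs_mult[of "\<sigma>\<^sup>2 / 2"] by (subst abs_of_nonneg) (auto intro!: mult_left_mono)
        have "\<bar>f' s\<bar> \<le> \<bar>\<theta> * \<kappa>\<bar> * \<eta> + \<bar>\<theta>\<bar> * (L * \<eta> + \<eta> * G) + \<sigma>\<^sup>2 / 2 * (L\<^sup>2 * \<eta> + \<eta> * (2 * L) * G)"
          unfolding e1 using b1 b2 b3 by linarith
        also have "\<dots> \<le> \<eta> * C" using \<eta> by (simp add: C_def algebra_simps)
        finally show "norm (f' s) \<le> \<eta> * C" by simp
      qed (use uv in auto)
      also have "norm (?v - ?u) = t / real (Suc n)" using q_step[of j] t by simp
      also have "\<eta> * C * (t / real (Suc n)) = e / real (Suc n)" using C t by (simp add: \<eta>_def)
      finally have "\<bar>f ?v - f ?u\<bar> \<le> e / real (Suc n)" by simp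
      moreover have "f ?v - f ?u = c j - (E (Suc j) - E j)"
        by (simp add: f_def c_def E_def field_simps)
      ultimately show ?thesis by simp
    qed
    have tel: "(\<Sum>j<m. c j - (E (Suc j) - E j)) = (\<Sum>j<m. c j) - (E m - E 0)" for m
      by (induction m) auto
    have "E 0 = 0" by (simp add: E_def q_end)
    then have "(\<Sum>j<k. c j) - E k = (\<Sum>j<k. c j - (E (Suc j) - E j))"
      by (simp add: tel)
    also have "\<bar>\<dots>\<bar> \<le> (\<Sum>j<k. e / real (Suc n))"
      by (rule order_trans[OF sum_abs sum_mono]) (use cell k in auto)
    also have "\<dots> = real k * (e / real (Suc n))" by simp
    also have "\<dots> \<le> real (Suc n) * (e / real (Suc n))" using k e by (intro mult_right_mono) auto
    also have "\<dots> = e" by simp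
    finally show "\<bar>(\<Sum>j<k. \<psi> (q n j) * ((g (q n (Suc j)) - J (q n (Suc j))) - (g (q n j) - J (q n j)))
        + \<sigma>\<^sup>2 / 2 * (\<psi> (q n j))\<^sup>2 * g (q n j) * (q n (Suc j) - q n j))
      - (\<psi> (q n k) * g (q n k) - \<psi> 0 * g 0 - \<theta> * \<kappa> * (\<Psi> (q n k) - \<Psi> 0))\<bar> \<le> e"
      unfolding c_def E_def .
  qed
qed

text \<open>Uniform continuity on [0, t] makes the step error at most \<open>d\<close> pointwise,
  and \<open>d\<close> is chosen so that (L d)^2 t \<le> e. The coefficients are arbitrary within
  the bound \<open>L\<close>, hence may depend on the path and on n.\<close>

lemma (in brownian) step_approximation_error:
  fixes h :: "real \<Rightarrow> real" and c :: "nat \<Rightarrow> nat \<Rightarrow> real"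
  assumes t: "t > 0" and h: "continuous_on {0..t} h" and e: "e > 0"
    and c: "\<And>n j. j < Suc n \<Longrightarrow> \<bar>c n j\<bar> \<le> L"
  defines "q \<equiv> \<lambda>n j. t * real j / real (Suc n)"
  shows "\<exists>N. \<forall>n\<ge>N. (\<integral>\<^sup>+s. ennreal ((\<Sum>j<Suc n. c n j * (h s - h (q n j)) * indicator {q n j<..q n (Suc j)} s)\<^sup>2) \<partial>lborel) \<le> ennreal e"
proof -
  have L0: "0 \<le> L" using c[of 0 0] by simp
  define d where "d = sqrt (e / t) / (L + 1)"
  have d: "d > 0" using e t L0 by (simp add: d_def)
  obtain N where N: "\<And>n u v. n \<ge> N \<Longrightarrow> u \<in> {0..t} \<Longrightarrow> v \<in> {0..t} \<Longrightarrow> \<bar>u - v\<bar> \<le> t / real (Suc n) \<Longrightarrow> \<bar>h u - h v\<bar> \<le> d"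
    using uniform_grid_modulus[OF h t d] by blast
  show ?thesis
  proof (intro exI[of _ N] allI impI)
    fix n assume n: "N \<le> n"
    have q_step: "q n (Suc j) - q n j = t / real (Suc n)" for j unfolding q_def diff_divide_distrib[symmetric] right_diff_distrib[symmetric] by simp
    have q_mono: "q n i \<le> q n j" if "i \<le> j" for i j using that t by (simp add: q_def divide_right_mono)
    have q_end: "q n 0 = 0" "q n (Suc n) = t" by (simp_all add: q_def)
    have "(\<integral>\<^sup>+s. ennreal ((\<Sum>j<Suc n. c n j * (h s - h (q n j)) * indicator {q n j<..q n (Suc j)} s)\<^sup>2) \<partial>lborel)
      \<le> (\<integral>\<^sup>+s. ennreal (e / t) * indicator {0<..t} s \<partial>lborel)"
    proof (rule nn_integral_mono)
      fix s
      have le: "\<bar>c n j * (h s - h (q n j)) * indicator {q n j<..q n (Suc j)} s\<bar> \<le> (L * d) * indicator {q n j<..q n (Suc j)} s"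
        if j: "j < Suc n" for j
      proof (cases "s \<in> {q n j<..q n (Suc j)}")
        case True
        have "0 \<le> q n j" "q n (Suc j) \<le> t" using q_mono[of 0 j] q_mono[of "Suc j" "Suc n"] q_end j by auto
        then have "\<bar>h s - h (q n j)\<bar> \<le> d" using True q_step[of j] by (intro N[OF n]) auto
        then have "\<bar>c n j\<bar> * \<bar>h s - h (q n j)\<bar> \<le> L * d" using c[OF j] by (intro mult_mono) (use L0 in auto)
        then show ?thesis using True by (simp add: abs_mult)
      qed simp
      have "\<bar>\<Sum>j<Suc n. c n j * (h s - h (q n j)) * indicator {q n j<..q n (Suc j)} s\<bar>
        \<le> (\<Sum>j<Suc n. (L * d) * indicator {q n j<..q n (Suc j)} s)"
        by (rule order_trans[OF sum_abs sum_mono]) (use le in auto)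
      also have "\<dots> = (L * d) * indicator {0<..t} s"
      proof -
        have "(\<Sum>j<Suc n. indicator {q n j<..q n (Suc j)} s) = (indicator {q n 0<..q n (Suc n)} s :: real)"
        proof (rule sum_indicator_grid)
          show "q n j < q n (Suc j)" for j using q_step[of j] t by (metis diff_gt_0_iff_gt divide_pos_pos of_nat_0_less_iff zero_less_Suc)
        qed
        then show ?thesis unfolding sum_distrib_left[symmetric] q_end by simp
      qed
      also have "\<dots> \<le> sqrt (e / t) * indicator {0<..t} s"
      proof (rule mult_right_mono)
        have "L * d \<le> (L + 1) * d" using d by simp
        also have "\<dots> = sqrt (e / t)" using L0 by (simp add: d_def)
        finally show "L * d \<le> sqrt (e / t)" .
      qed simp
      finally have "(\<Sum>j<Suc n. c n j * (h s - h (q n j)) * indicator {q n j<..q n (Suc j)} s)\<^sup>2 \<le> (sqrt (e / t) * indicator {0<..t} s)\<^sup>2"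
        by (subst power2_abs[symmetric]) (rule power_mono, auto)
      also have "\<dots> = e / t * indicator {0<..t} s" using e t by (simp add: power_mult_distrib indicator_def)
      finally show "ennreal ((\<Sum>j<Suc n. c n j * (h s - h (q n j)) * indicator {q n j<..q n (Suc j)} s)\<^sup>2) \<le> ennreal (e / t) * indicator {0<..t} s"
        by (cases "s \<in> {0<..t}") (auto simp: ennreal_leI)
    qed
    also have "\<dots> = ennreal e" using e t by (simp add: nn_integral_cmult_indicator flip: ennreal_mult)
    finally show "(\<integral>\<^sup>+s. ennreal ((\<Sum>j<Suc n. c n j * (h s - h (q n j)) * indicator {q n j<..q n (Suc j)} s)\<^sup>2) \<partial>lborel) \<le> ennreal e" .
  qed
qed

text \<open>Uniform integrability by hand: f \<le> min f b + f^2 / b, where the first term is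
  handled by dominated convergence and the second by the \<open>L^2\<close> bound.\<close>

lemma (in prob_space) L2_bounded_AE_null_imp_L1_null:
  fixes f :: "nat \<Rightarrow> 'a \<Rightarrow> real"
  assumes f[measurable]: "\<And>n. f n \<in> borel_measurable M" and f0: "\<And>n \<omega>. 0 \<le> f n \<omega>"
    and lim: "AE \<omega> in M. (\<lambda>n. f n \<omega>) \<longlonglongrightarrow> 0"
    and C: "\<And>n. integrable M (\<lambda>\<omega>. (f n \<omega>)\<^sup>2)" "\<And>n. (\<integral>\<omega>. (f n \<omega>)\<^sup>2 \<partial>M) \<le> C"
  shows "(\<lambda>n. \<integral>\<omega>. f n \<omega> \<partial>M) \<longlonglongrightarrow> 0"
proof (rule tendstoI)
  fix e :: real assume e: "e > 0"
  have C0: "0 \<le> C" using order_trans[OF _ C(2)[of 0]] by simp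
  \<comment> \<open>C + 1 in place of C yields the strict inequality C / b < e/2 and a positive
    level even if C = 0.\<close>
  define b where "b = 2 * (C + 1) / e"
  have b: "b > 0" using C0 e by (simp add: b_def)
  have Cb: "C / b < e / 2"
  proof -
    have "C < e / 2 * b" using e by (simp add: b_def)
    then show ?thesis using b by (simp add: pos_divide_less_eq)
  qed
  have "(\<lambda>n. \<integral>\<omega>. min (f n \<omega>) b \<partial>M) \<longlonglongrightarrow> (\<integral>\<omega>. 0 \<partial>M)"
  proof (rule integral_dominated_convergence[where w="\<lambda>\<omega>. b"])
    show "AE \<omega> in M. (\<lambda>n. min (f n \<omega>) b) \<longlonglongrightarrow> 0"
      using lim
    proof eventually_elim
      case (elim \<omega>)
      from tendsto_min[OF elim tendsto_const[of b]] show ?case using b by simp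
    qed
    show "AE \<omega> in M. norm (min (f n \<omega>) b) \<le> b" for n using b f0 by (auto simp: min_def)
  qed auto
  then have "\<forall>\<^sub>F n in sequentially. (\<integral>\<omega>. min (f n \<omega>) b \<partial>M) < e / 2"
    using order_tendstoD(2)[of _ 0 sequentially "e/2"] e by simp
  then show "\<forall>\<^sub>F n in sequentially. dist (\<integral>\<omega>. f n \<omega> \<partial>M) 0 < e"
  proof eventually_elim
    case (elim n)
    have fi: "integrable M (f n)" by (rule square_integrable_imp_integrable[OF f C(1)])
    have mi: "integrable M (\<lambda>\<omega>. min (f n \<omega>) b)"
      using b f0 by (intro integrable_const_bound[where B=b]) (auto simp: min_def)
    have "f n \<omega> \<le> min (f n \<omega>) b + (f n \<omega>)\<^sup>2 / b" for \<omega>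
    proof (cases "f n \<omega> \<le> b")
      case False
      then have "f n \<omega> * b \<le> (f n \<omega>)\<^sup>2" using f0[of n \<omega>] unfolding power2_eq_square by (intro mult_left_mono) auto
      then have "f n \<omega> \<le> (f n \<omega>)\<^sup>2 / b" using b by (simp only: pos_le_divide_eq)
      then show ?thesis using b False by (simp add: min_def)
    qed (use b in simp)
    then have "(\<integral>\<omega>. f n \<omega> \<partial>M) \<le> (\<integral>\<omega>. min (f n \<omega>) b + (f n \<omega>)\<^sup>2 / b \<partial>M)"
      by (intro integral_mono) (use fi mi C(1) in auto)
    also have "\<dots> = (\<integral>\<omega>. min (f n \<omega>) b \<partial>M) + (\<integral>\<omega>. (f n \<omega>)\<^sup>2 \<partial>M) / b" using mi C(1) by simp
    also have "\<dots> \<le> (\<integral>\<omega>. min (f n \<omega>) b \<partial>M) + C / b" using C(2)[of n] b by (simp add: divide_right_mono)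
    also have "\<dots> < e" using elim Cb by linarith
    finally have "(\<integral>\<omega>. f n \<omega> \<partial>M) < e" .
    moreover have "0 \<le> (\<integral>\<omega>. f n \<omega> \<partial>M)" using f0 by simp
    ultimately show ?case by simp
  qed
qed

text \<open>Capping at 1 turns convergence in probability into convergence in mean, from which an
  almost surely convergent subsequence is extracted; near 0 the cap is invisible.\<close>

lemma (in brownian) null_in_prob_AE_subseq:
  assumes "null_in_prob Z"
  shows "\<exists>r. strict_mono r \<and> (AE \<omega> in M. (\<lambda>n. Z (r n) \<omega>) \<longlonglongrightarrow> 0)"
proof -
  have Z[measurable]: "Z m \<in> borel_measurable M" for m using assms by (simp add: null_in_prob_def)
  let ?u = "\<lambda>m \<omega>. min 1 \<bar>Z m \<omega>\<bar>"
  have int: "integrable M (?u m)" for m by (rule integrable_const_bound[where B=1]) auto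
  have "(\<lambda>m. \<integral>\<omega>. norm (?u m \<omega>) \<partial>M) \<longlonglongrightarrow> 0"
  proof (rule tendstoI)
    fix e :: real assume e: "e > 0"
    have "\<forall>\<^sub>F m in sequentially. prob {\<omega>\<in>space M. e / 2 < \<bar>Z m \<omega>\<bar>} < e / 2"
      using order_tendstoD(2)[OF null_in_probD[OF assms, of "e/2"], of "e/2"] e by simp
    then show "\<forall>\<^sub>F m in sequentially. dist (\<integral>\<omega>. norm (?u m \<omega>) \<partial>M) 0 < e"
    proof eventually_elim
      case (elim m)
      let ?A = "{\<omega>\<in>space M. e / 2 < \<bar>Z m \<omega>\<bar>}"
      have iA: "integrable M (indicator ?A :: 'a \<Rightarrow> real)" by (rule integrable_real_indicator) (auto simp: emeasure_eq_measure)
      have "(\<integral>\<omega>. norm (?u m \<omega>) \<partial>M) \<le> (\<integral>\<omega>. e / 2 + indicator ?A \<omega> \<partial>M)"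
      proof (rule integral_mono)
        show "integrable M (\<lambda>\<omega>. norm (?u m \<omega>))" using int[of m] by simp
        show "integrable M (\<lambda>\<omega>. e / 2 + indicator ?A \<omega>)" using iA by (intro Bochner_Integration.integrable_add) auto
        show "norm (?u m \<omega>) \<le> e / 2 + indicator ?A \<omega>" if "\<omega> \<in> space M" for \<omega>
        proof (cases "e / 2 < \<bar>Z m \<omega>\<bar>")
          case True
          then have "indicator ?A \<omega> = (1::real)" using that by simp
          then show ?thesis using e by simp
        qed auto
      qed
      also have "\<dots> = e / 2 + prob ?A" using iA by (simp add: prob_space)
      finally have "(\<integral>\<omega>. norm (?u m \<omega>) \<partial>M) < e" using elim by simp
      moreover have "0 \<le> (\<integral>\<omega>. norm (?u m \<omega>) \<partial>M)" by simp
      ultimately show ?case by simp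
    qed
  qed
  from tendsto_L1_AE_subseq[OF int this] obtain r where r: "strict_mono r" "AE \<omega> in M. (\<lambda>n. ?u (r n) \<omega>) \<longlonglongrightarrow> 0" by auto
  have "AE \<omega> in M. (\<lambda>n. Z (r n) \<omega>) \<longlonglongrightarrow> 0"
    using r(2)
  proof eventually_elim
    case (elim \<omega>)
    then have "\<forall>\<^sub>F n in sequentially. ?u (r n) \<omega> < 1" by (rule order_tendstoD) simp
    then have "\<forall>\<^sub>F n in sequentially. ?u (r n) \<omega> = \<bar>Z (r n) \<omega>\<bar>" by eventually_elim auto
    with elim have "(\<lambda>n. \<bar>Z (r n) \<omega>\<bar>) \<longlonglongrightarrow> 0" by (rule Lim_transform_eventually)
    then show ?case by (rule tendsto_rabs_zero_cancel)
  qed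
  then show ?thesis using r(1) by blast
qed

lemma (in prob_space) prob_tendsto_0_pointwise:
  assumes "\<And>\<omega>. \<omega> \<in> space M \<Longrightarrow> \<forall>\<^sub>F n in sequentially. \<omega> \<notin> A n" "\<And>n. A n \<subseteq> space M"
  shows "(\<lambda>n. prob (A n)) \<longlonglongrightarrow> 0"
proof -
  \<comment> \<open>Since \<open>prob\<close> is 0 off the events, replacing nonmeasurable sets by
    the empty set leaves the sequence of probabilities unchanged and makes dominated convergence
    available.\<close>
  define A' where "A' n = (if A n \<in> events then A n else {})" for n
  have A'[measurable]: "A' n \<in> events" for n by (simp add: A'_def)
  have "(\<lambda>n. \<integral>\<omega>. indicator (A' n) \<omega> \<partial>M) \<longlonglongrightarrow> (\<integral>\<omega>. (0::real) \<partial>M)"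
  proof (rule integral_dominated_convergence[where w="\<lambda>\<omega>. 1"])
    show "AE \<omega> in M. (\<lambda>n. indicator (A' n) \<omega>) \<longlonglongrightarrow> (0::real)"
    proof (rule AE_I2)
      fix \<omega> assume "\<omega> \<in> space M"
      from assms(1)[OF this] have "\<forall>\<^sub>F n in sequentially. indicator (A' n) \<omega> = (0::real)"
        by eventually_elim (auto simp: A'_def)
      then show "(\<lambda>n. indicator (A' n) \<omega>) \<longlonglongrightarrow> (0::real)" by (rule tendsto_eventually)
    qed
    show "AE \<omega> in M. norm (indicator (A' n) \<omega> :: real) \<le> 1" for n by (auto simp: indicator_def)
  qed auto
  moreover have "prob (A' n) = prob (A n)" for n by (auto simp: A'_def measure_notin_sets)
  ultimately show ?thesis by simp
qed

text \<open>\<psi> is the Riccati solution on [0, t] that will end at the Laplace rate, \<Psi> a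
  primitive of it. Their sign and monotonicity bound the exponent from above, because X is
  nonnegative.\<close>

locale cir_riccati = brownian +
  fixes \<theta> \<kappa> \<sigma> T x t :: real and X :: "real \<Rightarrow> 'a \<Rightarrow> real" and \<psi> \<Psi> :: "real \<Rightarrow> real"
  assumes \<theta>: "\<theta> > 0" and \<kappa>: "\<kappa> > 0" and \<sigma>: "\<sigma> > 0"
    and sol: "cir_solution \<theta> \<kappa> \<sigma> T M F B x X"
    and t: "0 < t" "t \<le> T"
    and \<psi>: "\<And>s. s \<in> {0..t} \<Longrightarrow> (\<psi> has_real_derivative \<theta> * \<psi> s + \<sigma>\<^sup>2 / 2 * (\<psi> s)\<^sup>2) (at s within {0..t})"
    and \<psi>_nonneg: "\<And>s. s \<in> {0..t} \<Longrightarrow> 0 \<le> \<psi> s"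
    and \<Psi>: "\<And>s. s \<in> {0..t} \<Longrightarrow> (\<Psi> has_real_derivative \<psi> s) (at s within {0..t})"
    and \<Psi>_le: "\<And>s. s \<in> {0..t} \<Longrightarrow> \<Psi> s \<le> \<Psi> t"
begin

section \<open>Stopped discretisations of the exponential martingale\<close>

definition q :: "nat \<Rightarrow> nat \<Rightarrow> real" where "q n j = t * real j / real (Suc n)"
definition J :: "'a \<Rightarrow> real \<Rightarrow> real" where "J \<omega> s = (LBINT r:{0..s}. \<theta> * (\<kappa> - X r \<omega>))"
definition H :: "real \<Rightarrow> 'a \<Rightarrow> real" where "H s \<omega> = \<sigma> * sqrt (X s \<omega>)"

lemma q_step: "q n (Suc j) - q n j = t / real (Suc n)"
  unfolding q_def diff_divide_distrib[symmetric] right_diff_distrib[symmetric] by simp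

lemma q_less: "q n j < q n (Suc j)"
proof -
  have "0 < t / real (Suc n)" using t by simp
  then show ?thesis using q_step[of n j] by linarith
qed

lemma q_mono: "i \<le> j \<Longrightarrow> q n i \<le> q n j"
  using t by (simp add: q_def divide_right_mono)

lemma q_end: "q n 0 = 0" "q n (Suc n) = t"
  by (simp_all add: q_def)

lemma q_in: "j \<le> Suc n \<Longrightarrow> q n j \<in> {0..t}"
  using q_mono[of 0 j n] q_mono[of j "Suc n" n] by (simp add: q_end)

lemma q_in_T: "j \<le> Suc n \<Longrightarrow> q n j \<in> {0..T}"
  using q_in[of j n] t by auto

lemma X_F: "s \<in> {0..T} \<Longrightarrow> X s \<in> borel_measurable (F s)"
  using sol by (simp add: cir_solution_def)

lemma X_M: "s \<in> {0..T} \<Longrightarrow> X s \<in> borel_measurable M"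
  using X_F measurable_F by blast

lemma X_nonneg: "s \<in> {0..T} \<Longrightarrow> \<omega> \<in> space M \<Longrightarrow> 0 \<le> X s \<omega>"
  using sol by (simp add: cir_solution_def)

lemma X_cont: "\<omega> \<in> space M \<Longrightarrow> continuous_on {0..t} (\<lambda>s. X s \<omega>)"
  using sol t unfolding cir_solution_def by (auto intro: continuous_on_subset)

lemma J_deriv:
  assumes "\<omega> \<in> space M" "s \<in> {0..t}"
  shows "(J \<omega> has_real_derivative \<theta> * (\<kappa> - X s \<omega>)) (at s within {0..t})"
proof -
  have c: "continuous_on {0..t} (\<lambda>r. \<theta> * (\<kappa> - X r \<omega>))"
    by (intro continuous_intros X_cont assms)
  have "J \<omega> s = integral {0..s} (\<lambda>r. \<theta> * (\<kappa> - X r \<omega>))" if "s \<in> {0..t}" for s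
    unfolding J_def
    by (intro set_borel_integral_eq_integral borel_integrable_atLeastAtMost' continuous_on_subset[OF c]) (use that in auto)
  then show ?thesis
    using integral_has_real_derivative[OF c assms(2)] assms(2)
    by (subst has_field_derivative_cong_eventually[where g="\<lambda>s. integral {0..s} (\<lambda>r. \<theta> * (\<kappa> - X r \<omega>))"])
      (auto simp: eventually_at_filter)
qed

lemma ito_decomposition:
  obtains Y where "\<And>r. r \<in> {0..T} \<Longrightarrow> has_ito_integral M F B H r (Y r)"
    "\<And>r. r \<in> {0..T} \<Longrightarrow> AE \<omega> in M. X r \<omega> = x + J \<omega> r + Y r \<omega>"
proof -
  have "\<forall>r\<in>{0..T}. \<exists>Y. has_ito_integral M F B H r Y \<and> (AE \<omega> in M. X r \<omega> = x + J \<omega> r + Y \<omega>)"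
    using sol unfolding cir_solution_def H_def[abs_def] J_def by blast
  from bchoice[OF this] obtain Y where
    "\<forall>r\<in>{0..T}. has_ito_integral M F B H r (Y r) \<and> (AE \<omega> in M. X r \<omega> = x + J \<omega> r + Y r \<omega>)" by (elim exE)
  then show thesis by (intro that) (drule (1) bspec, erule conjunct1, drule (1) bspec, erule conjunct2)
qed

text \<open>The starting value enters the equation only through its instance at time 0: simple
  integrals vanish there, hence so does their limit in probability, and the drift integral is over a
  point.\<close>

lemma X_0: "AE \<omega> in M. X 0 \<omega> = x"
proof -
  obtain Y where Y: "\<And>r. r \<in> {0..T} \<Longrightarrow> has_ito_integral M F B H r (Y r)"
    "\<And>r. r \<in> {0..T} \<Longrightarrow> AE \<omega> in M. X r \<omega> = x + J \<omega> r + Y r \<omega>"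
    by (rule ito_decomposition) blast
  have T: "0 \<in> {0..T}" using t by auto
  obtain S where S: "approximates S H 0" "null_in_prob (\<lambda>m \<omega>. simple_integral B (S m) 0 \<omega> - Y 0 \<omega>)"
    by (rule has_ito_integralE[OF Y(1)[OF T]]) auto
  have "simple_integral B (S m) 0 \<omega> = 0" for m \<omega>
    using S(1) simple_integral_0 by (auto simp: approximates_def)
  with S(2) have "null_in_prob (\<lambda>m. Y 0)" by (simp add: null_in_prob_def)
  from null_in_prob_AE_subseq[OF this] obtain r :: "nat \<Rightarrow> nat" where "AE \<omega> in M. (\<lambda>n::nat. Y 0 \<omega>) \<longlonglongrightarrow> 0"
    by (elim exE conjE)
  then have "AE \<omega> in M. Y 0 \<omega> = 0" by eventually_elim (simp add: LIMSEQ_const_iff)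
  with Y(2)[OF T] show ?thesis
  proof eventually_elim
    case (elim \<omega>)
    have "J \<omega> 0 = 0" unfolding J_def set_lebesgue_integral_def
    proof (rule integral_eq_zero_AE)
      show "AE r in lborel. indicat_real {0..0} r *\<^sub>R (\<theta> * (\<kappa> - X r \<omega>)) = 0"
        using AE_lborel_singleton[of "0::real"] by eventually_elim simp
    qed
    with elim show ?case by simp
  qed
qed

definition below :: "real \<Rightarrow> nat \<Rightarrow> nat \<Rightarrow> 'a \<Rightarrow> bool" where
  "below K n j \<omega> \<longleftrightarrow> (\<forall>i\<le>j. X (q n i) \<omega> \<le> K)"

text \<open>The stopped coefficient: it is switched off from the first grid time at which X exceeds
  \<open>K\<close>, an event already known at that time.\<close>

definition \<eta> :: "real \<Rightarrow> nat \<Rightarrow> nat \<Rightarrow> 'a \<Rightarrow> real" where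
  "\<eta> K n j \<omega> = (if below K n j \<omega> then \<psi> (q n j) else 0)"

text \<open>The exponent that gives exp (c - \<psi>(t) X(t)) mean one; in the application exp (- c)
  is the Laplace transform sought.\<close>

definition c :: real where "c = \<psi> 0 * x + \<theta> * \<kappa> * (\<Psi> t - \<Psi> 0)"

text \<open>The part of the discrete exponent that is computed path by path. Subtracting
  \<open>J\<close> leaves the increments of the stochastic integral, so D is minus the stopped
  Riemann sum for \<psi> d(X - J) + (\<sigma>^2 / 2) \<psi>^2 X ds.\<close>

definition D :: "real \<Rightarrow> nat \<Rightarrow> 'a \<Rightarrow> real" where
  "D K n \<omega> = - (\<Sum>j<Suc n. \<eta> K n j \<omega> * ((X (q n (Suc j)) \<omega> - J \<omega> (q n (Suc j))) - (X (q n j) \<omega> - J \<omega> (q n j)))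
      + \<sigma>\<^sup>2 / 2 * (\<eta> K n j \<omega>)\<^sup>2 * X (q n j) \<omega> * (q n (Suc j) - q n j))"

text \<open>Rational multiples of t form a countable set, which gives measurability, and contain the
  grid points of every mesh, so one event serves all n.\<close>

definition never_above :: "real \<Rightarrow> 'a set" where
  "never_above K = {\<omega>\<in>space M. \<forall>u\<in>\<rat> \<inter> {0..1}. X (t * u) \<omega> \<le> K}"

lemma never_above_sets: "never_above K \<in> events"
proof -
  have "never_above K = (\<Inter>u\<in>\<rat> \<inter> {0..1}. {\<omega>\<in>space M. X (t * u) \<omega> \<le> K})"
    by (auto simp: never_above_def intro: exI[of _ 0])
  also have "\<dots> \<in> events"
  proof (rule sets.countable_INT')
    show "countable (\<rat> \<inter> {0..1::real})" by (rule countable_subset[OF _ countable_rat]) auto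
    have "0 \<in> \<rat> \<inter> {0..1::real}" by auto
    then show "\<rat> \<inter> {0..1::real} \<noteq> {}" by blast
    have "{\<omega>\<in>space M. X (t * u) \<omega> \<le> K} \<in> events" if "u \<in> {0..1}" for u
    proof -
      have "t * u \<le> t" "0 \<le> t * u" using that t by (simp_all add: mult_left_le)
      then have "t * u \<in> {0..T}" using t(2) unfolding atLeastAtMost_iff by linarith
      then have [measurable]: "X (t * u) \<in> borel_measurable M" by (rule X_M)
      show ?thesis by measurable
    qed
    then show "(\<lambda>u. {\<omega>\<in>space M. X (t * u) \<omega> \<le> K}) ` (\<rat> \<inter> {0..1}) \<subseteq> events" by auto
  qed
  finally show ?thesis .
qed

lemma never_above_below: "\<omega> \<in> never_above K \<Longrightarrow> j \<le> Suc n \<Longrightarrow> below K n j \<omega>"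
  unfolding below_def
proof (intro allI impI)
  fix i assume w: "\<omega> \<in> never_above K" "j \<le> Suc n" "i \<le> j"
  have "real i / real (Suc n) \<in> \<rat> \<inter> {0..1}" using w(2,3) by auto
  moreover have "\<forall>u\<in>\<rat> \<inter> {0..1}. X (t * u) \<omega> \<le> K" using w(1) by (simp add: never_above_def)
  ultimately have "X (t * (real i / real (Suc n))) \<omega> \<le> K" by (rule bspec[rotated])
  then show "X (q n i) \<omega> \<le> K" unfolding q_def by (simp only: times_divide_eq_right)
qed

lemma prob_above: "(\<lambda>k. prob (space M - never_above (real k))) \<longlonglongrightarrow> 0"
proof (rule prob_tendsto_0_pointwise)
  fix \<omega> assume w: "\<omega> \<in> space M"
  obtain G where G: "G > 0" "\<And>s. s \<in> {0..t} \<Longrightarrow> \<bar>X s \<omega>\<bar> \<le> G"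
    by (rule continuous_on_interval_bound[OF X_cont[OF w] t(1)]) blast
  have "\<forall>\<^sub>F k in sequentially. G \<le> real k"
    using eventually_ge_at_top[of "nat \<lceil>G\<rceil>"] by eventually_elim linarith
  then show "\<forall>\<^sub>F k in sequentially. \<omega> \<notin> space M - never_above (real k)"
  proof eventually_elim
    case (elim k)
    have "X (t * u) \<omega> \<le> real k" if "u \<in> {0..1}" for u
    proof -
      have "t * u \<le> t" using that t by (simp add: mult_left_le)
      then have "\<bar>X (t * u) \<omega>\<bar> \<le> G" using that t by (intro G) auto
      with elim show ?thesis by simp
    qed
    then show ?case using w by (auto simp: never_above_def)
  qed
qed auto

text \<open>The stopped Riemann sum telescopes to its value at the stopping index. There \<psi> X is
  nonnegative and \<Psi> is at most its final value, which gives the upper bound on all paths; on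
  paths that never stop, the index is the end of the grid.\<close>

lemma D_limit:
  assumes w: "\<omega> \<in> space M" "X 0 \<omega> = x" and e: "e > 0"
  shows "\<exists>N. \<forall>n\<ge>N. D K n \<omega> \<le> c + e \<and> (\<omega> \<in> never_above K \<longrightarrow> \<bar>D K n \<omega> - (c - \<psi> t * X t \<omega>)\<bar> \<le> e)"
proof -
  obtain N where N: "\<And>n k. n \<ge> N \<Longrightarrow> k \<le> Suc n \<Longrightarrow>
    \<bar>(\<Sum>j<k. \<psi> (q n j) * ((X (q n (Suc j)) \<omega> - J \<omega> (q n (Suc j))) - (X (q n j) \<omega> - J \<omega> (q n j)))
        + \<sigma>\<^sup>2 / 2 * (\<psi> (q n j))\<^sup>2 * X (q n j) \<omega> * (q n (Suc j) - q n j))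
      - (\<psi> (q n k) * X (q n k) \<omega> - \<psi> 0 * X 0 \<omega> - \<theta> * \<kappa> * (\<Psi> (q n k) - \<Psi> 0))\<bar> \<le> e"
    using riccati_riemann_sum[OF t(1) X_cont[OF w(1)] \<psi> \<Psi> J_deriv[OF w(1)] e] unfolding q_def by blast
  show ?thesis
  proof (intro exI[of _ N] allI impI)
    fix n assume n: "N \<le> n"
    \<comment> \<open>The first index at which the path exceeds \<open>K\<close>, or the end of the
      grid if there is none earlier.\<close>
    define k where "k = (LEAST k. k = Suc n \<or> \<not> below K n k \<omega>)"
    have kP: "k = Suc n \<or> \<not> below K n k \<omega>" unfolding k_def by (rule LeastI[of _ "Suc n"]) simp
    have kn: "k \<le> Suc n" unfolding k_def by (rule Least_le) simp
    have lt: "below K n j \<omega>" if "j < k" for j using not_less_Least[OF that[unfolded k_def]] by simp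
    have ge: "\<not> below K n j \<omega>" if "k \<le> j" "j < Suc n" for j
      using kP that unfolding below_def by (metis le_trans not_less)
    have "D K n \<omega> = - (\<Sum>j<Suc n. if j < k then \<psi> (q n j) * ((X (q n (Suc j)) \<omega> - J \<omega> (q n (Suc j))) - (X (q n j) \<omega> - J \<omega> (q n j)))
        + \<sigma>\<^sup>2 / 2 * (\<psi> (q n j))\<^sup>2 * X (q n j) \<omega> * (q n (Suc j) - q n j) else 0)"
      unfolding D_def by (intro arg_cong[where f=uminus] sum.cong refl) (use lt ge in \<open>auto simp: \<eta>_def not_less\<close>)
    also have "(\<Sum>j<Suc n. if j < k then \<psi> (q n j) * ((X (q n (Suc j)) \<omega> - J \<omega> (q n (Suc j))) - (X (q n j) \<omega> - J \<omega> (q n j)))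
        + \<sigma>\<^sup>2 / 2 * (\<psi> (q n j))\<^sup>2 * X (q n j) \<omega> * (q n (Suc j) - q n j) else 0)
      = (\<Sum>j<k. \<psi> (q n j) * ((X (q n (Suc j)) \<omega> - J \<omega> (q n (Suc j))) - (X (q n j) \<omega> - J \<omega> (q n j)))
        + \<sigma>\<^sup>2 / 2 * (\<psi> (q n j))\<^sup>2 * X (q n j) \<omega> * (q n (Suc j) - q n j))"
      by (rule sum.mono_neutral_cong_right) (use kn in auto)
    finally have b: "\<bar>- D K n \<omega> - (\<psi> (q n k) * X (q n k) \<omega> - \<psi> 0 * x - \<theta> * \<kappa> * (\<Psi> (q n k) - \<Psi> 0))\<bar> \<le> e"
      using N[OF n kn] w(2) by simp
    have "0 \<le> \<psi> (q n k) * X (q n k) \<omega>"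
      using \<psi>_nonneg[OF q_in[OF kn]] X_nonneg[OF q_in_T[OF kn] w(1)] by simp
    moreover have "\<theta> * \<kappa> * (\<Psi> (q n k) - \<Psi> 0) \<le> \<theta> * \<kappa> * (\<Psi> t - \<Psi> 0)"
      using \<Psi>_le[OF q_in[OF kn]] \<theta> \<kappa> by (intro mult_left_mono) auto
    ultimately have 1: "D K n \<omega> \<le> c + e" using b unfolding c_def by linarith
    have 2: "\<bar>D K n \<omega> - (c - \<psi> t * X t \<omega>)\<bar> \<le> e" if g: "\<omega> \<in> never_above K"
    proof -
      have "k = Suc n" using kP never_above_below[OF g kn] by blast
      then show ?thesis using b unfolding c_def by (simp add: q_end)
    qed
    show "D K n \<omega> \<le> c + e \<and> (\<omega> \<in> never_above K \<longrightarrow> \<bar>D K n \<omega> - (c - \<psi> t * X t \<omega>)\<bar> \<le> e)" using 1 2 by blast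
  qed
qed

lemma \<psi>_bound: obtains L where "L > 0" "\<And>s. s \<in> {0..t} \<Longrightarrow> \<psi> s \<le> L"
proof -
  have "continuous_on {0..t} \<psi>"
    using \<psi> by (meson DERIV_continuous continuous_on_eq_continuous_within)
  then obtain L where "L > 0" "\<And>s. s \<in> {0..t} \<Longrightarrow> \<bar>\<psi> s\<bar> \<le> L" by (rule continuous_on_interval_bound[OF _ t(1)]) blast
  then show thesis using that[of L] by force
qed

lemma below_F:
  assumes "j < Suc n"
  shows "{\<omega>\<in>space (F (q n j)). below K n j \<omega>} \<in> sets (F (q n j))"
proof -
  have [measurable]: "X (q n i) \<in> borel_measurable (F (q n j))" if "i \<le> j" for i
    using assms that q_mono[OF that] by (intro measurable_F_mono[OF X_F[OF q_in_T]]) auto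
  have "{\<omega>\<in>space (F (q n j)). below K n j \<omega>} = {\<omega>\<in>space (F (q n j)). \<forall>i\<in>{..j}. X (q n i) \<omega> \<le> K}"
    by (auto simp: below_def)
  also have "\<dots> \<in> sets (F (q n j))" by (rule sets.sets_Collect_finite_All) (auto intro: borel_measurable_le)
  finally show ?thesis .
qed

lemma \<eta>_F:
  assumes "j < Suc n"
  shows "\<eta> K n j \<in> borel_measurable (F (q n j))"
proof -
  have [measurable]: "Measurable.pred (F (q n j)) (below K n j)"
    using below_F[OF assms] by (simp add: pred_def)
  show ?thesis unfolding \<eta>_def[abs_def] by measurable
qed

lemma H_F:
  assumes "j < Suc n"
  shows "H (q n j) \<in> borel_measurable (F (q n j))"
proof -
  have [measurable]: "X (q n j) \<in> borel_measurable (F (q n j))" using assms by (intro X_F q_in_T) simp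
  show ?thesis unfolding H_def[abs_def] by measurable
qed

lemma \<eta>H_square:
  assumes L: "\<And>s. s \<in> {0..t} \<Longrightarrow> \<psi> s \<le> L" and j: "j < Suc n" and w: "\<omega> \<in> space M"
  shows "(\<eta> K n j \<omega> * H (q n j) \<omega>)\<^sup>2 \<le> L\<^sup>2 * \<sigma>\<^sup>2 * \<bar>K\<bar>"
proof (cases "below K n j \<omega>")
  case True
  have q: "q n j \<in> {0..t}" "q n j \<in> {0..T}" using q_in[of j n] q_in_T[of j n] j by auto
  have X: "0 \<le> X (q n j) \<omega>" "X (q n j) \<omega> \<le> \<bar>K\<bar>" using X_nonneg[OF q(2) w] True by (auto simp: below_def)
  have "(\<eta> K n j \<omega> * H (q n j) \<omega>)\<^sup>2 = (\<psi> (q n j))\<^sup>2 * (\<sigma>\<^sup>2 * X (q n j) \<omega>)"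
    using True X by (simp add: \<eta>_def H_def power_mult_distrib)
  also have "\<dots> \<le> L\<^sup>2 * (\<sigma>\<^sup>2 * \<bar>K\<bar>)"
    using X L[OF q(1)] \<psi>_nonneg[OF q(1)] \<sigma> by (intro mult_mono power_mono) auto
  finally show ?thesis by (simp add: mult.assoc)
qed (simp add: \<eta>_def)

text \<open>The exponent of the discrete exponential martingale with coefficients - \<eta>
  H.\<close>

definition Q :: "real \<Rightarrow> nat \<Rightarrow> 'a \<Rightarrow> real" where
  "Q K n \<omega> = (\<Sum>j<Suc n. - (\<eta> K n j \<omega> * H (q n j) \<omega>) * (B (q n (Suc j)) \<omega> - B (q n j) \<omega>))
    - (\<Sum>j<Suc n. (- (\<eta> K n j \<omega> * H (q n j) \<omega>))\<^sup>2 * (q n (Suc j) - q n j)) / 2"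

lemma \<eta>H_F: "j < Suc n \<Longrightarrow> (\<lambda>\<omega>. \<eta> K n j \<omega> * H (q n j) \<omega>) \<in> borel_measurable (F (q n j))"
  using \<eta>_F H_F by (intro borel_measurable_times)

lemma Q_M: "Q K n \<in> borel_measurable M"
proof -
  have "(\<lambda>\<omega>. - (\<eta> K n j \<omega> * H (q n j) \<omega>)) \<in> borel_measurable (F (q n j))" if "j < Suc n" for j
    using \<eta>H_F[OF that] by (rule borel_measurable_uminus)
  then have "(\<lambda>\<omega>. \<Sum>j<Suc n. - (\<eta> K n j \<omega> * H (q n j) \<omega>) * (B (q n (Suc j)) \<omega> - B (q n j) \<omega>)) \<in> borel_measurable (F (q n (Suc n)))"
    "(\<lambda>\<omega>. \<Sum>j<Suc n. (- (\<eta> K n j \<omega> * H (q n j) \<omega>))\<^sup>2 * (q n (Suc j) - q n j)) \<in> borel_measurable (F (q n (Suc n)))"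
    using grid_sum_measurable[of "q n" "Suc n" "\<lambda>j \<omega>. - (\<eta> K n j \<omega> * H (q n j) \<omega>)" "Suc n"] q_less q_end by auto
  from measurable_F[OF this(1)] measurable_F[OF this(2)] show ?thesis
    unfolding Q_def[abs_def] by (intro borel_measurable_diff borel_measurable_divide) auto
qed

lemma exp_Q: "integrable M (\<lambda>\<omega>. exp (Q K n \<omega>))" "(\<integral>\<omega>. exp (Q K n \<omega>) \<partial>M) = 1"
proof -
  have "(\<integral>\<^sup>+\<omega>. ennreal (exp (Q K n \<omega>)) \<partial>M) = 1"
    unfolding Q_def
  proof (rule exponential_martingale_grid)
    show "(\<lambda>\<omega>. - (\<eta> K n j \<omega> * H (q n j) \<omega>)) \<in> borel_measurable (F (q n j))" if "j < Suc n" for j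
      using \<eta>H_F[OF that] by (rule borel_measurable_uminus)
  qed (use q_less q_end in auto)
  then have "has_bochner_integral M (\<lambda>\<omega>. exp (Q K n \<omega>)) 1"
    using Q_M by (intro has_bochner_integral_nn_integral) auto
  then show "integrable M (\<lambda>\<omega>. exp (Q K n \<omega>))" "(\<integral>\<omega>. exp (Q K n \<omega>) \<partial>M) = 1"
    by (auto simp: has_bochner_integral_iff)
qed

text \<open>Doubling \<open>Q\<close> gives the exponent of the exponential martingale with doubled
  coefficients plus the discrete variance, and stopping bounds that variance by a constant.\<close>

lemma exp_2Q:
  assumes L: "\<And>s. s \<in> {0..t} \<Longrightarrow> \<psi> s \<le> L"
  shows "integrable M (\<lambda>\<omega>. exp (2 * Q K n \<omega>))" "(\<integral>\<omega>. exp (2 * Q K n \<omega>) \<partial>M) \<le> exp (L\<^sup>2 * \<sigma>\<^sup>2 * \<bar>K\<bar> * t)"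
proof -
  let ?C = "exp (L\<^sup>2 * \<sigma>\<^sup>2 * \<bar>K\<bar> * t)"
  let ?x = "\<lambda>j \<omega>. - 2 * (\<eta> K n j \<omega> * H (q n j) \<omega>)"
  let ?R = "\<lambda>\<omega>. (\<Sum>j<Suc n. ?x j \<omega> * (B (q n (Suc j)) \<omega> - B (q n j) \<omega>))
    - (\<Sum>j<Suc n. (?x j \<omega>)\<^sup>2 * (q n (Suc j) - q n j)) / 2"
  have R1: "(\<integral>\<^sup>+\<omega>. ennreal (exp (?R \<omega>)) \<partial>M) = 1"
  proof (rule exponential_martingale_grid)
    show "?x j \<in> borel_measurable (F (q n j))" if "j < Suc n" for j
      by (rule borel_measurable_times[OF borel_measurable_const \<eta>H_F[OF that]])
  qed (use q_less q_end in auto)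
  have le: "exp (2 * Q K n \<omega>) \<le> ?C * exp (?R \<omega>)" if w: "\<omega> \<in> space M" for \<omega>
  proof -
    have "2 * Q K n \<omega> = (\<Sum>j<Suc n. (\<eta> K n j \<omega> * H (q n j) \<omega>)\<^sup>2 * (q n (Suc j) - q n j)) + ?R \<omega>"
      unfolding Q_def by (simp only: power2_minus power_mult_distrib sum_distrib_left right_diff_distrib sum_divide_distrib
          sum_subtractf[symmetric] sum.distrib[symmetric] sum_negf[symmetric])
        (intro sum.cong refl, simp add: field_simps)
    moreover have "(\<Sum>j<Suc n. (\<eta> K n j \<omega> * H (q n j) \<omega>)\<^sup>2 * (q n (Suc j) - q n j)) \<le> (\<Sum>j<Suc n. L\<^sup>2 * \<sigma>\<^sup>2 * \<bar>K\<bar> * (t / real (Suc n)))"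
      unfolding q_step using \<eta>H_square[OF L _ w] t by (intro sum_mono mult_right_mono) auto
    moreover have "(\<Sum>j<Suc n. L\<^sup>2 * \<sigma>\<^sup>2 * \<bar>K\<bar> * (t / real (Suc n))) = L\<^sup>2 * \<sigma>\<^sup>2 * \<bar>K\<bar> * t"
      by (simp del: of_nat_Suc)
    ultimately have "2 * Q K n \<omega> \<le> L\<^sup>2 * \<sigma>\<^sup>2 * \<bar>K\<bar> * t + ?R \<omega>" by linarith
    then show ?thesis unfolding exp_add[symmetric] by simp
  qed
  have fin: "(\<integral>\<^sup>+\<omega>. ennreal (exp (2 * Q K n \<omega>)) \<partial>M) \<le> ennreal ?C"
  proof -
    have Rm[measurable]: "?R \<in> borel_measurable M"
    proof -
      have "?x j \<in> borel_measurable (F (q n j))" if "j < Suc n" for j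
        by (rule borel_measurable_times[OF borel_measurable_const \<eta>H_F[OF that]])
      then have "(\<lambda>\<omega>. \<Sum>j<Suc n. ?x j \<omega> * (B (q n (Suc j)) \<omega> - B (q n j) \<omega>)) \<in> borel_measurable (F (q n (Suc n)))"
        "(\<lambda>\<omega>. \<Sum>j<Suc n. (?x j \<omega>)\<^sup>2 * (q n (Suc j) - q n j)) \<in> borel_measurable (F (q n (Suc n)))"
        using grid_sum_measurable[of "q n" "Suc n" ?x "Suc n"] q_less q_end by auto
      from measurable_F[OF this(1)] measurable_F[OF this(2)] show ?thesis
        by (intro borel_measurable_diff borel_measurable_divide) auto
    qed
    have "(\<integral>\<^sup>+\<omega>. ennreal (exp (2 * Q K n \<omega>)) \<partial>M) \<le> (\<integral>\<^sup>+\<omega>. ennreal ?C * ennreal (exp (?R \<omega>)) \<partial>M)"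
      using le by (intro nn_integral_mono) (simp add: ennreal_mult[symmetric] ennreal_leI)
    also have "\<dots> = ennreal ?C" by (subst nn_integral_cmult, measurable) (simp only: R1 mult_1_right)
    finally show ?thesis .
  qed
  have m: "(\<lambda>\<omega>. exp (2 * Q K n \<omega>)) \<in> borel_measurable M" using Q_M by measurable
  show int: "integrable M (\<lambda>\<omega>. exp (2 * Q K n \<omega>))"
    using fin m by (intro integrableI_nonneg) (auto intro: le_less_trans)
  have "ennreal (\<integral>\<omega>. exp (2 * Q K n \<omega>) \<partial>M) \<le> ennreal ?C"
    using fin by (subst nn_integral_eq_integral[OF int, symmetric]) auto
  then show "(\<integral>\<omega>. exp (2 * Q K n \<omega>) \<partial>M) \<le> ?C" by simp
qed

text \<open>The step energies vanish on every path by continuity of X, hence in probability. The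
  choice of \<delta> makes the deterministic term of \<open>ito_riemann_error\<close> equal to
  d/2.\<close>

lemma Z_null:
  assumes Y: "\<And>r. r \<in> {0..T} \<Longrightarrow> has_ito_integral M F B H r (Y r)"
  shows "null_in_prob (\<lambda>n \<omega>. \<Sum>j<Suc n. \<eta> K n j \<omega> * (Y (q n (Suc j)) \<omega> - Y (q n j) \<omega>
      - H (q n j) \<omega> * (B (q n (Suc j)) \<omega> - B (q n j) \<omega>)))" (is "null_in_prob ?Z")
  unfolding null_in_prob_def
proof (intro conjI allI impI)
  obtain L where L: "L > 0" "\<And>s. s \<in> {0..t} \<Longrightarrow> \<psi> s \<le> L" by (rule \<psi>_bound) blast
  have YM: "Y (q n j) \<in> borel_measurable M" if "j \<le> Suc n" for n j
    using Y[OF q_in_T[OF that]] by (simp add: has_ito_integral_def)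
  have BM: "B (q n j) \<in> borel_measurable M" if "j \<le> Suc n" for n j
    using q_in[OF that] by (intro B_measurable) auto
  show "?Z n \<in> borel_measurable M" for n
    by (intro borel_measurable_sum borel_measurable_times borel_measurable_diff YM BM
        measurable_F[OF \<eta>_F] measurable_F[OF H_F]) auto
  have \<eta>_abs: "\<bar>\<eta> K n j \<omega>\<bar> \<le> L" if "j < Suc n" for n j \<omega>
    using L(2)[of "q n j"] \<psi>_nonneg[of "q n j"] q_in[of j n] that L(1) by (auto simp: \<eta>_def)
  fix e :: real assume e: "e > 0"
  show "(\<lambda>n. prob {\<omega>\<in>space M. e < \<bar>?Z n \<omega>\<bar>}) \<longlonglongrightarrow> 0"
  proof (rule tendstoI)
    fix d :: real assume d: "d > 0"
    define \<delta> where "\<delta> = d / 2 * (e / 2)\<^sup>2"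
    have \<delta>: "\<delta> > 0" "\<delta> / (e / 2)\<^sup>2 = d / 2" using d e by (simp_all add: \<delta>_def)
    let ?V = "\<lambda>n \<omega>. (\<integral>\<^sup>+s. ennreal ((\<Sum>j<Suc n. \<eta> K n j \<omega> * (H s \<omega> - H (q n j) \<omega>) * indicator {q n j<..q n (Suc j)} s)\<^sup>2) \<partial>lborel)"
    have "(\<lambda>n. prob {\<omega>\<in>space M. ennreal (\<delta> / 4) < ?V n \<omega>}) \<longlonglongrightarrow> 0"
    proof (rule prob_tendsto_0_pointwise)
      fix \<omega> assume w: "\<omega> \<in> space M"
      have "continuous_on {0..t} (\<lambda>s. H s \<omega>)" unfolding H_def by (intro continuous_intros X_cont w)
      from step_approximation_error[OF t(1) this, of "\<delta> / 4" "\<lambda>n j. \<eta> K n j \<omega>" L] \<eta>_abs \<delta>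
      have "\<exists>N. \<forall>n\<ge>N. ?V n \<omega> \<le> ennreal (\<delta> / 4)" unfolding q_def by auto
      then obtain N where "\<And>n. n \<ge> N \<Longrightarrow> ?V n \<omega> \<le> ennreal (\<delta> / 4)" by blast
      then show "\<forall>\<^sub>F n in sequentially. \<omega> \<notin> {\<omega>\<in>space M. ennreal (\<delta> / 4) < ?V n \<omega>}"
        unfolding eventually_sequentially by (intro exI[of _ N]) (auto simp: not_less)
    qed auto
    then have "\<forall>\<^sub>F n in sequentially. prob {\<omega>\<in>space M. ennreal (\<delta> / 4) < ?V n \<omega>} < d / 2"
      using d by (intro order_tendstoD) auto
    then show "\<forall>\<^sub>F n in sequentially. dist (prob {\<omega>\<in>space M. e < \<bar>?Z n \<omega>\<bar>}) 0 < d"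
    proof eventually_elim
      case (elim n)
      have "prob {\<omega>\<in>space M. 2 * (e / 2) < \<bar>?Z n \<omega>\<bar>} \<le> prob {\<omega>\<in>space M. ennreal (\<delta> / 4) < ?V n \<omega>} + \<delta> / (e / 2)\<^sup>2"
      proof (rule ito_riemann_error[where L=L])
        fix j assume j: "j < Suc n"
        show "\<exists>c. \<forall>\<omega>\<in>space M. \<bar>\<eta> K n j \<omega> * H (q n j) \<omega>\<bar> \<le> c"
        proof (intro exI ballI)
          fix \<omega> assume "\<omega> \<in> space M"
          from \<eta>H_square[OF L(2) j this, of K] show "\<bar>\<eta> K n j \<omega> * H (q n j) \<omega>\<bar> \<le> sqrt (L\<^sup>2 * \<sigma>\<^sup>2 * \<bar>K\<bar>)"
            by (simp add: real_le_rsqrt)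
        qed
      qed (use q_less q_end Y q_in_T \<eta>_F H_F \<eta>_abs L \<delta> e in auto)
      then show ?case using elim \<delta>(2) by simp
    qed
  qed
qed

text \<open>For fixed K the discrete exponentials have mean one. Along a subsequence they converge
  almost surely to the desired variable on paths that stay below K, and elsewhere they are
  eventually at most exp (c + 1). The \<open>L^2\<close> bound carries this to expectations, with an
  error proportional to the probability of exceeding K.\<close>

theorem exponential_moment: "(\<integral>\<omega>. exp (c - \<psi> t * X t \<omega>) \<partial>M) = 1"
proof -
  obtain L where L: "L > 0" "\<And>s. s \<in> {0..t} \<Longrightarrow> \<psi> s \<le> L" by (rule \<psi>_bound) blast
  obtain Y where Y: "\<And>r. r \<in> {0..T} \<Longrightarrow> has_ito_integral M F B H r (Y r)"
    "\<And>r. r \<in> {0..T} \<Longrightarrow> AE \<omega> in M. X r \<omega> = x + J \<omega> r + Y r \<omega>"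
    by (rule ito_decomposition) blast
  let ?V = "\<lambda>\<omega>. exp (c - \<psi> t * X t \<omega>)"
  have tT: "t \<in> {0..T}" "t \<in> {0..t}" using t by auto
  have Xt[measurable]: "X t \<in> borel_measurable M" by (rule X_M[OF tT(1)])
  have Vle: "?V \<omega> \<le> exp c" if "\<omega> \<in> space M" for \<omega>
    using \<psi>_nonneg[OF tT(2)] X_nonneg[OF tT(1) that] by simp
  have Vint: "integrable M ?V" by (rule integrable_const_bound[where B="exp c"]) (use Vle in auto)
  \<comment> \<open>The exceptional null set of the equation depends on the time; only the countably
    many grid times are combined.\<close>
  have grid: "AE \<omega> in M. \<forall>n. \<forall>j\<in>{..Suc n}. X (q n j) \<omega> = x + J \<omega> (q n j) + Y (q n j) \<omega>"
    unfolding AE_all_countable by (intro allI AE_finite_allI Y(2) q_in_T) auto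
  have bounds: "1 \<le> (\<integral>\<omega>. ?V \<omega> \<partial>M) + exp (c + 1) * prob (space M - never_above K)"
    "(\<integral>\<omega>. ?V \<omega> \<partial>M) - exp c * prob (space M - never_above K) \<le> 1" for K
  proof -
    let ?Z = "\<lambda>n \<omega>. \<Sum>j<Suc n. \<eta> K n j \<omega> * (Y (q n (Suc j)) \<omega> - Y (q n j) \<omega>
      - H (q n j) \<omega> * (B (q n (Suc j)) \<omega> - B (q n j) \<omega>))"
    let ?A = "never_above K" and ?b = "prob (space M - never_above K)"
    have [measurable]: "?A \<in> events" by (rule never_above_sets)
    obtain r where r: "strict_mono r" "AE \<omega> in M. (\<lambda>n. ?Z (r n) \<omega>) \<longlonglongrightarrow> 0"
      using null_in_prob_AE_subseq[OF Z_null[OF Y(1)]] by blast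
    have QZD: "Q K n \<omega> = ?Z n \<omega> + D K n \<omega>"
      if g: "\<forall>n. \<forall>j\<in>{..Suc n}. X (q n j) \<omega> = x + J \<omega> (q n j) + Y (q n j) \<omega>" and w: "\<omega> \<in> space M" for n \<omega>
    proof -
      have XX: "X (q n j) \<omega> = x + J \<omega> (q n j) + Y (q n j) \<omega>" if "j \<le> Suc n" for j using g that by auto
      have H2: "(H (q n j) \<omega>)\<^sup>2 = \<sigma>\<^sup>2 * X (q n j) \<omega>" if "j < Suc n" for j
        using X_nonneg[OF q_in_T[of j n] w] that by (simp add: H_def power_mult_distrib)
      show ?thesis
        unfolding Q_def D_def sum_divide_distrib sum_subtractf[symmetric] sum_negf[symmetric] sum.distrib[symmetric]
      proof (rule sum.cong[OF refl])
        fix j assume "j \<in> {..<Suc n}"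
        then have j: "j < Suc n" by simp
        have E: "(X (q n (Suc j)) \<omega> - J \<omega> (q n (Suc j))) - (X (q n j) \<omega> - J \<omega> (q n j)) = Y (q n (Suc j)) \<omega> - Y (q n j) \<omega>"
          using XX[of j] XX[of "Suc j"] j by simp
        show "- (\<eta> K n j \<omega> * H (q n j) \<omega>) * (B (q n (Suc j)) \<omega> - B (q n j) \<omega>)
            - (- (\<eta> K n j \<omega> * H (q n j) \<omega>))\<^sup>2 * (q n (Suc j) - q n j) / 2
          = \<eta> K n j \<omega> * (Y (q n (Suc j)) \<omega> - Y (q n j) \<omega> - H (q n j) \<omega> * (B (q n (Suc j)) \<omega> - B (q n j) \<omega>))
            + - (\<eta> K n j \<omega> * ((X (q n (Suc j)) \<omega> - J \<omega> (q n (Suc j))) - (X (q n j) \<omega> - J \<omega> (q n j)))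
              + \<sigma>\<^sup>2 / 2 * (\<eta> K n j \<omega>)\<^sup>2 * X (q n j) \<omega> * (q n (Suc j) - q n j))"
          unfolding E using H2[OF j] by (simp add: power_mult_distrib algebra_simps)
      qed
    qed
    \<comment> \<open>Two defects at once: the distance to the limit on paths below
      \<open>K\<close>, and the excess over exp (c + 1) on all paths. The 1 leaves room for one half
      from D and one half from Z.\<close>
    define f where "f n \<omega> = \<bar>exp (Q K (r n) \<omega>) - ?V \<omega>\<bar> * indicator ?A \<omega> + max 0 (exp (Q K (r n) \<omega>) - exp (c + 1))" for n \<omega>
    have [measurable]: "Q K n \<in> borel_measurable M" for n by (rule Q_M)
    have fM[measurable]: "f n \<in> borel_measurable M" for n unfolding f_def[abs_def] by measurable
    have f0: "0 \<le> f n \<omega>" for n \<omega> by (simp add: f_def)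
    have fle: "f n \<omega> \<le> 2 * exp (Q K (r n) \<omega>) + exp c" if "\<omega> \<in> space M" for n \<omega>
    proof -
      have pos: "0 \<le> a \<Longrightarrow> 0 \<le> b \<Longrightarrow> \<bar>a - b\<bar> * indicator ?A \<omega> \<le> a + b" "0 \<le> a \<Longrightarrow> 0 \<le> b \<Longrightarrow> max 0 (a - b) \<le> a" for a b :: real
        by (auto simp: indicator_def)
      show ?thesis
        using Vle[OF that] pos(1)[of "exp (Q K (r n) \<omega>)" "?V \<omega>"] pos(2)[of "exp (Q K (r n) \<omega>)" "exp (c + 1)"]
        unfolding f_def by (simp only: exp_ge_zero simp_thms True_implies_equals)
    qed
    have f2: "(f n \<omega>)\<^sup>2 \<le> 8 * exp (2 * Q K (r n) \<omega>) + 2 * (exp c)\<^sup>2" if "\<omega> \<in> space M" for n \<omega>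
    proof -
      have "(f n \<omega>)\<^sup>2 \<le> (2 * exp (Q K (r n) \<omega>) + exp c)\<^sup>2" by (rule power_mono[OF fle[OF that] f0])
      also have "\<dots> \<le> 2 * (2 * exp (Q K (r n) \<omega>))\<^sup>2 + 2 * (exp c)\<^sup>2"
        using sum_squares_bound[of "2 * exp (Q K (r n) \<omega>)" "exp c"] by (simp add: power2_eq_square algebra_simps)
      finally show ?thesis by (simp add: power_mult_distrib exp_double)
    qed
    have f2i: "integrable M (\<lambda>\<omega>. (f n \<omega>)\<^sup>2)" for n
      by (rule Bochner_Integration.integrable_bound[where f="\<lambda>\<omega>. 8 * exp (2 * Q K (r n) \<omega>) + 2 * (exp c)\<^sup>2"])
        (use exp_2Q(1)[OF L(2)] f2 in \<open>auto intro!: AE_I2 order_trans[OF f2]\<close>)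
    have f2b: "(\<integral>\<omega>. (f n \<omega>)\<^sup>2 \<partial>M) \<le> 8 * exp (L\<^sup>2 * \<sigma>\<^sup>2 * \<bar>K\<bar> * t) + 2 * (exp c)\<^sup>2" for n
    proof -
      have "(\<integral>\<omega>. (f n \<omega>)\<^sup>2 \<partial>M) \<le> (\<integral>\<omega>. 8 * exp (2 * Q K (r n) \<omega>) + 2 * (exp c)\<^sup>2 \<partial>M)"
        by (rule integral_mono) (use exp_2Q(1)[OF L(2)] f2 f2i in auto)
      also have "\<dots> = 8 * (\<integral>\<omega>. exp (2 * Q K (r n) \<omega>) \<partial>M) + 2 * (exp c)\<^sup>2"
        using exp_2Q(1)[OF L(2)] by (simp add: prob_space)
      finally show ?thesis using exp_2Q(2)[OF L(2), of K "r n"] by linarith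
    qed
    have fi: "integrable M (f n)" for n by (rule square_integrable_imp_integrable[OF fM f2i])
    have flim: "AE \<omega> in M. (\<lambda>n. f n \<omega>) \<longlonglongrightarrow> 0"
      using r(2) grid X_0 AE_space
    proof eventually_elim
      case (elim \<omega>)
      note Zl = elim(1) and w = elim(4)
      have Qn: "Q K n \<omega> = ?Z n \<omega> + D K n \<omega>" for n by (rule QZD[OF elim(2) w])
      have ev: "\<forall>\<^sub>F n in sequentially. D K (r n) \<omega> \<le> c + e \<and> (\<omega> \<in> ?A \<longrightarrow> \<bar>D K (r n) \<omega> - (c - \<psi> t * X t \<omega>)\<bar> \<le> e)" if e: "e > 0" for e
      proof -
        obtain N where N: "\<forall>n\<ge>N. D K n \<omega> \<le> c + e \<and> (\<omega> \<in> ?A \<longrightarrow> \<bar>D K n \<omega> - (c - \<psi> t * X t \<omega>)\<bar> \<le> e)"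
          using D_limit[OF w elim(3) e] by blast
        have "\<forall>\<^sub>F n in sequentially. N \<le> r n"
          using filterlim_subseq[OF r(1)] by (simp add: filterlim_at_top)
        then show ?thesis by eventually_elim (use N in blast)
      qed
      have l2: "(\<lambda>n. max 0 (exp (Q K (r n) \<omega>) - exp (c + 1))) \<longlonglongrightarrow> 0"
      proof (rule tendsto_eventually)
        have "\<forall>\<^sub>F n in sequentially. ?Z (r n) \<omega> < 1/2" using Zl by (rule order_tendstoD) simp
        moreover have "\<forall>\<^sub>F n in sequentially. D K (r n) \<omega> \<le> c + 1/2" using ev[of "1/2"] by (auto elim: eventually_mono)
        ultimately show "\<forall>\<^sub>F n in sequentially. max 0 (exp (Q K (r n) \<omega>) - exp (c + 1)) = 0"
        proof eventually_elim
          case (elim n)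
          then have "Q K (r n) \<omega> \<le> c + 1" unfolding Qn by linarith
          then show ?case by simp
        qed
      qed
      have l1: "(\<lambda>n. \<bar>exp (Q K (r n) \<omega>) - ?V \<omega>\<bar> * indicator ?A \<omega>) \<longlonglongrightarrow> 0"
      proof (cases "\<omega> \<in> ?A")
        case True
        have "(\<lambda>n. D K (r n) \<omega>) \<longlonglongrightarrow> c - \<psi> t * X t \<omega>"
        proof (rule tendstoI)
          fix e :: real assume "e > 0"
          with ev[of "e/2"] show "\<forall>\<^sub>F n in sequentially. dist (D K (r n) \<omega>) (c - \<psi> t * X t \<omega>) < e"
            using True by (auto elim!: eventually_mono simp: dist_real_def)
        qed
        from tendsto_add[OF Zl this] have "(\<lambda>n. Q K (r n) \<omega>) \<longlonglongrightarrow> c - \<psi> t * X t \<omega>" by (simp only: Qn add_0)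
        from tendsto_rabs_zero[OF LIM_zero[OF tendsto_exp[OF this]]] show ?thesis using True by simp
      qed simp
      show ?case using tendsto_add[OF l1 l2] by (simp only: f_def add_0)
    qed
    have lim: "(\<lambda>n. \<integral>\<omega>. f n \<omega> \<partial>M) \<longlonglongrightarrow> 0"
      by (rule L2_bounded_AE_null_imp_L1_null[OF fM f0 flim f2i f2b])
    have bi: "integrable M (indicator (space M - ?A) :: 'a \<Rightarrow> real)" "(\<integral>\<omega>. indicator (space M - ?A) \<omega> \<partial>M) = ?b"
      by (auto simp: emeasure_eq_measure)
    \<comment> \<open>On the complement of the good event, only the cap exp (c + 1) is known;
      integrating it there produces the probability term.\<close>
    have up: "1 \<le> (\<integral>\<omega>. ?V \<omega> \<partial>M) + exp (c + 1) * ?b + (\<integral>\<omega>. f n \<omega> \<partial>M)" for n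
    proof -
      have "(\<integral>\<omega>. exp (Q K (r n) \<omega>) \<partial>M) \<le> (\<integral>\<omega>. ?V \<omega> + exp (c + 1) * indicator (space M - ?A) \<omega> + f n \<omega> \<partial>M)"
      proof (rule integral_mono)
        fix \<omega> assume w: "\<omega> \<in> space M"
        show "exp (Q K (r n) \<omega>) \<le> ?V \<omega> + exp (c + 1) * indicator (space M - ?A) \<omega> + f n \<omega>"
        proof (cases "\<omega> \<in> ?A")
          case True
          then have "\<bar>exp (Q K (r n) \<omega>) - ?V \<omega>\<bar> \<le> f n \<omega>" unfolding f_def by simp
          moreover have i: "indicator (space M - ?A) \<omega> = (0::real)" using True by simp
          ultimately show ?thesis unfolding i by linarith
        next
          case False
          have "exp (Q K (r n) \<omega>) - exp (c + 1) \<le> f n \<omega>" using False unfolding f_def by simp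
          moreover have i: "indicator (space M - ?A) \<omega> = (1::real)" using False w by simp
          moreover have "0 \<le> ?V \<omega>" by simp
          ultimately show ?thesis unfolding i by linarith
        qed
      qed (use exp_Q(1) Vint bi fi in auto)
      also have "\<dots> = (\<integral>\<omega>. ?V \<omega> \<partial>M) + exp (c + 1) * ?b + (\<integral>\<omega>. f n \<omega> \<partial>M)"
        using Vint bi fi by simp
      finally show ?thesis using exp_Q(2)[of K "r n"] by simp
    qed
    have lo: "(\<integral>\<omega>. ?V \<omega> \<partial>M) - exp c * ?b - (\<integral>\<omega>. f n \<omega> \<partial>M) \<le> 1" for n
    proof -
      have "(\<integral>\<omega>. ?V \<omega> - exp c * indicator (space M - ?A) \<omega> - f n \<omega> \<partial>M) \<le> (\<integral>\<omega>. exp (Q K (r n) \<omega>) \<partial>M)"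
      proof (rule integral_mono)
        fix \<omega> assume w: "\<omega> \<in> space M"
        show "?V \<omega> - exp c * indicator (space M - ?A) \<omega> - f n \<omega> \<le> exp (Q K (r n) \<omega>)"
        proof (cases "\<omega> \<in> ?A")
          case True
          then have "\<bar>exp (Q K (r n) \<omega>) - ?V \<omega>\<bar> \<le> f n \<omega>" unfolding f_def by simp
          moreover have i: "indicator (space M - ?A) \<omega> = (0::real)" using True by simp
          ultimately show ?thesis unfolding i by linarith
        next
          case False
          have i: "indicator (space M - ?A) \<omega> = (1::real)" using False w by simp
          have "0 \<le> exp (Q K (r n) \<omega>)" by simp
          then show ?thesis unfolding i using Vle[OF w] f0[of n \<omega>] by linarith
        qed
      qed (use exp_Q(1) Vint bi fi in auto)
      also have "(\<integral>\<omega>. ?V \<omega> - exp c * indicator (space M - ?A) \<omega> - f n \<omega> \<partial>M) = (\<integral>\<omega>. ?V \<omega> \<partial>M) - exp c * ?b - (\<integral>\<omega>. f n \<omega> \<partial>M)"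
        using Vint bi fi by simp
      finally show ?thesis using exp_Q(2)[of K "r n"] by simp
    qed
    show "1 \<le> (\<integral>\<omega>. ?V \<omega> \<partial>M) + exp (c + 1) * ?b"
    proof (rule LIMSEQ_le_const)
      show "(\<lambda>n. (\<integral>\<omega>. ?V \<omega> \<partial>M) + exp (c + 1) * ?b + (\<integral>\<omega>. f n \<omega> \<partial>M)) \<longlonglongrightarrow> (\<integral>\<omega>. ?V \<omega> \<partial>M) + exp (c + 1) * ?b"
        using tendsto_add[OF tendsto_const lim] by simp
    qed (use up in blast)
    show "(\<integral>\<omega>. ?V \<omega> \<partial>M) - exp c * ?b \<le> 1"
    proof (rule LIMSEQ_le_const2)
      show "(\<lambda>n. (\<integral>\<omega>. ?V \<omega> \<partial>M) - exp c * ?b - (\<integral>\<omega>. f n \<omega> \<partial>M)) \<longlonglongrightarrow> (\<integral>\<omega>. ?V \<omega> \<partial>M) - exp c * ?b"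
        using tendsto_diff[OF tendsto_const lim] by simp
    qed (use lo in blast)
  qed
  show ?thesis
  proof (rule antisym)
    have "(\<lambda>k. (\<integral>\<omega>. ?V \<omega> \<partial>M) - exp c * prob (space M - never_above (real k))) \<longlonglongrightarrow> (\<integral>\<omega>. ?V \<omega> \<partial>M) - exp c * 0"
      by (intro tendsto_intros prob_above)
    then show "(\<integral>\<omega>. ?V \<omega> \<partial>M) \<le> 1" using bounds(2) by (intro LIMSEQ_le_const2) auto
    have "(\<lambda>k. (\<integral>\<omega>. ?V \<omega> \<partial>M) + exp (c + 1) * prob (space M - never_above (real k))) \<longlonglongrightarrow> (\<integral>\<omega>. ?V \<omega> \<partial>M) + exp (c + 1) * 0"
      by (intro tendsto_intros prob_above)
    then show "1 \<le> (\<integral>\<omega>. ?V \<omega> \<partial>M)" using bounds(1) by (intro LIMSEQ_le_const) auto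
  qed
qed

end

text \<open>The Riccati equation is solved backwards from the value l at time t. Its value at 0
  supplies the exponent in x and its primitive the logarithm that becomes the power - 2 \<theta>
  \<kappa> / \<sigma>^2.\<close>

lemma cir_solution_laplace:
  assumes bm: "brownian_motion M F B" and sol: "cir_solution \<theta> \<kappa> \<sigma> T M F B x X"
    and pos: "\<theta> > 0" "\<kappa> > 0" "\<sigma> > 0" "0 < l" and t: "t \<in> {0..T}" and T: "0 < T"
  shows "(\<integral>\<omega>. exp (- l * X t \<omega>) \<partial>M) = cir_laplace \<theta> \<sigma> (2 * \<theta> * \<kappa> / \<sigma>\<^sup>2) t x l"
proof (cases "t = 0")
  case True
  \<comment> \<open>At time 0 only the initial value is wanted; the zero solution of the Riccati
    equation on [0, T] gives access to it.\<close>
  interpret R: cir_riccati M F B \<theta> \<kappa> \<sigma> T x T X "\<lambda>_. 0" "\<lambda>_. 0"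
    by unfold_locales (use assms in auto)
  have "(\<integral>\<omega>. exp (- l * X 0 \<omega>) \<partial>M) = (\<integral>\<omega>. exp (- l * x) \<partial>M)"
  proof (rule integral_cong_AE)
    have [measurable]: "X 0 \<in> borel_measurable M" using T by (intro R.X_M) auto
    show "(\<lambda>\<omega>. exp (- l * X 0 \<omega>)) \<in> borel_measurable M" by measurable
    show "AE \<omega> in M. exp (- l * X 0 \<omega>) = exp (- l * x)" using R.X_0 by eventually_elim simp
  qed simp
  then show ?thesis using True by (simp add: R.prob_space cir_laplace_def mult.commute)
next
  case False
  let ?b = "\<lambda>s. cir_scale \<theta> \<sigma> (t - s)"
  \<comment> \<open>At s = t the scale vanishes, so the terminal value is l. The primitive
    \<open>?P\<close> below is 0 at t and nonpositive before.\<close>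
  let ?p = "\<lambda>s. l * exp (- \<theta> * (t - s)) / (1 + l * ?b s)"
  let ?P = "\<lambda>s. - (2 / \<sigma>\<^sup>2) * ln (1 + l * ?b s)"
  have D: "1 + l * ?b s > 0" if "s \<in> {0..t}" for s
    using cir_scale_nonneg[of \<theta> "t - s" \<sigma>] that pos by (intro add_pos_nonneg) auto
  have b: "(?b has_real_derivative - (\<sigma>\<^sup>2 / 2 * exp (- \<theta> * (t - s)))) (at s within A)" for s A
    unfolding cir_scale_def using pos by (auto intro!: derivative_eq_intros simp: field_simps)
  interpret R: cir_riccati M F B \<theta> \<kappa> \<sigma> T x t X ?p ?P
  proof unfold_locales
    fix s assume s: "s \<in> {0..t}"
    show "(?p has_real_derivative \<theta> * ?p s + \<sigma>\<^sup>2 / 2 * (?p s)\<^sup>2) (at s within {0..t})"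
    proof -
      have "(?p has_real_derivative (l * (exp (- \<theta> * (t - s)) * \<theta>) * (1 + l * ?b s)
          - l * exp (- \<theta> * (t - s)) * (l * - (\<sigma>\<^sup>2 / 2 * exp (- \<theta> * (t - s))))) / ((1 + l * ?b s) * (1 + l * ?b s)))
        (at s within {0..t})"
        using D[OF s] by (auto intro!: derivative_eq_intros b)
      also have "(l * (exp (- \<theta> * (t - s)) * \<theta>) * (1 + l * ?b s)
          - l * exp (- \<theta> * (t - s)) * (l * - (\<sigma>\<^sup>2 / 2 * exp (- \<theta> * (t - s))))) / ((1 + l * ?b s) * (1 + l * ?b s))
        = \<theta> * ?p s + \<sigma>\<^sup>2 / 2 * (?p s)\<^sup>2"
      proof -
        have "(l * (e * \<theta>) * d - l * e * (l * - (\<sigma>\<^sup>2 / 2 * e))) / (d * d) = \<theta> * (l * e / d) + \<sigma>\<^sup>2 / 2 * (l * e / d)\<^sup>2"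
          if "d > 0" for d e :: real
          using that by (simp add: field_simps power2_eq_square)
        from this[OF D[OF s]] show ?thesis .
      qed
      finally show ?thesis .
    qed
    show "0 \<le> ?p s" using D[OF s] pos by simp
    show "(?P has_real_derivative ?p s) (at s within {0..t})"
    proof -
      have "(?P has_real_derivative - (2 / \<sigma>\<^sup>2) * ((l * - (\<sigma>\<^sup>2 / 2 * exp (- \<theta> * (t - s)))) / (1 + l * ?b s))) (at s within {0..t})"
      proof -
        have "((\<lambda>s. ln (1 + l * ?b s)) has_real_derivative (l * - (\<sigma>\<^sup>2 / 2 * exp (- \<theta> * (t - s)))) / (1 + l * ?b s)) (at s within {0..t})"
          using D[OF s] by (auto intro!: derivative_eq_intros b simp: algebra_simps)
        from DERIV_cmult[OF this, of "- (2 / \<sigma>\<^sup>2)"] show ?thesis .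
      qed
      also have "- (2 / \<sigma>\<^sup>2) * ((l * - (\<sigma>\<^sup>2 / 2 * exp (- \<theta> * (t - s)))) / (1 + l * ?b s)) = ?p s"
      proof -
        have "- (2 / \<sigma>\<^sup>2) * ((l * - (\<sigma>\<^sup>2 / 2 * e)) / d) = l * e / d" for d e :: real
          using pos by simp
        then show ?thesis .
      qed
      finally show ?thesis .
    qed
    have "0 \<le> ln (1 + l * ?b s)" using cir_scale_nonneg[of \<theta> "t - s" \<sigma>] s pos by (intro ln_ge_zero) auto
    then show "?P s \<le> ?P t" using pos by simp
  qed (use assms False in auto)
  have "R.c = l * exp (- \<theta> * t) / (1 + l * cir_scale \<theta> \<sigma> t) * x + 2 * \<theta> * \<kappa> / \<sigma>\<^sup>2 * ln (1 + l * cir_scale \<theta> \<sigma> t)"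
    unfolding R.c_def by simp
  then have c: "exp (- R.c) = cir_laplace \<theta> \<sigma> (2 * \<theta> * \<kappa> / \<sigma>\<^sup>2) t x l"
    using D[of 0] t by (simp add: cir_laplace_def powr_def exp_add[symmetric] mult_ac)
  have "exp (R.c - ?p t * X t \<omega>) = exp R.c * exp (- l * X t \<omega>)" for \<omega>
    by (simp add: exp_diff exp_minus field_simps)
  then have "exp R.c * (\<integral>\<omega>. exp (- l * X t \<omega>) \<partial>M) = 1"
    using R.exponential_moment by simp
  then have "(\<integral>\<omega>. exp (- l * X t \<omega>) \<partial>M) = exp (- R.c)"
    by (simp add: exp_minus field_simps)
  with c show ?thesis by simp
qed

section \<open>Partial derivatives\<close>

text \<open>Uniqueness of the one-sided derivative is taken from a nondegenerate closed interval,
  which near x coincides with the half line.\<close>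

lemma deriv_within_half_line:
  assumes "(f has_real_derivative D) (at x within {0..})" "0 \<le> x"
  shows "deriv_within {0..} f x = D"
proof -
  have e: "at x within {0..} = at x within {0..x + 1}"
    by (rule at_within_nhd[of _ "{..<x + 1}"]) auto
  have "(f has_vector_derivative D) (at x within {0..x + 1})"
    using assms(1) unfolding e by (simp add: has_real_derivative_iff_has_vector_derivative)
  then have "vector_derivative f (at x within {0..x + 1}) = D"
    using assms(2) by (intro vector_derivative_within_closed_interval) auto
  then show ?thesis unfolding deriv_within_def e .
qed

lemma deriv_within_interval:
  assumes "(f has_real_derivative D) (at t within {0..T})" "t \<in> {0..T}" "0 < T"
  shows "deriv_within {0..T} f t = D"
  unfolding deriv_within_def
  using assms by (intro vector_derivative_within_closed_interval) (auto simp: has_real_derivative_iff_has_vector_derivative)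

lemma C_k_on_has_derivative:
  assumes "C_k_on n {0..} f" "i < n" "0 \<le> z"
  shows "((deriv_within {0..} ^^ i) f has_real_derivative (deriv_within {0..} ^^ Suc i) f z) (at z within {0..})"
proof -
  have "(deriv_within {0..} ^^ i) f differentiable (at z within {0..})"
    using assms by (auto simp: C_k_on_def differentiable_on_def)
  then obtain D where D: "((deriv_within {0..} ^^ i) f has_real_derivative D) (at z within {0..})"
    unfolding real_differentiable_def by blast
  from deriv_within_half_line[OF D assms(3)] D show ?thesis by simp
qed

text \<open>Summing the exponents gives one weight for all derivatives; the factor 2 comes from 1 +
  z^k \<le> 2 (1 + z)^k.\<close>

lemma good_set_weighted:
  assumes "C_k_on n {0..} f" "good_set n f C k" "i \<le> n"
  shows "weighted (\<Sum>i\<le>n. k i) (2 * C i) ((deriv_within {0..} ^^ i) f)"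
proof (rule weighted_mono_exponent)
  show "k i \<le> (\<Sum>i\<le>n. k i)" by (rule member_le_sum) (use assms(3) in auto)
  have "\<bar>(deriv_within {0..} ^^ i) f z\<bar> \<le> 2 * C i * (1 + z) ^ k i" if z: "0 \<le> z" for z
  proof -
    have 1: "\<bar>(deriv_within {0..} ^^ i) f z\<bar> \<le> C i * (1 + z ^ k i)" and C: "0 \<le> C i"
      using assms(2,3) z by (auto simp: good_set_def)
    have "1 + z ^ k i \<le> (1 + z) ^ k i + (1 + z) ^ k i"
      using z by (intro add_mono one_le_power power_mono) auto
    then have "C i * (1 + z ^ k i) \<le> C i * ((1 + z) ^ k i + (1 + z) ^ k i)" by (rule mult_left_mono[OF _ C])
    with 1 show ?thesis by simp
  qed
  then show "weighted (k i) (2 * C i) ((deriv_within {0..} ^^ i) f)"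
    using assms(1,3) by (auto simp: weighted_def C_k_on_def)
qed

lemma poly_weighted_bound: "\<exists>a n. 0 \<le> a \<and> (\<forall>x\<ge>0. \<bar>poly p x\<bar> \<le> a * (1 + x) ^ n)" for p :: "real poly"
proof (induction p)
  case 0
  show ?case by (intro exI[of _ 0]) auto
next
  case (pCons c p)
  then obtain a n where a: "0 \<le> a" "\<And>x. 0 \<le> x \<Longrightarrow> \<bar>poly p x\<bar> \<le> a * (1 + x) ^ n" by blast
  have "\<bar>poly (pCons c p) x\<bar> \<le> (\<bar>c\<bar> + a) * (1 + x) ^ Suc n" if x: "0 \<le> x" for x
  proof -
    have 1: "\<bar>c\<bar> * 1 \<le> \<bar>c\<bar> * (1 + x) ^ Suc n" using x by (intro mult_left_mono one_le_power) auto
    have "\<bar>x * poly p x\<bar> = x * \<bar>poly p x\<bar>" using x by (simp add: abs_mult)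
    also have "\<dots> \<le> (1 + x) * (a * (1 + x) ^ n)" using x a(2)[OF x] by (intro mult_mono) auto
    finally have 2: "\<bar>x * poly p x\<bar> \<le> a * (1 + x) ^ Suc n" by (simp add: mult_ac)
    have "\<bar>poly (pCons c p) x\<bar> \<le> \<bar>c\<bar> + \<bar>x * poly p x\<bar>" by simp
    also have "\<dots> \<le> (\<bar>c\<bar> + a) * (1 + x) ^ Suc n" using 1 2 unfolding distrib_right by linarith
    finally show ?thesis .
  qed
  then show ?case using a(1) by (intro exI[of _ "\<bar>c\<bar> + a"] exI[of _ "Suc n"]) auto
qed

section \<open>A symbolic calculus for the partial derivatives\<close>

context cir_parameters
begin

text \<open>The exponential collects the factors from r applications of the intertwining relation;
  with this normalisation the x-derivative of w_r is exactly w_(r+1).\<close>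

definition w :: "real \<Rightarrow> (nat \<Rightarrow> real \<Rightarrow> real) \<Rightarrow> nat \<Rightarrow> real \<Rightarrow> real \<Rightarrow> real" where
  "w d f r t x = exp (- (real r * \<theta>) * t) * P (d + real r) (f r) t x"

text \<open>The partial derivatives of the semigroup are combinations, with coefficients polynomial in \<open>x\<close>
  and independent of \<open>f\<close>, of the functions \<open>w d f r\<close>; a pair \<open>(p, r)\<close> stands for \<open>p(x) w\<^sub>r(t, x)\<close>.\<close>

definition comb :: "real \<Rightarrow> (nat \<Rightarrow> real \<Rightarrow> real) \<Rightarrow> (real poly \<times> nat) list \<Rightarrow> real \<Rightarrow> real \<Rightarrow> real" where
  "comb d f L t x = (\<Sum>(p, r)\<leftarrow>L. poly p x * w d f r t x)"

definition D_x :: "(real poly \<times> nat) list \<Rightarrow> (real poly \<times> nat) list" where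
  "D_x L = concat (map (\<lambda>(p, r). [(pderiv p, r), (p, Suc r)]) L)"

text \<open>The first entry differentiates the exponential factor; the other two are the time
  derivative of the semigroup of dimension d + r, whose drift coefficient is (d + r) \<sigma>^2 / 2
  - \<theta> x.\<close>

definition D_t :: "real \<Rightarrow> (real poly \<times> nat) list \<Rightarrow> (real poly \<times> nat) list" where
  "D_t d L = concat (map (\<lambda>(p, r). [(smult (- (real r * \<theta>)) p, r),
     ([:(d + real r) * \<sigma>\<^sup>2 / 2, - \<theta>:] * p, Suc r), ([:0, \<sigma>\<^sup>2 / 2:] * p, Suc (Suc r))]) L)"

text \<open>The number of derivatives of \<open>f\<close> that a combination consumes, hence how
  often it may still be differentiated.\<close>

definition order_le :: "nat \<Rightarrow> (real poly \<times> nat) list \<Rightarrow> bool" where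
  "order_le n L \<longleftrightarrow> (\<forall>(p, r)\<in>set L. r \<le> n)"

lemma comb_simps [simp]:
  "comb d f [] t x = 0"
  "comb d f ((p, r) # L) t x = poly p x * w d f r t x + comb d f L t x"
  by (simp_all add: comb_def)

lemma D_x_simps [simp]:
  "D_x [] = []"
  "D_x ((p, r) # L) = (pderiv p, r) # (p, Suc r) # D_x L"
  by (simp_all add: D_x_def)

lemma D_t_simps [simp]:
  "D_t d [] = []"
  "D_t d ((p, r) # L) = (smult (- (real r * \<theta>)) p, r) # ([:(d + real r) * \<sigma>\<^sup>2 / 2, - \<theta>:] * p, Suc r)
     # ([:0, \<sigma>\<^sup>2 / 2:] * p, Suc (Suc r)) # D_t d L"
  by (simp_all add: D_t_def)

lemma order_le_simps [simp]: "order_le n []" "order_le n ((p, r) # L) \<longleftrightarrow> r \<le> n \<and> order_le n L"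
  by (auto simp: order_le_def)

lemma order_le_D_x: "order_le n L \<Longrightarrow> order_le (Suc n) (D_x L)"
  by (induction L) auto

lemma order_le_D_t: "order_le n L \<Longrightarrow> order_le (n + 2) (D_t d L)"
  by (induction L) auto

lemma order_le_iterate:
  "order_le (2 * i + j) ((D_x ^^ j) ((D_t d ^^ i) [(1, 0)]))"
proof (induction j)
  case 0
  show ?case
  proof (induction i)
    case (Suc i)
    then show ?case using order_le_D_t[of "2 * i"] by simp
  qed simp
next
  case (Suc j)
  then show ?case using order_le_D_x by simp
qed

text \<open>The constants are chosen before \<open>f\<close> and see it only through the weights;
  this is the source of the dependence on a good set alone.\<close>

lemma comb_bound:
  assumes d: "0 < d" and L: "order_le n L"
  shows "\<exists>K\<ge>0. \<exists>k\<ge>1. \<forall>f. (\<forall>i\<le>n. weighted m (C i) (f i)) \<longrightarrow>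
    (\<forall>t\<in>{0..T}. \<forall>x\<ge>0. \<bar>comb d f L t x\<bar> \<le> K * (1 + x ^ k))"
proof -
  have "\<exists>K\<ge>0. \<exists>N. \<forall>f. (\<forall>i\<le>n. weighted m (C i) (f i)) \<longrightarrow>
    (\<forall>t\<in>{0..T}. \<forall>x\<ge>0. \<bar>comb d f L t x\<bar> \<le> K * (1 + x) ^ N)"
    using L
  proof (induction L)
    case Nil
    then show ?case by (intro exI[of _ 0]) auto
  next
    case (Cons pr L)
    obtain p r where pr: "pr = (p, r)" by (cases pr)
    have r: "r \<le> n" and L: "order_le n L" using Cons.prems by (auto simp: pr)
    obtain K N where K: "0 \<le> K" "\<And>f t x. (\<forall>i\<le>n. weighted m (C i) (f i)) \<Longrightarrow> t \<in> {0..T} \<Longrightarrow> 0 \<le> x \<Longrightarrow> \<bar>comb d f L t x\<bar> \<le> K * (1 + x) ^ N"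
      using Cons.IH[OF L] by blast
    obtain a n' where a: "0 \<le> a" "\<And>x. 0 \<le> x \<Longrightarrow> \<bar>poly p x\<bar> \<le> a * (1 + x) ^ n'" using poly_weighted_bound[of p] by blast
    have dr: "0 < d + real r" using d by simp
    obtain A where A: "0 < A" "\<And>t x g C. t \<in> {0..T} \<Longrightarrow> 0 \<le> x \<Longrightarrow> weighted m C g \<Longrightarrow> \<bar>P (d + real r) g t x\<bar> \<le> C * A * (1 + x) ^ m"
      by (rule P_bound[OF dr]) blast
    let ?K = "a * (\<bar>C r\<bar> * A) + K" and ?N = "n' + m + N"
    have "\<bar>comb d f (pr # L) t x\<bar> \<le> ?K * (1 + x) ^ ?N"
      if f: "\<forall>i\<le>n. weighted m (C i) (f i)" and t: "t \<in> {0..T}" and x: "0 \<le> x" for f t x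
    proof -
      have "0 \<le> real r * \<theta> * t" using \<theta> t by simp
      then have e: "exp (- (real r * \<theta>) * t) \<le> 1" by simp
      have fr: "weighted m (C r) (f r)" using f r by blast
      have "\<bar>w d f r t x\<bar> = exp (- (real r * \<theta>) * t) * \<bar>P (d + real r) (f r) t x\<bar>"
        by (simp add: w_def abs_mult)
      also have "\<dots> \<le> 1 * \<bar>P (d + real r) (f r) t x\<bar>" using e by (intro mult_right_mono) auto
      also have "\<dots> \<le> \<bar>C r\<bar> * A * (1 + x) ^ m" using A(2)[OF t x fr] weighted_nonneg[OF fr] by simp
      finally have w: "\<bar>w d f r t x\<bar> \<le> \<bar>C r\<bar> * A * (1 + x) ^ m" .
      have "\<bar>poly p x * w d f r t x\<bar> \<le> (a * (1 + x) ^ n') * (\<bar>C r\<bar> * A * (1 + x) ^ m)"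
        unfolding abs_mult using a x A(1) by (intro mult_mono a(2) w) auto
      also have "\<dots> = a * (\<bar>C r\<bar> * A) * (1 + x) ^ (n' + m)" by (simp add: power_add)
      also have "\<dots> \<le> a * (\<bar>C r\<bar> * A) * (1 + x) ^ ?N" using a A(1) x by (intro mult_left_mono power_increasing) auto
      finally have 1: "\<bar>poly p x * w d f r t x\<bar> \<le> a * (\<bar>C r\<bar> * A) * (1 + x) ^ ?N" .
      have "\<bar>comb d f L t x\<bar> \<le> K * (1 + x) ^ N" by (rule K(2)[OF f t x])
      also have "\<dots> \<le> K * (1 + x) ^ ?N" using K(1) x by (intro mult_left_mono power_increasing) auto
      finally have 2: "\<bar>comb d f L t x\<bar> \<le> K * (1 + x) ^ ?N" .
      show ?thesis using 1 2 unfolding pr comb_simps distrib_right by linarith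
    qed
    moreover have "0 \<le> ?K" using a(1) A(1) K(1) by simp
    ultimately show ?case by blast
  qed
  then obtain K N where K: "0 \<le> K" "\<And>f t x. (\<forall>i\<le>n. weighted m (C i) (f i)) \<Longrightarrow> t \<in> {0..T} \<Longrightarrow> 0 \<le> x \<Longrightarrow> \<bar>comb d f L t x\<bar> \<le> K * (1 + x) ^ N"
    by blast
  \<comment> \<open>Return to the form 1 + x^k, via 1 + x \<le> 2 max 1 x; the successor of N makes
    the exponent at least 1.\<close>
  have "\<bar>comb d f L t x\<bar> \<le> K * 2 ^ Suc N * (1 + x ^ Suc N)"
    if "\<forall>i\<le>n. weighted m (C i) (f i)" "t \<in> {0..T}" "0 \<le> x" for f t x
  proof -
    have "(1 + x) ^ Suc N \<le> (2 * max 1 x) ^ Suc N" using that(3) by (intro power_mono) auto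
    also have "\<dots> = 2 ^ Suc N * max 1 x ^ Suc N" by (rule power_mult_distrib)
    also have "max 1 x ^ Suc N \<le> 1 + x ^ Suc N" using that(3) by (auto simp: max_def)
    finally have 1: "(1 + x) ^ Suc N \<le> 2 ^ Suc N * (1 + x ^ Suc N)" by simp
    have "\<bar>comb d f L t x\<bar> \<le> K * (1 + x) ^ N" by (rule K(2)[OF that])
    also have "\<dots> \<le> K * (1 + x) ^ Suc N" using K(1) that(3) by (intro mult_left_mono power_increasing) auto
    also have "\<dots> \<le> K * (2 ^ Suc N * (1 + x ^ Suc N))" using K(1) 1 by (intro mult_left_mono)
    finally show ?thesis by (simp only: mult.assoc)
  qed
  then show ?thesis using K(1) by (intro exI[of _ "K * 2 ^ Suc N"] conjI exI[of _ "Suc N"]) auto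
qed

end

locale cir_smooth = cir_parameters +
  fixes d T :: real and q m :: nat and C :: "nat \<Rightarrow> real" and f :: "nat \<Rightarrow> real \<Rightarrow> real"
  assumes d: "0 < d" and T: "0 < T"
    and der: "\<And>i z. i < q \<Longrightarrow> 0 \<le> z \<Longrightarrow> (f i has_real_derivative f (Suc i) z) (at z within {0..})"
    and wt: "\<And>i. i \<le> q \<Longrightarrow> weighted m (C i) (f i)"
begin

lemma d_pos: "0 < d + real r"
  using d by simp

lemma w_exp: "exp (- (real (Suc r) * \<theta>) * t) = exp (- (real r * \<theta>) * t) * exp (- \<theta> * t)"
proof -
  have "- (real (Suc r) * \<theta>) * t = - (real r * \<theta>) * t + - \<theta> * t" by (simp add: algebra_simps)
  then show ?thesis by (simp only: exp_add)
qed

lemma w_deriv_x: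
  assumes "r < q" "t \<in> {0..T}" "0 \<le> x"
  shows "(w d f r t has_real_derivative w d f (Suc r) t x) (at x within {0..})"
proof -
  have 1: "(P (d + real r) (f r) t has_real_derivative exp (- \<theta> * t) * P (d + real r + 1) (f (Suc r)) t x) (at x within {0..})"
    by (rule P_deriv_x[OF d_pos wt wt der]) (use assms in auto)
  have s: "d + real (Suc r) = d + real r + 1" by simp
  have "w d f (Suc r) t x = exp (- (real r * \<theta>) * t) * (exp (- \<theta> * t) * P (d + real r + 1) (f (Suc r)) t x)"
    by (simp only: w_def w_exp s mult.assoc)
  then show ?thesis
    using DERIV_cmult[OF 1, of "exp (- (real r * \<theta>) * t)"] by (simp only: w_def[abs_def])
qed

lemma w_deriv_t:
  assumes "r + 2 \<le> q" "t \<in> {0..T}" "0 \<le> x"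
  shows "((\<lambda>t. w d f r t x) has_real_derivative - (real r * \<theta>) * w d f r t x
    + ((d + real r) * \<sigma>\<^sup>2 / 2 - \<theta> * x) * w d f (Suc r) t x + \<sigma>\<^sup>2 / 2 * x * w d f (Suc (Suc r)) t x) (at t within {0..T})"
proof -
  let ?P1 = "P (d + real r + 1) (f (Suc r)) t x" and ?P2 = "P (d + real r + 2) (f (Suc (Suc r))) t x"
  have 1: "((\<lambda>t. P (d + real r) (f r) t x) has_real_derivative
      exp (- \<theta> * t) * ((d + real r) * \<sigma>\<^sup>2 / 2 - \<theta> * x) * ?P1
      + \<sigma>\<^sup>2 / 2 * x * (exp (- \<theta> * t))\<^sup>2 * ?P2) (at t within {0..T})"
    by (rule P_deriv_t[OF d_pos wt wt wt der der]) (use assms in auto)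
  have 2: "((\<lambda>t. exp (- (real r * \<theta>) * t)) has_real_derivative - (real r * \<theta>) * exp (- (real r * \<theta>) * t)) (at t within {0..T})"
    by (auto intro!: derivative_eq_intros)
  have s: "d + real (Suc r) = d + real r + 1" "d + real (Suc (Suc r)) = d + real r + 2" by simp_all
  have w1: "w d f (Suc r) t x = exp (- (real r * \<theta>) * t) * exp (- \<theta> * t) * ?P1"
    by (simp only: w_def w_exp s)
  have w2: "w d f (Suc (Suc r)) t x = exp (- (real r * \<theta>) * t) * exp (- \<theta> * t) * exp (- \<theta> * t) * ?P2"
    by (simp only: w_def w_exp s)
  have alg: "a * c * p + (c1 * k * p1 + k2 * c1\<^sup>2 * p2) * c = a * (c * p) + k * (c * c1 * p1) + k2 * (c * c1 * c1 * p2)"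
    for a c p c1 k p1 k2 p2 :: real
    by (simp add: algebra_simps power2_eq_square)
  show ?thesis
    unfolding w1 w2 unfolding w_def by (rule DERIV_cong[OF DERIV_mult[OF 2 1]]) (rule alg)
qed

lemma w_continuous:
  assumes "r \<le> q"
  shows "continuous_on ({0..T} \<times> {0..}) (\<lambda>p. w d f r (fst p) (snd p))"
  unfolding w_def
proof (rule continuous_on_mult)
  show "continuous_on ({0..T} \<times> {0..}) (\<lambda>p. exp (- (real r * \<theta>) * fst p))" by (intro continuous_intros)
  show "continuous_on ({0..T} \<times> {0..}) (\<lambda>p. P (d + real r) (f r) (fst p) (snd p))"
    using P_continuous[OF d_pos[of r] wt[OF assms], of T] by (simp add: split_beta')
qed

lemma comb_deriv_x:
  assumes "order_le n L" "n < q" "t \<in> {0..T}" "0 \<le> x"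
  shows "(comb d f L t has_real_derivative comb d f (D_x L) t x) (at x within {0..})"
  using assms(1)
proof (induction L)
  case Nil
  show ?case by (simp add: comb_def[abs_def])
next
  case (Cons pr L)
  obtain p r where pr: "pr = (p, r)" by (cases pr)
  have "((\<lambda>x. poly p x * w d f r t x + comb d f L t x) has_real_derivative
    (poly (pderiv p) x * w d f r t x + w d f (Suc r) t x * poly p x) + comb d f (D_x L) t x) (at x within {0..})"
    using Cons assms by (intro DERIV_add DERIV_mult w_deriv_x DERIV_subset[OF poly_DERIV]) (auto simp: pr)
  then show ?case by (simp add: pr algebra_simps)
qed

lemma comb_deriv_t:
  assumes "order_le n L" "n + 2 \<le> q" "t \<in> {0..T}" "0 \<le> x"
  shows "((\<lambda>t. comb d f L t x) has_real_derivative comb d f (D_t d L) t x) (at t within {0..T})"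
  using assms(1)
proof (induction L)
  case Nil
  show ?case by simp
next
  case (Cons pr L)
  obtain p r where pr: "pr = (p, r)" by (cases pr)
  have "((\<lambda>t. poly p x * w d f r t x + comb d f L t x) has_real_derivative
    poly p x * (- (real r * \<theta>) * w d f r t x
    + ((d + real r) * \<sigma>\<^sup>2 / 2 - \<theta> * x) * w d f (Suc r) t x + \<sigma>\<^sup>2 / 2 * x * w d f (Suc (Suc r)) t x) + comb d f (D_t d L) t x) (at t within {0..T})"
    using Cons assms by (intro DERIV_add DERIV_cmult w_deriv_t) (auto simp: pr)
  then show ?case by (simp add: pr algebra_simps)
qed

lemma comb_continuous:
  assumes "order_le q L"
  shows "continuous_on ({0..T} \<times> {0..}) (\<lambda>p. comb d f L (fst p) (snd p))"
  using assms
proof (induction L)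
  case Nil
  show ?case by simp
next
  case (Cons pr L)
  obtain p r where pr: "pr = (p, r)" by (cases pr)
  show ?case
    using Cons unfolding pr comb_simps by (intro continuous_on_add continuous_on_mult w_continuous continuous_on_poly continuous_on_snd continuous_on_id) auto
qed

text \<open>Agreement is required on the strip only: all derivatives are taken within it, so values
  elsewhere are irrelevant.\<close>

definition agrees :: "(real \<Rightarrow> real \<Rightarrow> real) \<Rightarrow> (real poly \<times> nat) list \<Rightarrow> bool" where
  "agrees u L \<longleftrightarrow> (\<forall>t\<in>{0..T}. \<forall>x\<ge>0. u t x = comb d f L t x)"

lemma agrees_x:
  assumes "agrees u L" "order_le n L" "n < q"
  shows "differentiable_x T u" "agrees (partial_x u) (D_x L)"
proof -
  have "(u t has_real_derivative comb d f (D_x L) t x) (at x within {0..})" if t: "t \<in> {0..T}" and x: "0 \<le> x" for t x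
  proof (rule has_field_derivative_transform_within[OF comb_deriv_x[OF assms(2,3) t x] zero_less_one])
    show "x \<in> {0..}" using x by simp
    show "comb d f L t y = u t y" if "y \<in> {0..}" for y using assms(1) t that by (simp add: agrees_def)
  qed
  note * = this
  show "differentiable_x T u"
    unfolding differentiable_x_def differentiable_on_def real_differentiable_def
    by (intro ballI exI, rule *) auto
  show "agrees (partial_x u) (D_x L)"
    unfolding agrees_def partial_x_def using deriv_within_half_line * by simp
qed

lemma agrees_t:
  assumes "agrees u L" "order_le n L" "n + 2 \<le> q"
  shows "differentiable_t T u" "agrees (partial_t T u) (D_t d L)"
proof -
  have "((\<lambda>s. u s x) has_real_derivative comb d f (D_t d L) t x) (at t within {0..T})" if t: "t \<in> {0..T}" and x: "0 \<le> x" for t x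
  proof (rule has_field_derivative_transform_within[OF comb_deriv_t[OF assms(2,3) t x] zero_less_one])
    show "t \<in> {0..T}" by (rule t)
    show "comb d f L s x = u s x" if "s \<in> {0..T}" for s using assms(1) x that by (simp add: agrees_def)
  qed
  note * = this
  show "differentiable_t T u"
    unfolding differentiable_t_def differentiable_on_def real_differentiable_def
    by (intro allI impI ballI exI, rule *) auto
  show "agrees (partial_t T u) (D_t d L)"
    unfolding agrees_def partial_t_def using deriv_within_interval[OF * _ T] by simp
qed

lemma agrees_continuous:
  assumes "agrees u L" "order_le q L"
  shows "jointly_continuous T u"
  unfolding jointly_continuous_def
  by (rule continuous_on_cong[THEN iffD2, OF refl _ comb_continuous[OF assms(2)]])
    (use assms(1) in \<open>auto simp: agrees_def\<close>)

lemma agrees_iterate: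
  assumes u: "agrees u [(1, 0)]" and ij: "2 * i + j \<le> q"
  shows "agrees ((partial_x ^^ j) ((partial_t T ^^ i) u)) ((D_x ^^ j) ((D_t d ^^ i) [(1, 0)]))"
  using ij
proof (induction j)
  case 0
  then show ?case
  proof (induction i)
    case (Suc i)
    have "agrees ((partial_t T ^^ i) u) ((D_t d ^^ i) [(1, 0)])" using Suc by simp
    from agrees_t(2)[OF this order_le_iterate[of i 0 d, simplified]] Suc.prems show ?case by simp
  qed (use u in simp)
next
  case (Suc j)
  from agrees_x(2)[OF Suc.IH order_le_iterate] Suc.prems show ?case by simp
qed

lemma C_tx_of_agrees:
  assumes u: "agrees u [(1, 0)]" and ml: "2 * a + b \<le> q"
  shows "C_tx T a b u"
  unfolding C_tx_def
proof (intro conjI allI impI)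
  fix i assume i: "i < a"
  show "differentiable_t T ((partial_t T ^^ i) u)"
    using agrees_t(1)[OF agrees_iterate[OF u, of i 0, simplified] order_le_iterate[of i 0 d, simplified]] i ml by simp
next
  fix i j assume i: "i \<le> a" and j: "j < b"
  show "differentiable_x T ((partial_x ^^ j) ((partial_t T ^^ i) u))"
    by (rule agrees_x(1)[OF agrees_iterate[OF u] order_le_iterate]) (use i j ml in auto)
next
  fix i j assume i: "i \<le> a" and j: "j \<le> b"
  have "order_le q ((D_x ^^ j) ((D_t d ^^ i) [(1, 0)]))"
    using order_le_iterate[of i j d] i j ml by (force simp: order_le_def)
  then show "jointly_continuous T ((partial_x ^^ j) ((partial_t T ^^ i) u))"
    by (rule agrees_continuous[OF agrees_iterate[OF u], rotated]) (use i j ml in auto)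
qed

text \<open>Both sides are symbolic derivatives of the same combination. For r = 0 the drift
  coefficient is d \<sigma>^2 / 2 - \<theta> x = \<theta> (\<kappa> - x), and the equation becomes
  an identity between combinations.\<close>

lemma kolmogorov_of_agrees:
  assumes u: "agrees u [(1, 0)]" and q: "4 \<le> q" and d': "d * \<sigma>\<^sup>2 / 2 = \<theta> * \<kappa>" and init: "\<And>x. 0 \<le> x \<Longrightarrow> u 0 x = g x"
  shows "classical_solution_kolmogorov \<theta> \<kappa> \<sigma> T g u"
  unfolding classical_solution_kolmogorov_def
proof (intro conjI ballI allI impI)
  show "C_tx T 1 0 u" "C_tx T 0 2 u" by (rule C_tx_of_agrees[OF u]; use q in simp)+
  show "u 0 x = g x" if "0 \<le> x" for x by (rule init[OF that])
  fix t x :: real assume t: "t \<in> {0..T}" and x: "0 \<le> x"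
  have 1: "partial_t T u t x = comb d f (D_t d [(1, 0)]) t x"
    using agrees_iterate[OF u, of 1 0] q t x by (simp add: agrees_def)
  have 2: "partial_x u t x = comb d f (D_x [(1, 0)]) t x"
    using agrees_iterate[OF u, of 0 1] q t x by (simp add: agrees_def)
  have 3: "partial_x (partial_x u) t x = comb d f (D_x (D_x [(1, 0)])) t x"
    using agrees_iterate[OF u, of 0 2] q t x by (simp add: agrees_def numeral_2_eq_2)
  have "deriv_within {0..} (u t) x = partial_x u t x" "(deriv_within {0..} ^^ 2) (u t) x = partial_x (partial_x u) t x"
    by (simp_all add: partial_x_def[abs_def] numeral_2_eq_2)
  then show "partial_t T u t x = cir_generator \<theta> \<kappa> \<sigma> (u t) x"
    unfolding cir_generator_def 1 2 3 using d' by (simp add: algebra_simps pderiv_1)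
qed

end

text \<open>Every mixed derivative, in whatever order it is taken, is again a combination of some
  order n. The locale is entered afresh with n + 2 derivatives each time, because its weights depend
  on the order while \<open>comb\<close> does not.\<close>

lemma (in cir_parameters) C_infinity_of_agrees:
  assumes d: "0 < d" and T: "0 < T" and C: "\<And>n. C_k_on n {0..} g" "\<And>n. \<exists>C k. good_set n g C k"
    and u: "\<And>t x. t \<in> {0..T} \<Longrightarrow> 0 \<le> x \<Longrightarrow> u t x = P d g t x"
  shows "C_infinity_tx T u"
proof -
  let ?f = "\<lambda>i. (deriv_within {0..} ^^ i) g"
  have sm: "\<exists>m C. cir_smooth \<theta> \<sigma> d T q m C ?f" for q
  proof -
    obtain C' k where "good_set q g C' k" using C(2) by blast
    then have "cir_smooth \<theta> \<sigma> d T q (\<Sum>i\<le>q. k i) (\<lambda>i. 2 * C' i) ?f"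
      by unfold_locales (use d T C_k_on_has_derivative[OF C(1)[of q]] good_set_weighted[OF C(1)[of q]] in auto)
    then show ?thesis by blast
  qed
  have "\<exists>L n. order_le n L \<and> (\<forall>t\<in>{0..T}. \<forall>x\<ge>0. h t x = comb d ?f L t x)" if "h \<in> iterated_partials T u" for h
    using that
  proof (induction rule: iterated_partials.induct)
    case 1
    have "comb d ?f [(1, 0)] t x = P d g t x" for t x by (simp add: w_def)
    then show ?case using u by (intro exI[of _ "[(1, 0)]"] exI[of _ 0]) simp
  next
    case (2 h)
    then obtain L n where L: "order_le n L" "\<forall>t\<in>{0..T}. \<forall>x\<ge>0. h t x = comb d ?f L t x" by blast
    obtain m C where "cir_smooth \<theta> \<sigma> d T (n + 2) m C ?f" using sm by blast
    then interpret S: cir_smooth \<theta> \<sigma> d T "n + 2" m C ?f .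
    have "S.agrees h L" using L(2) by (simp add: S.agrees_def)
    from S.agrees_t(2)[OF this L(1)] show ?case using order_le_D_t[OF L(1)] unfolding S.agrees_def by blast
  next
    case (3 h)
    then obtain L n where L: "order_le n L" "\<forall>t\<in>{0..T}. \<forall>x\<ge>0. h t x = comb d ?f L t x" by blast
    obtain m C where "cir_smooth \<theta> \<sigma> d T (n + 2) m C ?f" using sm by blast
    then interpret S: cir_smooth \<theta> \<sigma> d T "n + 2" m C ?f .
    have "S.agrees h L" using L(2) by (simp add: S.agrees_def)
    from S.agrees_x(2)[OF this L(1)] show ?case using order_le_D_x[OF L(1)] unfolding S.agrees_def by force
  qed
  note repr = this
  show ?thesis
    unfolding C_infinity_tx_def
  proof
    fix h assume "h \<in> iterated_partials T u"
    then obtain L n where L: "order_le n L" "\<forall>t\<in>{0..T}. \<forall>x\<ge>0. h t x = comb d ?f L t x" using repr by blast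
    obtain m C where "cir_smooth \<theta> \<sigma> d T (n + 2) m C ?f" using sm by blast
    then interpret S: cir_smooth \<theta> \<sigma> d T "n + 2" m C ?f .
    have a: "S.agrees h L" using L(2) by (simp add: S.agrees_def)
    have "order_le (n + 2) L" using L(1) by (force simp: order_le_def)
    then show "differentiable_t T h \<and> differentiable_x T h \<and> jointly_continuous T h"
      using S.agrees_t(1)[OF a L(1)] S.agrees_x(1)[OF a L(1)] S.agrees_continuous[OF a] by simp
  qed
qed

text \<open>Finitely many bounds merge by adding constants and exponents; the factor 2 comes from
  x^a \<le> 1 + x^b for a \<le> b.\<close>

lemma uniform_polynomial_bound:
  fixes h :: "'b \<Rightarrow> 'c \<Rightarrow> real \<Rightarrow> real"
  assumes "finite I" "\<And>p. p \<in> I \<Longrightarrow> \<exists>K\<ge>0. \<exists>k\<ge>1. \<forall>y. Q y \<longrightarrow> (\<forall>x\<ge>0. \<bar>h p y x\<bar> \<le> K * (1 + x ^ k))"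
  shows "\<exists>K\<ge>0. \<exists>k\<ge>1. \<forall>p\<in>I. \<forall>y. Q y \<longrightarrow> (\<forall>x\<ge>0. \<bar>h p y x\<bar> \<le> K * (1 + x ^ k))"
  using assms
proof (induction I)
  case empty
  show ?case by (intro exI[of _ 0] exI[of _ 1] conjI) auto
next
  case (insert p I)
  obtain K k where K: "0 \<le> K" "1 \<le> k" "\<And>p y x. p \<in> I \<Longrightarrow> Q y \<Longrightarrow> 0 \<le> x \<Longrightarrow> \<bar>h p y x\<bar> \<le> K * (1 + x ^ k)"
    using insert.IH insert.prems by (metis insertCI)
  obtain K' k' where K': "0 \<le> K'" "1 \<le> k'" "\<And>y x. Q y \<Longrightarrow> 0 \<le> x \<Longrightarrow> \<bar>h p y x\<bar> \<le> K' * (1 + x ^ k')"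
    using insert.prems[of p] by blast
  have grow: "L * (1 + x ^ a) \<le> (2 * (K + K')) * (1 + x ^ (k + k'))"
    if "L \<le> K + K'" "a \<le> k + k'" "0 \<le> x" for L x :: real and a
  proof -
    have "x ^ a \<le> 1 + x ^ (k + k')"
    proof (cases "x \<le> 1")
      case True
      then have "x ^ a \<le> 1" using that(3) by (intro power_le_one) auto
      moreover have "0 \<le> x ^ (k + k')" using that(3) by simp
      ultimately show ?thesis by linarith
    next
      case False
      then have "x ^ a \<le> x ^ (k + k')" using that(2) by (intro power_increasing) auto
      then show ?thesis by simp
    qed
    moreover have "0 \<le> x ^ (k + k')" using that(3) by simp
    ultimately have "1 + x ^ a \<le> 2 * (1 + x ^ (k + k'))" unfolding distrib_left by simp
    then have "L * (1 + x ^ a) \<le> (K + K') * (2 * (1 + x ^ (k + k')))"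
      using that K(1) K'(1) by (intro mult_mono) auto
    then show ?thesis by (simp only: mult_ac)
  qed
  have "\<bar>h p' y x\<bar> \<le> (2 * (K + K')) * (1 + x ^ (k + k'))" if "p' \<in> insert p I" "Q y" "0 \<le> x" for p' y x
  proof (cases "p' = p")
    case True
    have "\<bar>h p' y x\<bar> \<le> K' * (1 + x ^ k')" using K'(3)[OF that(2,3)] True by simp
    also have "\<dots> \<le> (2 * (K + K')) * (1 + x ^ (k + k'))" by (rule grow) (use K(1) that(3) in auto)
    finally show ?thesis .
  next
    case False
    have "\<bar>h p' y x\<bar> \<le> K * (1 + x ^ k)" using K(3)[OF _ that(2,3)] that(1) False by simp
    also have "\<dots> \<le> (2 * (K + K')) * (1 + x ^ (k + k'))" by (rule grow) (use K'(1) that(3) in auto)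
    finally show ?thesis .
  qed
  then show ?case using K(1,2) K'(1)
    by (intro exI[of _ "2 * (K + K')"] exI[of _ "k + k'"] conjI) auto
qed

lemma (in cir_parameters) cir_expectation_eq:
  assumes pos: "0 < \<kappa>" "0 < T" and fam: "cir_family \<theta> \<kappa> \<sigma> T M F B X" and f: "weighted m C f"
    and t: "t \<in> {0..T}" and x: "0 \<le> x"
  shows "integrable M (\<lambda>\<omega>. f (X x t \<omega>)) \<and> cir_expectation M X f t x = P (2 * \<theta> * \<kappa> / \<sigma>\<^sup>2) f t x"
  unfolding cir_expectation_def
proof (rule law_determined_by_laplace[OF _ _ _ _ _ x _ f])
  have bm: "brownian_motion M F B" and sol: "cir_solution \<theta> \<kappa> \<sigma> T M F B x (X x)"
    using fam x by (auto simp: cir_family_def)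
  interpret brownian M F B by unfold_locales (rule bm)
  show "prob_space M" by (rule prob_space_axioms)
  show "X x t \<in> borel_measurable M"
    by (rule measurable_F[of _ t]) (use sol t in \<open>auto simp: cir_solution_def\<close>)
  show "0 \<le> X x t \<omega>" if "\<omega> \<in> space M" for \<omega> using sol t that by (auto simp: cir_solution_def)
  show "0 < 2 * \<theta> * \<kappa> / \<sigma>\<^sup>2" using \<theta> \<sigma> pos by simp
  show "0 \<le> t" using t by simp
  show "(\<integral>\<omega>. exp (- l * X x t \<omega>) \<partial>M) = cir_laplace \<theta> \<sigma> (2 * \<theta> * \<kappa> / \<sigma>\<^sup>2) t x l" if "0 < l" for l
    by (rule cir_solution_laplace[OF bm sol \<theta> pos(1) \<sigma> that t pos(2)])
qed

lemma good_set_of_sequence: "good_sequence f C k \<Longrightarrow> good_set n f C k"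
  by (simp add: good_set_def good_sequence_def)

theorem theorem4:
  fixes \<theta> \<kappa> \<sigma> T :: real
  assumes "\<theta> > 0" and "\<kappa> > 0" and "\<sigma> > 0" and "\<sigma>\<^sup>2 \<le> 4 * \<theta> * \<kappa>" and "T > 0"
  shows
   "(\<forall>q\<ge>4.
       (\<forall>l l'. 2 * l + 4 * l' \<le> q \<longrightarrow>
          (\<forall>(M :: 'a measure) F B X f.
             cir_family \<theta> \<kappa> \<sigma> T M F B X \<longrightarrow> f \<in> C_pol q \<longrightarrow>
               (\<forall>t\<in>{0..T}. \<forall>x\<ge>0. integrable M (\<lambda>\<omega>. f (X x t \<omega>))) \<and>
               C_tx T l' l (cir_expectation M X f)) \<and>
          (\<forall>Cf kf. \<exists>C\<ge>0. \<exists>k\<ge>1.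
             \<forall>(M :: 'a measure) F B X f.
               cir_family \<theta> \<kappa> \<sigma> T M F B X \<longrightarrow> f \<in> C_pol q \<longrightarrow> good_set q f Cf kf \<longrightarrow>
                 (\<forall>j\<le>l. \<forall>i\<le>l'. \<forall>x\<ge>0. \<forall>t\<in>{0..T}.
                    \<bar>(partial_x ^^ j) ((partial_t T ^^ i) (cir_expectation M X f)) t x\<bar>
                      \<le> C * (1 + x ^ k)))) \<and>
       (\<forall>(M :: 'a measure) F B X f.
          cir_family \<theta> \<kappa> \<sigma> T M F B X \<longrightarrow> f \<in> C_pol q \<longrightarrow>
            classical_solution_kolmogorov \<theta> \<kappa> \<sigma> T f (cir_expectation M X f))) \<and>
    (\<forall>(M :: 'a measure) F B X f.
       cir_family \<theta> \<kappa> \<sigma> T M F B X \<longrightarrow> f \<in> C_pol_infinity \<longrightarrow>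
         C_infinity_tx T (cir_expectation M X f)) \<and>
    (\<forall>i j Cf kf. \<exists>C\<ge>0. \<exists>k\<ge>1.
       \<forall>(M :: 'a measure) F B X f.
         cir_family \<theta> \<kappa> \<sigma> T M F B X \<longrightarrow> f \<in> C_pol_infinity \<longrightarrow> good_sequence f Cf kf \<longrightarrow>
           (\<forall>x\<ge>0. \<forall>t\<in>{0..T}.
              \<bar>(partial_x ^^ j) ((partial_t T ^^ i) (cir_expectation M X f)) t x\<bar>
                \<le> C * (1 + x ^ k)))"
proof -
  interpret cir_parameters \<theta> \<sigma> by unfold_locales (use assms in auto)
  define d where "d = 2 * \<theta> * \<kappa> / \<sigma>\<^sup>2"
  have d: "0 < d" and d\<sigma>: "d * \<sigma>\<^sup>2 / 2 = \<theta> * \<kappa>" using assms by (simp_all add: d_def)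
  let ?D = "\<lambda>f i. (deriv_within {0..} ^^ i) f"
  have smooth: "cir_smooth \<theta> \<sigma> d T q (\<Sum>i\<le>q. k i) (\<lambda>i. 2 * C i) (?D f)"
    if "C_k_on q {0..} f" "good_set q f C k" for q f C k
    by unfold_locales (use d assms(5) C_k_on_has_derivative[OF that(1)] good_set_weighted[OF that] in auto)
  have expectation: "integrable M (\<lambda>\<omega>. f (X x t \<omega>)) \<and> cir_expectation M X f t x = P d f t x"
    if "cir_family \<theta> \<kappa> \<sigma> T M F B X" "C_k_on q {0..} f" "good_set q f C k" "t \<in> {0..T}" "0 \<le> x"
    for M :: "'a measure" and F B X q f C k t x
    using cir_expectation_eq[OF assms(2,5) that(1) _ that(4,5)] good_set_weighted[OF that(2,3), of 0]
    unfolding d_def by simp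
  have agree: "cir_smooth.agrees \<theta> \<sigma> d T (?D f) (cir_expectation M X f) [(1, 0)]"
    if "cir_family \<theta> \<kappa> \<sigma> T M F B X" "C_k_on q {0..} f" "good_set q f C k"
    for M :: "'a measure" and F B X q f C k
  proof -
    interpret S: cir_smooth \<theta> \<sigma> d T q "\<Sum>i\<le>q. k i" "\<lambda>i. 2 * C i" "?D f" by (rule smooth[OF that(2,3)])
    show ?thesis using expectation[OF that] by (simp add: S.agrees_def w_def)
  qed
  have regular: "C_tx T l' l (cir_expectation M X f)"
    if fam: "cir_family \<theta> \<kappa> \<sigma> T M F B X" and fC: "f \<in> C_pol q" and l: "2 * l + 4 * l' \<le> q"
    for M :: "'a measure" and F B X q f l l'
  proof -
    obtain C k where f: "C_k_on q {0..} f" "good_set q f C k" using fC by (auto simp: C_pol_def)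
    interpret S: cir_smooth \<theta> \<sigma> d T q "\<Sum>i\<le>q. k i" "\<lambda>i. 2 * C i" "?D f" by (rule smooth[OF f])
    show ?thesis by (rule S.C_tx_of_agrees[OF agree[OF fam f]]) (use l in simp)
  qed
  have kolmogorov: "classical_solution_kolmogorov \<theta> \<kappa> \<sigma> T f (cir_expectation M X f)"
    if fam: "cir_family \<theta> \<kappa> \<sigma> T M F B X" and fC: "f \<in> C_pol q" and q: "4 \<le> q"
    for M :: "'a measure" and F B X q f
  proof -
    obtain C k where f: "C_k_on q {0..} f" "good_set q f C k" using fC by (auto simp: C_pol_def)
    interpret S: cir_smooth \<theta> \<sigma> d T q "\<Sum>i\<le>q. k i" "\<lambda>i. 2 * C i" "?D f" by (rule smooth[OF f])
    show ?thesis
    proof (rule S.kolmogorov_of_agrees[OF agree[OF fam f] q d\<sigma>])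
      show "cir_expectation M X f 0 x = f x" if x: "0 \<le> x" for x
        using expectation[OF fam f, of 0 x] P_0[OF d x good_set_weighted[OF f, of 0, simplified]] x assms(5)
        by simp
    qed
  qed
  \<comment> \<open>The function and the time are bundled into one parameter y, since the constants
    must be uniform in both when finitely many pairs (i, j) are merged.\<close>
  have derivative_bound: "\<exists>K\<ge>0. \<exists>k\<ge>1. \<forall>y. (case y of (f, t) \<Rightarrow> (\<forall>r\<le>q. weighted m (C r) (f r)) \<and> t \<in> {0..T}) \<longrightarrow>
      (\<forall>x\<ge>0. \<bar>case y of (f, t) \<Rightarrow> comb d f ((D_x ^^ j) ((D_t d ^^ i) [(1, 0)])) t x\<bar> \<le> K * (1 + x ^ k))"
    if "2 * i + j \<le> q" for i j q m C
  proof -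
    have "order_le q ((D_x ^^ j) ((D_t d ^^ i) [(1, 0)]))"
      using order_le_iterate[of i j d] that by (force simp: order_le_def)
    from comb_bound[OF d this, of m C T] obtain K k where K: "0 \<le> K" "1 \<le> k"
      "\<And>f t x. \<forall>r\<le>q. weighted m (C r) (f r) \<Longrightarrow> t \<in> {0..T} \<Longrightarrow> 0 \<le> x \<Longrightarrow>
        \<bar>comb d f ((D_x ^^ j) ((D_t d ^^ i) [(1, 0)])) t x\<bar> \<le> K * (1 + x ^ k)" by blast
    show ?thesis
      by (intro exI[of _ K] exI[of _ k] conjI K(1,2)) (use K(3) in auto)
  qed
  have bounds: "\<exists>C\<ge>0. \<exists>k\<ge>1. \<forall>(M :: 'a measure) F B X f.
      cir_family \<theta> \<kappa> \<sigma> T M F B X \<longrightarrow> C_k_on q {0..} f \<longrightarrow> good_set q f Cf kf \<longrightarrow>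
        (\<forall>j\<le>l. \<forall>i\<le>l'. \<forall>x\<ge>0. \<forall>t\<in>{0..T}.
          \<bar>(partial_x ^^ j) ((partial_t T ^^ i) (cir_expectation M X f)) t x\<bar> \<le> C * (1 + x ^ k))"
    if ll: "2 * l' + l \<le> q" for q l l' Cf kf
  proof -
    let ?m = "\<Sum>i\<le>q. kf i" and ?C = "\<lambda>i. 2 * Cf i"
    let ?Q = "\<lambda>(f, t). (\<forall>r\<le>q. weighted ?m (?C r) (f r)) \<and> t \<in> {0..T}"
    let ?h = "\<lambda>(i, j) (f, t) x. comb d f ((D_x ^^ j) ((D_t d ^^ i) [(1, 0)])) t x"
    have "\<exists>K\<ge>0. \<exists>k\<ge>1. \<forall>p\<in>{..l'} \<times> {..l}. \<forall>y. ?Q y \<longrightarrow> (\<forall>x\<ge>0. \<bar>?h p y x\<bar> \<le> K * (1 + x ^ k))"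
    proof (rule uniform_polynomial_bound)
      fix p assume "p \<in> {..l'} \<times> {..l}"
      then obtain i j where p: "p = (i, j)" "2 * i + j \<le> q" using ll by auto
      from derivative_bound[OF p(2), of ?m ?C]
      show "\<exists>K\<ge>0. \<exists>k\<ge>1. \<forall>y. ?Q y \<longrightarrow> (\<forall>x\<ge>0. \<bar>?h p y x\<bar> \<le> K * (1 + x ^ k))"
        by (simp add: p(1) split_beta')
    qed simp
    then obtain K k where K: "0 \<le> K" "1 \<le> k"
      "\<And>p y x. p \<in> {..l'} \<times> {..l} \<Longrightarrow> ?Q y \<Longrightarrow> 0 \<le> x \<Longrightarrow> \<bar>?h p y x\<bar> \<le> K * (1 + x ^ k)" by blast
    have "\<bar>(partial_x ^^ j) ((partial_t T ^^ i) (cir_expectation M X f)) t x\<bar> \<le> K * (1 + x ^ k)"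
      if fam: "cir_family \<theta> \<kappa> \<sigma> T M F B X" and f: "C_k_on q {0..} f" "good_set q f Cf kf"
        and ij: "j \<le> l" "i \<le> l'" and x: "0 \<le> x" and t: "t \<in> {0..T}"
      for M :: "'a measure" and F B X f i j t x
    proof -
      interpret S: cir_smooth \<theta> \<sigma> d T q ?m ?C "?D f" by (rule smooth[OF f])
      have "2 * i + j \<le> q" using ij ll by linarith
      from S.agrees_iterate[OF agree[OF fam f] this]
      have "(partial_x ^^ j) ((partial_t T ^^ i) (cir_expectation M X f)) t x
          = comb d (?D f) ((D_x ^^ j) ((D_t d ^^ i) [(1, 0)])) t x"
        using t x by (simp add: S.agrees_def)
      moreover have "\<bar>?h (i, j) (?D f, t) x\<bar> \<le> K * (1 + x ^ k)"
        by (rule K(3)[OF _ _ x]) (use ij t S.wt in auto)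
      ultimately show ?thesis by simp
    qed
    then show ?thesis using K(1,2) by blast
  qed
  have int: "integrable M (\<lambda>\<omega>. f (X x t \<omega>))"
    if fam: "cir_family \<theta> \<kappa> \<sigma> T M F B X" and fC: "f \<in> C_pol q" and t: "t \<in> {0..T}" and x: "0 \<le> x"
    for M :: "'a measure" and F B X q f t x
  proof -
    obtain C k where f: "C_k_on q {0..} f" "good_set q f C k" using fC by (auto simp: C_pol_def)
    show ?thesis using expectation[OF fam f t x] by blast
  qed
  have infinity: "C_infinity_tx T (cir_expectation M X f)"
    if fam: "cir_family \<theta> \<kappa> \<sigma> T M F B X" and f: "f \<in> C_pol_infinity"
    for M :: "'a measure" and F B X f
  proof -
    obtain C k where "good_sequence f C k" using f by (auto simp: C_pol_infinity_def)
    then have C: "C_k_on n {0..} f" "good_set n f C k" for n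
      using f good_set_of_sequence by (auto simp: C_pol_infinity_def)
    show ?thesis
    proof (rule C_infinity_of_agrees[OF d assms(5) C(1)])
      show "\<exists>C k. good_set n f C k" for n using C(2) by blast
      show "cir_expectation M X f t x = P d f t x" if "t \<in> {0..T}" "0 \<le> x" for t x
        using expectation[OF fam C(1) C(2) that] by blast
    qed
  qed
  show ?thesis
  proof (intro conjI allI impI ballI)
    fix q l l' :: nat and M :: "'a measure" and F B X f
    assume l: "2 * l + 4 * l' \<le> q" and fam: "cir_family \<theta> \<kappa> \<sigma> T M F B X" and f: "f \<in> C_pol q"
    show "C_tx T l' l (cir_expectation M X f)" by (rule regular[OF fam f l])
    show "integrable M (\<lambda>\<omega>. f (X x t \<omega>))" if "t \<in> {0..T}" "0 \<le> x" for t x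
      by (rule int[OF fam f that])
  next
    fix q l l' :: nat and Cf kf
    assume "2 * l + 4 * l' \<le> q"
    then have "2 * l' + l \<le> q" by linarith
    from bounds[OF this, of Cf kf] obtain C k where C: "0 \<le> C" "1 \<le> k"
      and bound: "\<forall>(M :: 'a measure) F B X f.
        cir_family \<theta> \<kappa> \<sigma> T M F B X \<longrightarrow> C_k_on q {0..} f \<longrightarrow> good_set q f Cf kf \<longrightarrow>
          (\<forall>j\<le>l. \<forall>i\<le>l'. \<forall>x\<ge>0. \<forall>t\<in>{0..T}.
            \<bar>(partial_x ^^ j) ((partial_t T ^^ i) (cir_expectation M X f)) t x\<bar> \<le> C * (1 + x ^ k))"
      by (elim exE conjE)
    show "\<exists>C\<ge>0. \<exists>k\<ge>1. \<forall>(M :: 'a measure) F B X f.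
        cir_family \<theta> \<kappa> \<sigma> T M F B X \<longrightarrow> f \<in> C_pol q \<longrightarrow> good_set q f Cf kf \<longrightarrow>
          (\<forall>j\<le>l. \<forall>i\<le>l'. \<forall>x\<ge>0. \<forall>t\<in>{0..T}.
            \<bar>(partial_x ^^ j) ((partial_t T ^^ i) (cir_expectation M X f)) t x\<bar> \<le> C * (1 + x ^ k))"
    proof (intro exI[of _ C] exI[of _ k] conjI C(1,2) allI impI ballI)
      fix M :: "'a measure" and F B X f i j x t
      assume "cir_family \<theta> \<kappa> \<sigma> T M F B X" "f \<in> C_pol q" "good_set q f Cf kf" "j \<le> l" "i \<le> l'" "(0::real) \<le> x" "t \<in> {0..T}"
      then show "\<bar>(partial_x ^^ j) ((partial_t T ^^ i) (cir_expectation M X f)) t x\<bar> \<le> C * (1 + x ^ k)"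
        by (intro bound[rule_format]) (auto simp: C_pol_def)
    qed
  next
    fix q :: nat and M :: "'a measure" and F B X f
    assume "4 \<le> q" and "cir_family \<theta> \<kappa> \<sigma> T M F B X" and "f \<in> C_pol q"
    then show "classical_solution_kolmogorov \<theta> \<kappa> \<sigma> T f (cir_expectation M X f)"
      by (intro kolmogorov)
  next
    fix M :: "'a measure" and F B X f
    assume "cir_family \<theta> \<kappa> \<sigma> T M F B X" "f \<in> C_pol_infinity"
    then show "C_infinity_tx T (cir_expectation M X f)" by (rule infinity)
  next
    fix i j :: nat and Cf kf
    \<comment> \<open>A derivative of order (i, j) involves 2 i + j derivatives of f, so the bound
      reads only this initial part of the good sequence.\<close>
    have "2 * i + j \<le> 2 * i + j" ..
    from bounds[OF this, of Cf kf] obtain C k where C: "0 \<le> C" "1 \<le> k"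
      and bound: "\<forall>(M :: 'a measure) F B X f.
        cir_family \<theta> \<kappa> \<sigma> T M F B X \<longrightarrow> C_k_on (2 * i + j) {0..} f \<longrightarrow> good_set (2 * i + j) f Cf kf \<longrightarrow>
          (\<forall>j'\<le>j. \<forall>i'\<le>i. \<forall>x\<ge>0. \<forall>t\<in>{0..T}.
            \<bar>(partial_x ^^ j') ((partial_t T ^^ i') (cir_expectation M X f)) t x\<bar> \<le> C * (1 + x ^ k))"
      by (elim exE conjE)
    show "\<exists>C\<ge>0. \<exists>k\<ge>1. \<forall>(M :: 'a measure) F B X f.
         cir_family \<theta> \<kappa> \<sigma> T M F B X \<longrightarrow> f \<in> C_pol_infinity \<longrightarrow> good_sequence f Cf kf \<longrightarrow>
           (\<forall>x\<ge>0. \<forall>t\<in>{0..T}.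
              \<bar>(partial_x ^^ j) ((partial_t T ^^ i) (cir_expectation M X f)) t x\<bar> \<le> C * (1 + x ^ k))"
    proof (intro exI[of _ C] exI[of _ k] conjI C(1,2) allI impI ballI)
      fix M :: "'a measure" and F B X f x t
      assume "cir_family \<theta> \<kappa> \<sigma> T M F B X" "f \<in> C_pol_infinity" "good_sequence f Cf kf" "(0::real) \<le> x" "t \<in> {0..T}"
      then show "\<bar>(partial_x ^^ j) ((partial_t T ^^ i) (cir_expectation M X f)) t x\<bar> \<le> C * (1 + x ^ k)"
        by (intro bound[rule_format] good_set_of_sequence) (auto simp: C_pol_infinity_def)
    qed
  qed
qed

end
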